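(* Let $d\ge 1$ be an integer, $\sigma\in(0,1)$, $\mathcal L=-\Delta+(-\Delta)^\sigma$ on $\mathbb R^d$, $r\ge 0$ and $p>1$. Consider the problem $$u_t+\mathcal L u=t^r\,(1+u)\,[\ln(1+u)]^p\ \text{ in }\mathbb R^d\times(0,\infty),\qquad u(\cdot,0)=u_0 .$$ This problem has no global (mild) solution for any positive initial datum $u_0\in C_0(\mathbb R^d)\cap L^1(\mathbb R^d)$ (that is, for every such $u_0$ there is no global solution) if and only if $$1<p\le 1+\frac{2\sigma(1+r)}{d}.$$
   Context: $C_0(\mathbb R^d)$ is the space of continuous functions on $\mathbb R^d$ vanishing at infinity. For $\sigma\in(0,1)$, $(-\Delta)^\sigma v(x)=C_{d,\sigma}\,\mathrm{P.V.}\int_{\mathbb R^d}\frac{v(x)-v(y)}{|x-y|^{d+2\sigma}}\,dy$ with $C_{d,\sigma}=\frac{2^{2\sigma-1}\,2\sigma\,\Gamma(\frac{d+2\sigma}{2})}{\pi^{d/2}\Gamma(1-\sigma)}$ is the fractional Laplacian (Fourier multiplier $|\xi|^{2\sigma}$). The heat semigroup generated by $-\mathcal L$ is $e^{-t\mathcal L}\phi(x)=\int_{\mathbb R^d}p_t(x-y)\phi(y)\,dy$, where $p_t(x)=(4\pi t)^{-d/2}\int_{\mathbb R^d}e^{-|x-\xi|^2/(4t)}H^\sigma_t(\xi)\,d\xi$ for $t>0$, and $H_t^\sigma$ is the heat kernel of $(-\Delta)^\sigma$. Mild solution of $u_t+\mathcal L u=h(t)f(u)$, $u(\cdot,0)=u_0$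 (here $h(t)=t^r$, $f(u)=(1+u)[\ln(1+u)]^p$): for nonnegative nontrivial $u_0\in L^\infty(\mathbb R^d)$ there is a nonnegative local-in-time mild solution $u\in C([0,T_{\max});L^\infty(\mathbb R^d))$ with maximal existence time $T_{\max}\le\infty$, i.e. $u(x,t)=e^{-t\mathcal L}u_0(x)+\int_0^t e^{-(t-s)\mathcal L}h(s)f(u(x,s))\,ds$ for all $t\in[0,T_{\max})$. It is global if $T_{\max}=\infty$; it blows up in finite time if $T_{\max}<\infty$, in which case $\lim_{t\to T_{\max}}\|u(\cdot,t)\|_{L^\infty(\mathbb R^d)}=\infty$. *)

theory Defs
  imports "HOL-Analysis.Analysis" "HOL-Probability.Essential_Supremum"
begin

text \<open>The Euclidean space \<open>\<real>\<^sup>d\<close> is a type \<open>'a::euclidean_space\<close> with \<open>d = DIM('a) \<ge> 1\<close>.\<close>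

definition C0 :: "('a::euclidean_space \<Rightarrow> real) set" where
  "C0 = {\<phi>. continuous_on UNIV \<phi> \<and> (\<phi> \<longlongrightarrow> 0) at_infinity}"

text \<open>Elements of \<open>L\<^sup>\<infinity>\<close> are represented by Borel functions, and equality in \<open>L\<^sup>\<infinity>\<close> by
  almost-everywhere equality.\<close>

definition Linf_norm :: "('a::euclidean_space \<Rightarrow> real) \<Rightarrow> ennreal" where
  "Linf_norm \<phi> = esssup lborel (\<lambda>x. ennreal \<bar>\<phi> x\<bar>)"

definition Linf :: "('a::euclidean_space \<Rightarrow> real) set" where
  "Linf = {\<phi>. \<phi> \<in> borel_measurable lborel \<and> Linf_norm \<phi> < \<infinity>}"

definition frac_laplacian_symbol :: "real \<Rightarrow> 'a::euclidean_space \<Rightarrow> real" where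
  "frac_laplacian_symbol \<sigma> \<xi> = norm \<xi> powr (2 * \<sigma>)"

text \<open>The heat kernel \<open>H\<^sub>t\<close> of \<open>(-\<Delta>)\<^sup>\<sigma>\<close>, i.e. the inverse Fourier transform of
  \<open>exp (-t \<bar>\<xi>\<bar>\<^bsup>2\<sigma>\<^esup>)\<close>. The integral is real because the symbol is even.\<close>

definition frac_heat_kernel :: "real \<Rightarrow> real \<Rightarrow> 'a::euclidean_space \<Rightarrow> real" where
  "frac_heat_kernel \<sigma> t x =
     Re (LINT \<xi>|lborel. cis (x \<bullet> \<xi>) * of_real (exp (- t * frac_laplacian_symbol \<sigma> \<xi>)))
       / (2 * pi) ^ DIM('a)"

text \<open>The heat kernel \<open>p\<^sub>t\<close> of \<open>\<L> = -\<Delta> + (-\<Delta>)\<^sup>\<sigma>\<close>, for \<open>t > 0\<close>: the Gauss kernel convolved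
  with \<open>H\<^sub>t\<close>.\<close>

definition mixed_heat_kernel :: "real \<Rightarrow> real \<Rightarrow> 'a::euclidean_space \<Rightarrow> real" where
  "mixed_heat_kernel \<sigma> t x =
     (4 * pi * t) powr (- real DIM('a) / 2) *
     (LINT \<xi>|lborel. exp (- (norm (x - \<xi>))\<^sup>2 / (4 * t)) * frac_heat_kernel \<sigma> t \<xi>)"

text \<open>\<open>e\<^bsup>-t\<L>\<^esup>\<close> for \<open>t \<ge> 0\<close>, with \<open>e\<^bsup>-0\<L>\<^esup>\<close> the identity.\<close>

definition heat_semigroup ::
    "real \<Rightarrow> real \<Rightarrow> ('a::euclidean_space \<Rightarrow> real) \<Rightarrow> 'a \<Rightarrow> real" where
  "heat_semigroup \<sigma> t \<phi> x =
     (if t = 0 then \<phi> x else LINT y|lborel. mixed_heat_kernel \<sigma> t (x - y) * \<phi> y)"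

text \<open>Nonnegative mild solutions \<open>u \<in> C([0,T); L\<^sup>\<infinity>)\<close>, \<open>0 < T \<le> \<infinity>\<close>, of
  \<open>u\<^sub>t + \<L> u = h(t) f(u)\<close>, \<open>u(\<cdot>,0) = u\<^sub>0\<close>; here \<open>u t x\<close> stands for \<open>u(x,t)\<close>.
  The time integral is taken pointwise in \<open>x\<close>: for \<open>s < t\<close> its integrand does not depend on
  the representative of \<open>u(\<cdot>,s)\<close>, and \<open>s = t\<close> is a null set.\<close>

definition mild_solution ::
    "real \<Rightarrow> (real \<Rightarrow> real) \<Rightarrow> (real \<Rightarrow> real) \<Rightarrow> ('a::euclidean_space \<Rightarrow> real) \<Rightarrow>
     ereal \<Rightarrow> (real \<Rightarrow> 'a \<Rightarrow> real) \<Rightarrow> bool" where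
  "mild_solution \<sigma> h f u0 T u \<longleftrightarrow>
     0 < T \<and>
     (let I = {t. 0 \<le> t \<and> ereal t < T} in
        (\<forall>t\<in>I. u t \<in> Linf \<and> (AE x in lborel. 0 \<le> u t x)) \<and>
        (\<forall>t\<in>I. ((\<lambda>s. Linf_norm (\<lambda>x. u s x - u t x)) \<longlongrightarrow> 0) (at t within I)) \<and>
        (\<forall>t\<in>I. AE x in lborel.
           u t x = heat_semigroup \<sigma> t u0 x +
             (LINT s:{0..t}|lborel. heat_semigroup \<sigma> (t - s) (\<lambda>y. h s * f (u s y)) x)))"

definition global_mild_solution ::
    "real \<Rightarrow> (real \<Rightarrow> real) \<Rightarrow> (real \<Rightarrow> real) \<Rightarrow> ('a::euclidean_space \<Rightarrow> real) \<Rightarrow>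
     (real \<Rightarrow> 'a \<Rightarrow> real) \<Rightarrow> bool" where
  "global_mild_solution \<sigma> h f u0 u \<longleftrightarrow> mild_solution \<sigma> h f u0 \<infinity> u"

end

(*
Write S(a,b) for the inverse Fourier transform of exp(-a|xi|^2 - b|xi|^(2 sigma)), so that p_t = S(t,t), and put
beta = d/(2 sigma).  S(a,b) is nonnegative because |xi|^(2 sigma) is a limit of compound Poisson exponents
int (1 - exp(-s|xi|^2)) w(s) ds, which make S(a,b) a limit of mixtures of Gaussians; it has mass one and satisfies
S(a,b) * S(a',b') = S(a+a',b+b') by Fourier inversion.  By scaling, S(1+t,t) <= A (1+t)^(-beta), and
p_t >= c t^(-beta) on the ball of radius R t^(1/(2 sigma)) for t >= 1.

Nonexistence: for a global solution u the function J(t) = (e^(-(T-t)L) u(t))(0) satisfies, by the semigroup property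
and Jensen's inequality, J' >= t^r f(J) on (0,T).  Since 1/f has the antiderivative -ln(1+v)^(1-p)/(p-1), this forces
ln(1+J(t)) <= C T^(-(r+1)/(p-1)) for T >= 2t.  If p <= 1 + 2 sigma(1+r)/d, the right-hand side is at most C T^(-beta), and
T -> infinity bounds the mass of u(t) uniformly in t.  But u(s) >= e^(-sL) u_0 >= c s^(-beta) on balls of volume
~ s^beta, so the mass of u(t) grows at least like int^t s^(r - beta(p-1)) ds >= ln t, a contradiction.

Existence: if p > 1 + 2 sigma(1+r)/d and u_0 = e S(1,0) with e small, then 2e S(1+t,t) is a supersolution, because
int s^r (1+s)^(-beta(p-1)) ds is finite.  Monotone iteration from 0 below it gives a global mild solution.
*)
theory Submission
  imports Defs "HOL-Probability.Probability" "HOL-Real_Asymp.Real_Asymp"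
begin

section \<open>Lebesgue integrals on Euclidean space\<close>

text \<open>Two parameters are kept because members off the diagonal are needed: the datum S(1,0),
  its evolution S(1+t,t), and the two factors of p_t. Starting one unit of heat time late keeps
  S(1+t,t) bounded down to t = 0, where p_t is singular. Nonnegativity must precede inversion: at
  first S is only an oscillatory integral, and it is positivity that turns convergence of
  Gaussian-damped integrals into integrability. Low frequencies govern large times, and there
  |xi|^(2 sigma) outweighs |xi|^2; hence beta is the decay rate of the fractional part. The source
  behaves like v^p for small v, which fixes the threshold; at the threshold itself the mass diverges
  only logarithmically, so a bound on the mass uniform in time is required. Most estimates on
  solutions are done in \<open>ennreal\<close>, where Tonelli and monotone limits are free of
  integrability conditions; inequalities there are arranged as sums, without subtraction. To get
  there, a mild solution is first replaced by a jointly measurable representative.\<close>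

lemma lborel_eq_distr_PiM:
  "(lborel :: 'a::euclidean_space measure) =
     distr (\<Pi>\<^sub>M b\<in>Basis. lborel) borel (\<lambda>f. \<Sum>b\<in>Basis. f b *\<^sub>R b)"
  by (simp add: lborel_def[where 'a='a] lborel_eq_real)

text \<open>Fubini over the coordinates. It carries one-dimensional facts over to d dimensions: the
  Gaussian Fourier transform, and the integrability of a product of Cauchy profiles.\<close>

lemma
  fixes f :: "'a::euclidean_space \<Rightarrow> real \<Rightarrow> 'b::{real_normed_field,banach,second_countable_topology}"
  assumes f: "\<And>b. b \<in> Basis \<Longrightarrow> integrable lborel (f b)"
  shows integrable_lborel_prod: "integrable lborel (\<lambda>x. \<Prod>b\<in>Basis. f b (x \<bullet> b))"
    and integral_lborel_prod:
      "(LINT x|lborel. (\<Prod>b\<in>Basis. f b (x \<bullet> b))) = (\<Prod>b\<in>Basis. LINT x|lborel. f b x)"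
proof -
  interpret product_sigma_finite "\<lambda>_::'a. lborel :: real measure" by standard
  have [measurable]: "\<And>b. b \<in> Basis \<Longrightarrow> f b \<in> borel_measurable borel"
    using f borel_measurable_integrable by fastforce
  have eq: "(\<Prod>b\<in>Basis. f b ((\<Sum>i\<in>Basis. w i *\<^sub>R i) \<bullet> b)) = (\<Prod>b\<in>Basis. f b (w b))" for w
    by (intro prod.cong refl) simp
  show "integrable lborel (\<lambda>x. \<Prod>b\<in>Basis. f b (x \<bullet> b))"
    unfolding lborel_eq_distr_PiM[where 'a='a]
    by (subst integrable_distr_eq) (auto simp: eq intro!: product_integrable_prod f)
  show "(LINT x|lborel. (\<Prod>b\<in>Basis. f b (x \<bullet> b))) = (\<Prod>b\<in>Basis. LINT x|lborel. f b x)"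
    unfolding lborel_eq_distr_PiM[where 'a='a]
    by (subst integral_distr) (auto simp: eq intro!: product_integral_prod f)
qed

lemma nn_integral_lborel_affine:
  fixes t :: "'a::euclidean_space"
  assumes [measurable]: "f \<in> borel_measurable borel" and c: "c \<noteq> 0"
  shows "(\<integral>\<^sup>+x. f x \<partial>lborel) = ennreal (\<bar>c\<bar> ^ DIM('a)) * (\<integral>\<^sup>+x. f (t + c *\<^sub>R x) \<partial>lborel)"
proof -
  have "(\<integral>\<^sup>+x. f x \<partial>lborel) =
      integral\<^sup>N (density (distr lborel borel (\<lambda>x. t + c *\<^sub>R x)) (\<lambda>_. ennreal (\<bar>c\<bar> ^ DIM('a)))) f"
    by (rule arg_cong[OF lborel_affine[OF c, of t]])
  also have "\<dots> = ennreal (\<bar>c\<bar> ^ DIM('a)) * (\<integral>\<^sup>+x. f (t + c *\<^sub>R x) \<partial>lborel)"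
    by (simp add: nn_integral_density nn_integral_distr nn_integral_cmult)
  finally show ?thesis .
qed

lemma
  fixes t :: "'a::euclidean_space" and f :: "'a \<Rightarrow> real"
  assumes c: "c \<noteq> 0" and f: "integrable lborel f"
  shows integrable_lborel_affine: "integrable lborel (\<lambda>x. f (t + c *\<^sub>R x))"
    and integral_lborel_affine:
      "(LINT x|lborel. f x) = \<bar>c\<bar> ^ DIM('a) * (LINT x|lborel. f (t + c *\<^sub>R x))"
proof -
  have [measurable]: "f \<in> borel_measurable borel" using f by auto
  show 1: "integrable lborel (\<lambda>x. f (t + c *\<^sub>R x))"
    using f nn_integral_lborel_affine[of "\<lambda>x. ennreal (norm (f x))" c t] c
    by (auto simp: integrable_iff_bounded ennreal_mult_less_top)
  show "(LINT x|lborel. f x) = \<bar>c\<bar> ^ DIM('a) * (LINT x|lborel. f (t + c *\<^sub>R x))"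
  proof -
    have "(LINT x|lborel. f x) = integral\<^sup>L (density (distr lborel borel (\<lambda>x. t + c *\<^sub>R x)) (\<lambda>_. ennreal (\<bar>c\<bar> ^ DIM('a)))) f"
      by (rule arg_cong[OF lborel_affine[OF c, of t]])
    also have "\<dots> = (LINT x|distr lborel borel (\<lambda>x. t + c *\<^sub>R x). \<bar>c\<bar> ^ DIM('a) *\<^sub>R f x)"
      by (rule integral_density) auto
    also have "\<dots> = (LINT x|lborel. \<bar>c\<bar> ^ DIM('a) *\<^sub>R f (t + c *\<^sub>R x))"
      by (rule integral_distr) auto
    finally show ?thesis by simp
  qed
qed

section \<open>Gaussian Fourier transforms and integrability of the symbols\<close>

lemma borel_measurable_cis [measurable]: "cis \<in> borel_measurable borel"
  by (intro borel_measurable_continuous_onI continuous_intros)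

text \<open>A dilation by sqrt (2a) in the characteristic function of the standard normal law,
  multiplied by sqrt (2 pi) to undo its normalisation.\<close>

lemma gaussian_fourier_real:
  fixes a t :: real assumes a: "0 < a"
  shows "has_bochner_integral lborel (\<lambda>x. cis (t * x) * of_real (exp (- a * x\<^sup>2)))
           (of_real (sqrt (pi / a) * exp (- t\<^sup>2 / (4 * a))))"
proof -
  let ?c = "sqrt (2 * a)"
  let ?g = "\<lambda>x. std_normal_density x *\<^sub>R cis (t / ?c * x)"
  have c: "?c > 0" using a by simp
  have int: "integrable lborel ?g"
    by (rule Bochner_Integration.integrable_bound[of _ std_normal_density]) auto
  have I: "(LINT x|lborel. ?g x) = of_real (exp (- (t / ?c)\<^sup>2 / 2))"
    using fun_cong[OF char_std_normal_distribution, of "t / ?c"]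
    by (simp add: char_def integral_density cis_conv_exp)
  have "has_bochner_integral lborel ?g (of_real (exp (- (t / ?c)\<^sup>2 / 2)))"
    using int I by (simp add: has_bochner_integral_iff)
  then have "has_bochner_integral lborel (\<lambda>x. ?g (0 + ?c * x)) (of_real (exp (- (t / ?c)\<^sup>2 / 2)) /\<^sub>R \<bar>?c\<bar>)"
    using lborel_has_bochner_integral_real_affine_iff[of ?c ?g "of_real (exp (- (t / ?c)\<^sup>2 / 2))" 0] c by simp
  then have "has_bochner_integral lborel (\<lambda>x. sqrt (2 * pi) *\<^sub>R ?g (0 + ?c * x))
       (sqrt (2 * pi) *\<^sub>R (of_real (exp (- (t / ?c)\<^sup>2 / 2)) /\<^sub>R \<bar>?c\<bar>))"
    by (rule has_bochner_integral_scaleR_right)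
  moreover have "sqrt (2 * pi) *\<^sub>R ?g (0 + ?c * x) = cis (t * x) * of_real (exp (- a * x\<^sup>2))" for x
    using a c by (simp add: std_normal_density_def scaleR_conv_of_real power_mult_distrib)
  moreover have "sqrt (2 * pi) *\<^sub>R (of_real (exp (- (t / ?c)\<^sup>2 / 2)) /\<^sub>R \<bar>?c\<bar>)
      = (of_real (sqrt (pi / a) * exp (- t\<^sup>2 / (4 * a))) :: complex)"
  proof -
    have "sqrt (2 * pi) / ?c = sqrt (pi / a)" using a by (simp add: real_sqrt_divide[symmetric])
    moreover have "(t / ?c)\<^sup>2 / 2 = t\<^sup>2 / (4 * a)" using a by (simp add: power_divide)
    moreover have "sqrt (2 * pi) *\<^sub>R (of_real E /\<^sub>R \<bar>?c\<bar>) = (of_real (sqrt (2 * pi) / ?c * E) :: complex)" for E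
      using c by (simp only: scaleR_conv_of_real of_real_mult of_real_divide of_real_inverse abs_of_pos divide_inverse mult.assoc)
    ultimately show ?thesis by (simp only: minus_divide_left[symmetric])
  qed
  ultimately show ?thesis by (simp only:)
qed

lemma norm_sq_eq_sum: "(norm (x::'a::euclidean_space))\<^sup>2 = (\<Sum>b\<in>Basis. (x \<bullet> b)\<^sup>2)"
  by (subst power2_norm_eq_inner, subst euclidean_inner) (simp add: power2_eq_square)

text \<open>\<open>cis\<close> and \<open>exp\<close> turn sums over \<open>Basis\<close> into
  products, so the integrand factors into one-dimensional ones. Cosines alone do not factor, hence
  the detour through complex values, with the real part taken at the end.\<close>

lemma
  fixes x :: "'a::euclidean_space" assumes a: "0 < a"
  shows gaussian_fourier: "(LINT \<xi>|lborel. cos (x \<bullet> \<xi>) * exp (- a * (norm \<xi>)\<^sup>2))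
           = sqrt (pi / a) ^ DIM('a) * exp (- (norm x)\<^sup>2 / (4 * a))"
    and integrable_gaussian: "integrable lborel (\<lambda>\<xi>::'a. exp (- a * (norm \<xi>)\<^sup>2))"
proof -
  have cis_sum: "cis (\<Sum>i\<in>A. g i) = (\<Prod>i\<in>A. cis (g i))" for g and A :: "'a set"
    by (induction A rule: infinite_finite_induct) (simp_all flip: cis_mult)
  define F where "F = (\<lambda>(x::'a) (\<xi>::'a). \<Prod>b\<in>Basis. cis ((x \<bullet> b) * (\<xi> \<bullet> b)) * of_real (exp (- a * (\<xi> \<bullet> b)\<^sup>2)))"
  have F: "F x \<xi> = cis (x \<bullet> \<xi>) * of_real (exp (- a * (norm \<xi>)\<^sup>2))" for x \<xi>
    unfolding F_def prod.distrib
    by (simp add: euclidean_inner[of x \<xi>] cis_sum norm_sq_eq_sum sum_distrib_left exp_sum sum_negf[symmetric]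
)
  have g: "integrable lborel (\<lambda>x. cis (t * x) * complex_of_real (exp (- a * x\<^sup>2)))"
      "(LINT x|lborel. cis (t * x) * complex_of_real (exp (- a * x\<^sup>2))) =
        of_real (sqrt (pi / a) * exp (- t\<^sup>2 / (4 * a)))" for t
    using gaussian_fourier_real[OF a, of t] by (auto simp only: has_bochner_integral_iff)
  have int: "integrable lborel (F x)" for x
    unfolding F_def by (rule integrable_lborel_prod[OF g(1)])
  have I: "integral\<^sup>L lborel (F x) = of_real (sqrt (pi / a) ^ DIM('a) * exp (- (norm x)\<^sup>2 / (4 * a)))"
    unfolding F_def integral_lborel_prod[OF g(1), of "\<lambda>b. x \<bullet> b"] g(2)
    by (simp add: prod.distrib norm_sq_eq_sum exp_sum sum_negf[symmetric] sum_divide_distrib)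
  have "(LINT \<xi>|lborel. Re (F x \<xi>)) = Re (integral\<^sup>L lborel (F x))"
    using int by simp
  then show "(LINT \<xi>|lborel. cos (x \<bullet> \<xi>) * exp (- a * (norm \<xi>)\<^sup>2))
           = sqrt (pi / a) ^ DIM('a) * exp (- (norm x)\<^sup>2 / (4 * a))"
    by (simp add: F I)
  show "integrable lborel (\<lambda>\<xi>::'a. exp (- a * (norm \<xi>)\<^sup>2))"
    using integrable_norm[OF int[of 0]] by (simp add: F norm_mult)
qed

text \<open>For s < 2 no Gaussian dominates. Instead (1 + z^2)^d exp(-b z^s) is bounded in z =
  |\<xi>|, and the square of each coordinate of \<xi> is at most |\<xi>|^2, so a multiple of a
  product of Cauchy profiles dominates.\<close>

lemma integrable_exp_neg_norm_powr:
  fixes b s :: real assumes b: "0 < b" and s: "0 < s"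
  shows "integrable lborel (\<lambda>\<xi>::'a::euclidean_space. exp (- b * norm \<xi> powr s))"
proof -
  obtain C where C: "\<And>z. 0 \<le> z \<Longrightarrow> (1 + z\<^sup>2) ^ DIM('a) * exp (- b * z powr s) \<le> C"
  proof -
    let ?g = "\<lambda>z::real. (1 + z\<^sup>2) ^ DIM('a) * exp (- b * z powr s)"
    have "(?g \<longlongrightarrow> 0) at_top" using b s by real_asymp
    then have "eventually (\<lambda>z. ?g z < 1) at_top" by (rule order_tendstoD) simp
    then obtain N where N: "\<And>z. z \<ge> N \<Longrightarrow> ?g z < 1" by (auto simp: eventually_at_top_linorder)
    have "continuous_on {0..max N 0} ?g" using s by (intro continuous_intros continuous_on_powr') auto
    then have "bdd_above (?g ` {0..max N 0})" 
      by (intro bounded_imp_bdd_above compact_imp_bounded compact_continuous_image) auto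
    then obtain C where C: "\<And>z. z \<in> {0..max N 0} \<Longrightarrow> ?g z \<le> C"
      unfolding bdd_above_def by blast
    show thesis
    proof (rule that[of "max C 1"])
      fix z :: real assume "0 \<le> z"
      then show "?g z \<le> max C 1" using C[of z] N[of z] by (cases "z \<ge> N") (auto simp: le_max_iff_disj)
    qed
  qed
  let ?h = "\<lambda>\<xi>::'a. C * (\<Prod>b\<in>Basis. inverse (1 + (\<xi> \<bullet> b)\<^sup>2))"
  have "integrable lborel (\<lambda>x::real. inverse (1 + x\<^sup>2))"
    using integrable_inverse_1_plus_square by (simp add: set_integrable_def)
  then have "integrable lborel ?h"
    by (intro integrable_mult_right integrable_lborel_prod) auto
  then show ?thesis
  proof (rule Bochner_Integration.integrable_bound)
    have "norm (exp (- b * norm \<xi> powr s)) \<le> norm (?h \<xi>)" for \<xi> :: 'a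
    proof -
      have "(\<Prod>b\<in>Basis. 1 + (\<xi> \<bullet> b)\<^sup>2) \<le> (\<Prod>b\<in>(Basis::'a set). 1 + (norm \<xi>)\<^sup>2)"
        by (intro prod_mono) (auto simp: abs_le_square_iff[symmetric] Basis_le_norm)
      then have "(\<Prod>b\<in>Basis. 1 + (\<xi> \<bullet> b)\<^sup>2) * exp (- b * norm \<xi> powr s)
          \<le> (1 + (norm \<xi>)\<^sup>2) ^ DIM('a) * exp (- b * norm \<xi> powr s)"
        by (intro mult_right_mono) auto
      also have "\<dots> \<le> C" by (rule C) simp
      finally have "(\<Prod>b\<in>Basis. 1 + (\<xi> \<bullet> b)\<^sup>2) * exp (- b * norm \<xi> powr s) \<le> C" .
      moreover have "0 < (\<Prod>b\<in>Basis. 1 + (\<xi> \<bullet> b)\<^sup>2)" by (intro prod_pos) (simp add: add_pos_nonneg)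
      ultimately have "exp (- b * norm \<xi> powr s) \<le> ?h \<xi>"
        by (simp only: prod_inversef[unfolded o_def] divide_inverse[symmetric] pos_le_divide_eq mult.commute)
      then show ?thesis by simp
    qed
    then show "AE \<xi> in lborel. norm (exp (- b * norm (\<xi>::'a) powr s)) \<le> norm (?h \<xi>)" by simp
  qed measurable
qed

section \<open>Measurability, Fubini and symmetry tools\<close>

lemma measurable_case_prod_comp:
  assumes "case_prod G \<in> borel_measurable (borel \<Otimes>\<^sub>M borel)"
    and [measurable]: "f \<in> borel_measurable M" "h \<in> borel_measurable M"
  shows "(\<lambda>z. G (f z) (h z)) \<in> borel_measurable M"
proof -
  have "(\<lambda>z. (f z, h z)) \<in> M \<rightarrow>\<^sub>M borel \<Otimes>\<^sub>M borel" by measurable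
  from measurable_compose[OF this assms(1)] show ?thesis by simp
qed

lemma cball_sets_borel [measurable]: "cball (x :: 'a::euclidean_space) \<rho> \<in> sets borel"
  by simp

lemma integrable_lborel_pair_bound:
  fixes f :: "'a::euclidean_space \<times> 'b::euclidean_space \<Rightarrow> real"
  assumes f: "f \<in> borel_measurable (lborel \<Otimes>\<^sub>M lborel)"
    and u: "integrable lborel u" and v: "integrable lborel v"
    and bound: "\<And>x y. \<bar>f (x, y)\<bar> \<le> u x * v y"
  shows "integrable (lborel \<Otimes>\<^sub>M lborel) f"
proof (rule Bochner_Integration.integrable_bound)
  have [measurable]: "u \<in> borel_measurable borel" "v \<in> borel_measurable borel" using u v by auto
  show "integrable (lborel \<Otimes>\<^sub>M lborel) (\<lambda>(x, y). u x * v y)"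
    using u v by (intro lborel_pair.Fubini_integrable) (auto simp: abs_mult)
  show "AE z in lborel \<Otimes>\<^sub>M lborel. norm (f z) \<le> norm (case z of (x, y) \<Rightarrow> u x * v y)"
    using bound by (auto simp: abs_mult intro!: AE_I2 order_trans[OF bound abs_ge_self])
qed (use f in auto)

lemma integrable_cos_symbol:
  fixes g :: "'a::euclidean_space \<Rightarrow> real"
  assumes "integrable lborel g" and [measurable]: "f \<in> borel_measurable borel"
  shows "integrable lborel (\<lambda>\<xi>. cos (f \<xi>) * g \<xi>)"
proof (rule Bochner_Integration.integrable_bound[OF assms(1)])
  show "(\<lambda>\<xi>. cos (f \<xi>) * g \<xi>) \<in> borel_measurable lborel" using assms by measurable
  show "AE \<xi> in lborel. norm (cos (f \<xi>) * g \<xi>) \<le> norm (g \<xi>)"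
    by (auto simp: abs_mult intro!: AE_I2 mult_left_le_one_le)
qed

text \<open>The addition formula yields a cosine and a sine term, and the sine integral vanishes
  because \<open>g\<close> is even. This lets convolutions be transformed into products while
  staying with real cosines.\<close>

lemma integral_cos_shift_even:
  fixes x \<xi> :: "'a::euclidean_space"
  assumes g: "integrable lborel g" and even: "\<And>y. g (- y) = g y"
  shows "(LINT y|lborel. cos ((x - y) \<bullet> \<xi>) * g y) = cos (x \<bullet> \<xi>) * (LINT y|lborel. cos (y \<bullet> \<xi>) * g y)"
proof -
  have [measurable]: "g \<in> borel_measurable borel" using g by auto
  have s: "integrable lborel (\<lambda>y. sin (y \<bullet> \<xi>) * g y)"
    by (rule Bochner_Integration.integrable_bound[OF g]) (auto simp: abs_mult intro!: AE_I2 mult_left_le_one_le)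
  have "(LINT y|lborel. sin (y \<bullet> \<xi>) * g y) = - (LINT y|lborel. sin (y \<bullet> \<xi>) * g y)"
    using integral_lborel_affine[of "-1" "\<lambda>y. sin (y \<bullet> \<xi>) * g y" 0] s by (simp add: even)
  then have s0: "(LINT y|lborel. sin (y \<bullet> \<xi>) * g y) = 0" by simp
  have c: "integrable lborel (\<lambda>y. cos (y \<bullet> \<xi>) * g y)" by (rule integrable_cos_symbol[OF g]) measurable
  have "(LINT y|lborel. cos ((x - y) \<bullet> \<xi>) * g y)
      = (LINT y|lborel. cos (x \<bullet> \<xi>) * (cos (y \<bullet> \<xi>) * g y) + sin (x \<bullet> \<xi>) * (sin (y \<bullet> \<xi>) * g y))"
    by (intro Bochner_Integration.integral_cong) (auto simp: inner_diff_left cos_diff algebra_simps)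
  also have "\<dots> = cos (x \<bullet> \<xi>) * (LINT y|lborel. cos (y \<bullet> \<xi>) * g y)"
    using s c by (simp add: s0)
  finally show ?thesis .
qed

text \<open>Reflection preserves integrability in both directions, and where it fails both Bochner
  integrals have the default value 0; so the identity covers every \<open>f\<close>.\<close>

lemma integral_lborel_reflect:
  fixes x :: "'a::euclidean_space" and f :: "'a \<Rightarrow> real"
  shows "(LINT y|lborel. f (x - y)) = (LINT y|lborel. f y)"
proof -
  have *: "integrable lborel (\<lambda>y. g (x - y))" if "integrable lborel g" for g :: "'a \<Rightarrow> real"
    using integrable_lborel_affine[of "-1" g x] that by simp
  show ?thesis
  proof (cases "integrable lborel f")
    case True
    then show ?thesis using integral_lborel_affine[of "-1" f x] by simp
  next
    case False
    then have "\<not> integrable lborel (\<lambda>y. f (x - y))" using *[of "\<lambda>y. f (x - y)"] by auto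
    with False show ?thesis by (simp add: not_integrable_integral_eq)
  qed
qed

lemma integral_lborel_pos:
  fixes f :: "'a::euclidean_space \<Rightarrow> real"
  assumes f: "integrable lborel f" and pos: "\<And>x. 0 < f x"
  shows "0 < integral\<^sup>L lborel f"
proof -
  have "integral\<^sup>L lborel f \<noteq> 0"
  proof
    assume "integral\<^sup>L lborel f = 0"
    then have "AE x in lborel. f x = 0"
      using integral_nonneg_eq_0_iff_AE[OF f] pos by (auto intro: less_imp_le)
    then have "AE x in lborel. x \<notin> (UNIV :: 'a set)"
      by eventually_elim (use pos in \<open>auto simp: less_le\<close>)
    then have "(UNIV :: 'a set) \<in> null_sets lborel" by (subst AE_iff_null_sets) auto
    then show False by (simp add: null_sets_def)
  qed
  moreover have "0 \<le> integral\<^sup>L lborel f" by (intro integral_nonneg_AE AE_I2 less_imp_le pos)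
  ultimately show ?thesis by simp
qed

lemma nn_integral_lborel_reflect:
  fixes x :: "'a::euclidean_space"
  assumes [measurable]: "f \<in> borel_measurable borel"
  shows "(\<integral>\<^sup>+y. f (x - y) \<partial>lborel) = (\<integral>\<^sup>+y. f y \<partial>lborel)"
  using nn_integral_lborel_affine[of f "-1" x] by simp

lemma nn_integral_lborel_shift:
  fixes x :: "'a::euclidean_space"
  assumes [measurable]: "f \<in> borel_measurable borel"
  shows "(\<integral>\<^sup>+y. f (y - x) \<partial>lborel) = (\<integral>\<^sup>+y. f y \<partial>lborel)"
  using nn_integral_lborel_affine[of f "1" "- x"] by simp

section \<open>The source term and the comparison equation\<close>

definition log_source :: "real \<Rightarrow> real \<Rightarrow> real" where
  "log_source p v = (1 + v) * ln (1 + v) powr p"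

lemma log_source_nonneg: "0 \<le> v \<Longrightarrow> 0 \<le> log_source p v"
  by (simp add: log_source_def)

lemma log_source_mono: "0 \<le> p \<Longrightarrow> 0 \<le> v \<Longrightarrow> v \<le> w \<Longrightarrow> log_source p v \<le> log_source p w"
  unfolding log_source_def by (intro mult_mono powr_mono2) auto

lemma log_source_measurable [measurable]: "log_source p \<in> borel_measurable borel"
  unfolding log_source_def by measurable

lemma continuous_on_log_source: "0 < p \<Longrightarrow> continuous_on {0..} (log_source p)"
  unfolding log_source_def by (intro continuous_intros continuous_on_powr') auto

lemma log_source_deriv:
  assumes "0 < v"
  shows "(log_source p has_real_derivative (ln (1 + v) powr p + p * ln (1 + v) powr (p - 1))) (at v)"
proof -
  have l: "0 < ln (1 + v)" using assms by simp
  have "((\<lambda>v. ln (1 + v)) has_real_derivative 1 / (1 + v)) (at v)"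
    using assms by (auto intro!: derivative_eq_intros)
  from DERIV_chain2[where g = "\<lambda>v. ln (1 + v)" and f = "\<lambda>z. z powr p", OF has_real_derivative_powr[OF l] this]
  have P: "((\<lambda>v. ln (1 + v) powr p) has_real_derivative p * ln (1 + v) powr (p - 1) * (1 / (1 + v))) (at v)" .
  have "((\<lambda>v. 1 + v) has_real_derivative 1) (at v)" by (auto intro!: derivative_eq_intros)
  from DERIV_mult[OF this P] show ?thesis
    using assms unfolding log_source_def[abs_def] by simp
qed

text \<open>Convexity through the mean value theorem, the derivative being nondecreasing for p > 1.
  The supporting line is the form in which Jensen's inequality will use it, with the mean as
  \<open>w\<close>.\<close>

lemma log_source_tangent:
  assumes p: "1 < p" and w: "0 < w" and v: "0 \<le> v"
  shows "log_source p w + (ln (1 + w) powr p + p * ln (1 + w) powr (p - 1)) * (v - w) \<le> log_source p v"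
proof -
  let ?D = "\<lambda>v. ln (1 + v) powr p + p * ln (1 + v) powr (p - 1)"
  have mono: "?D a \<le> ?D b" if "0 < a" "a \<le> b" for a b
    using that p by (intro add_mono mult_left_mono powr_mono2) auto
  have cont: "continuous_on {a..b} (log_source p)" if "0 \<le> a" for a b
    using continuous_on_subset[OF continuous_on_log_source] p that by auto
  have slope: "\<exists>z. a < z \<and> z < b \<and> log_source p b - log_source p a = (b - a) * ?D z" if "0 \<le> a" "a < b" for a b
  proof -
    have "\<exists>l z. a < z \<and> z < b \<and> DERIV (log_source p) z :> l \<and> log_source p b - log_source p a = (b - a) * l"
      using that by (intro MVT cont) (auto simp: real_differentiable_def intro!: exI log_source_deriv)
    then obtain l z where z: "a < z" "z < b" "DERIV (log_source p) z :> l" "log_source p b - log_source p a = (b - a) * l"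
      by blast
    then have "l = ?D z" using DERIV_unique[OF z(3) log_source_deriv] that by simp
    then show ?thesis using z by blast
  qed
  consider "v < w" | "v = w" | "w < v" by linarith
  then show ?thesis
  proof cases
    case 1
    then obtain z where z: "v < z" "z < w" "log_source p w - log_source p v = (w - v) * ?D z"
      using slope[OF v] by blast
    have "(w - v) * ?D z \<le> (w - v) * ?D w" using mono[of z w] z v by (intro mult_left_mono) auto
    then show ?thesis using z(3) by (simp add: algebra_simps)
  next
    case 3
    then obtain z where z: "w < z" "z < v" "log_source p v - log_source p w = (v - w) * ?D z"
      using slope[of w v] w by auto
    have "(v - w) * ?D w \<le> (v - w) * ?D z" using mono[of w z] z w by (intro mult_left_mono) auto
    then show ?thesis using z(3) by (simp add: algebra_simps)
  qed simp
qed

text \<open>On [0,1] one has ln (1 + v) \<ge> v / (1 + v) \<ge> v / 2, which is where the factor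
  (1/2)^p comes from.\<close>

lemma log_source_lower:
  assumes "0 \<le> p" "0 \<le> v" "v \<le> 1"
  shows "(1 / 2) powr p * v powr p \<le> log_source p v"
proof -
  have "v / 2 \<le> v / (1 + v)" using assms by (intro divide_left_mono) auto
  also have "\<dots> \<le> ln (1 + v)"
  proof -
    have "ln (inverse (1 + v)) \<le> inverse (1 + v) - 1" using assms ln_le_minus_one[of "inverse (1 + v)"] by simp
    moreover have "ln (inverse (1 + v)) = - ln (1 + v)" by (rule ln_inverse)
    moreover have "inverse (1 + v) - 1 = - (v / (1 + v))" using assms by (simp add: divide_simps)
    ultimately show ?thesis by linarith
  qed
  finally have "(v / 2) powr p \<le> ln (1 + v) powr p" using assms by (intro powr_mono2) auto
  then have "1 * (v / 2) powr p \<le> (1 + v) * ln (1 + v) powr p" using assms by (intro mult_mono) auto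
  then show ?thesis using assms powr_mult[of "1 / 2" v p] by (simp add: log_source_def)
qed

lemma log_source_upper:
  assumes "0 \<le> p" "0 \<le> v" "v \<le> 1"
  shows "log_source p v \<le> 2 * v powr p"
  unfolding log_source_def using assms by (intro mult_mono powr_mono2 ln_add_one_self_le_self) auto

text \<open>The integral of 1 / \<open>log_source p\<close> from y(t1) to \<infinity> is ln (1 +
  y(t1))^(1-p) / (p - 1), hence finite. A function with y' \<ge> s^r f(y) can live until T only if
  the integral of s^r over [t1,T] does not exceed it.\<close>

lemma superlinear_ode_lifespan:
  fixes y :: "real \<Rightarrow> real"
  assumes p: "1 < p" and r: "0 \<le> r" and t1: "0 < t1" "t1 < T"
    and y1: "0 < y t1" and y0: "\<And>t. t1 \<le> t \<Longrightarrow> t < T \<Longrightarrow> 0 \<le> y t" and cont: "continuous_on {t1..<T} y"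
    and ineq: "\<And>t. t1 \<le> t \<Longrightarrow> t < T \<Longrightarrow> y t1 + integral {t1..t} (\<lambda>s. s powr r * log_source p (y s)) \<le> y t"
  shows "(p - 1) * (T powr (r + 1) - t1 powr (r + 1)) / (r + 1) \<le> ln (1 + y t1) powr (1 - p)"
proof -
  let ?g = "\<lambda>s. s powr r * log_source p (y s)"
  let ?E = "\<lambda>t. (p - 1) * t powr (r + 1) / (r + 1)"
  have bound: "?E t2 \<le> ln (1 + y t1) powr (1 - p) + ?E t1" if t2: "t1 < t2" "t2 < T" for t2
  proof -
    \<comment> \<open>\<open>y\<close> need not be differentiable. Its minorant \<open>K\<close> is,
      starts at the same value, and satisfies K' \<ge> s^r f(K), because K \<le> y and f is
      nondecreasing.\<close>
    define K where "K = (\<lambda>t. y t1 + integral {t1..t} ?g)"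
    have g: "continuous_on {t1..t2} ?g"
      using t1 t2 y0 p by (intro continuous_intros continuous_on_compose2[OF continuous_on_log_source, of p _ y]
          continuous_on_subset[OF cont]) auto
    have yK: "K t \<le> y t" if "t \<in> {t1..t2}" for t using ineq[of t] that t2 by (simp add: K_def)
    have K: "y t1 \<le> K t" if "t \<in> {t1..t2}" for t
      unfolding K_def using that t2 y0
      by (auto intro!: Henstock_Kurzweil_Integration.integral_nonneg integrable_continuous_real
          continuous_on_subset[OF g] mult_nonneg_nonneg log_source_nonneg)
    have K_deriv: "(K has_real_derivative ?g t) (at t within {t1..t2})" if "t \<in> {t1..t2}" for t
      unfolding K_def using DERIV_add[OF DERIV_const integral_has_real_derivative[OF g that]] by simp
    have K_cont: "continuous_on {t1..t2} K"
      by (rule DERIV_continuous_on[OF K_deriv])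
    \<comment> \<open>This sum is nonincreasing: its derivative is (p - 1) (t^r - K' /
      f(K)).\<close>
    let ?\<phi> = "\<lambda>t. ln (1 + K t) powr (1 - p) + ?E t"
    have "?\<phi> t2 \<le> ?\<phi> t1"
    proof (rule DERIV_nonpos_imp_decreasing_open[of t1 t2 ?\<phi>])
      show "continuous_on {t1..t2} ?\<phi>"
      proof (intro continuous_intros K_cont ballI)
        fix t assume "t \<in> {t1..t2}"
        then have "0 < K t" using K[of t] y1 by linarith
        then show "ln (1 + K t) \<noteq> 0" "1 + K t \<noteq> 0" by auto
      qed (use t1 r in auto)
      fix t assume t: "t1 < t" "t < t2"
      then have Kt: "0 < K t" "K t \<le> y t" using K[of t] y1 yK[of t] by auto
      have D: "(K has_real_derivative ?g t) (at t)"
        using K_deriv[of t] t by (simp add: at_within_Icc_at)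
      have l: "0 < ln (1 + K t)" using Kt by simp
      have "(?\<phi> has_real_derivative
          (1 - p) * ln (1 + K t) powr (- p) * (?g t / (1 + K t)) + (p - 1) * t powr r) (at t)"
      proof -
        have "((\<lambda>t. ln (1 + K t)) has_real_derivative ?g t / (1 + K t)) (at t)"
          using Kt by (auto intro!: derivative_eq_intros D)
        from DERIV_chain2[where g = "\<lambda>t. ln (1 + K t)" and f = "\<lambda>z. z powr (1 - p)", OF has_real_derivative_powr[OF l] this] have "((\<lambda>t. ln (1 + K t) powr (1 - p)) has_real_derivative (1 - p) * ln (1 + K t) powr (- p) * (?g t / (1 + K t))) (at t)"
          by simp
        moreover have "(?E has_real_derivative (p - 1) * t powr r) (at t)"
        proof -
          have "((\<lambda>t. (p - 1) / (r + 1) * t powr (r + 1)) has_real_derivative (p - 1) / (r + 1) * ((r + 1) * t powr r)) (at t)"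
            using DERIV_cmult[OF has_real_derivative_powr[of t "r + 1"], of "(p - 1) / (r + 1)"] t t1 by simp
          then show ?thesis using r by simp
        qed
        ultimately show ?thesis by (rule DERIV_add)
      qed
      moreover have "(1 - p) * ln (1 + K t) powr (- p) * (?g t / (1 + K t)) + (p - 1) * t powr r \<le> 0"
      proof -
        have "log_source p (K t) \<le> log_source p (y t)" using Kt p by (intro log_source_mono) auto
        then have "t powr r * log_source p (K t) \<le> ?g t" by (intro mult_left_mono) auto
        moreover have "0 < log_source p (K t)" using Kt l by (simp add: log_source_def)
        moreover have "ln (1 + K t) powr (- p) * (?g t / (1 + K t)) = ?g t / log_source p (K t)"
          by (simp add: log_source_def powr_minus divide_inverse mult_ac)
        ultimately have "t powr r \<le> ln (1 + K t) powr (- p) * (?g t / (1 + K t))"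
          by (simp only: pos_le_divide_eq)
        then have "(p - 1) * t powr r \<le> (p - 1) * (ln (1 + K t) powr (- p) * (?g t / (1 + K t)))"
          using p by (intro mult_left_mono) auto
        moreover have "(1 - p) * a * b = - ((p - 1) * (a * b))" for a b :: real by algebra
        ultimately show ?thesis by simp
      qed
      ultimately show "\<exists>D. (?\<phi> has_real_derivative D) (at t) \<and> D \<le> 0" by blast
    qed (use t2 in auto)
    moreover have "K t1 = y t1" by (simp add: K_def)
    moreover have "0 \<le> ln (1 + K t2) powr (1 - p)" by simp
    ultimately show ?thesis unfolding \<open>K t1 = y t1\<close> by linarith
  qed
  \<comment> \<open>So far the bound holds only at times before T; the value at T is reached as a
    limit from the left.\<close>
  have "?E T \<le> ln (1 + y t1) powr (1 - p) + ?E t1"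
  proof (rule tendsto_upperbound)
    have "continuous (at_left T) ?E" using t1 r by (intro continuous_intros) auto
    then show "(?E \<longlongrightarrow> ?E T) (at_left T)" by (simp add: continuous_within)
    show "\<forall>\<^sub>F t in at_left T. ?E t \<le> ln (1 + y t1) powr (1 - p) + ?E t1"
      using eventually_at_left_real[OF t1(2)] by eventually_elim (use bound in auto)
  qed simp
  then show ?thesis by (simp add: right_diff_distrib diff_divide_distrib)
qed

section \<open>Positivity of the kernel\<close>

lemma
  fixes w :: "real \<Rightarrow> real"
  assumes w: "integrable lborel w" "\<And>s. 0 \<le> w s" "\<And>s. s < 0 \<Longrightarrow> w s = 0" and l: "0 \<le> l"
  shows integrable_laplace: "integrable lborel (\<lambda>s. exp (- s * l) * w s)"
    and laplace_nonneg: "0 \<le> (LINT s|lborel. exp (- s * l) * w s)"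
    and laplace_le: "(LINT s|lborel. exp (- s * l) * w s) \<le> integral\<^sup>L lborel w"
proof -
  have [measurable]: "w \<in> borel_measurable borel" using w by auto
  have b: "exp (- s * l) * w s \<le> w s" for s
    using w(2)[of s] w(3)[of s] l by (cases "s < 0") (auto intro!: mult_left_le_one_le)
  show i: "integrable lborel (\<lambda>s. exp (- s * l) * w s)"
    by (intro Bochner_Integration.integrable_bound[OF w(1)]) (use b w in auto)
  show "0 \<le> (LINT s|lborel. exp (- s * l) * w s)" using w by simp
  show "(LINT s|lborel. exp (- s * l) * w s) \<le> integral\<^sup>L lborel w"
    by (intro integral_mono i w b)
qed

text \<open>A factor g(|\<xi>|^2) is a mixture of the Gaussians exp(-s |\<xi>|^2). Pulling one out
  by Fubini turns the integral for a and k + 1 into a mixture over s of the integrals for a + s and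
  k; hence the induction runs over all a. For k = 0 it is the Gaussian transform.\<close>

lemma gaussian_mixture_power_nonneg:
  fixes x :: "'a::euclidean_space" and w :: "real \<Rightarrow> real"
  assumes w: "integrable lborel w" "\<And>s. 0 \<le> w s" "\<And>s. s < 0 \<Longrightarrow> w s = 0" and a: "0 < a"
  defines "g \<equiv> \<lambda>l. LINT s|lborel. exp (- s * l) * w s"
  shows "0 \<le> (LINT \<xi>|lborel. cos (x \<bullet> \<xi>) * (exp (- a * (norm \<xi>)\<^sup>2) * g ((norm \<xi>)\<^sup>2) ^ k))"
  using a
proof (induction k arbitrary: a)
  case 0
  then show ?case using gaussian_fourier[of a x] by simp
next
  case (Suc k)
  have [measurable]: "w \<in> borel_measurable borel" using w by auto
  have [measurable]: "g \<in> borel_measurable borel" unfolding g_def by measurable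
  have g: "0 \<le> g l" "g l \<le> integral\<^sup>L lborel w" if "0 \<le> l" for l
    unfolding g_def using laplace_nonneg[OF w that] laplace_le[OF w that] by auto
  let ?F = "\<lambda>(s, \<xi>::'a). cos (x \<bullet> \<xi>) * (exp (- (a + s) * (norm \<xi>)\<^sup>2) * g ((norm \<xi>)\<^sup>2) ^ k) * w s"
  have int: "integrable (lborel \<Otimes>\<^sub>M lborel) ?F"
  proof (rule integrable_lborel_pair_bound)
    show "integrable lborel (\<lambda>\<xi>::'a. exp (- a * (norm \<xi>)\<^sup>2) * integral\<^sup>L lborel w ^ k)"
      using integrable_gaussian[OF Suc.prems] by (rule integrable_mult_left)
    show "\<bar>?F (s, \<xi>)\<bar> \<le> w s * (exp (- a * (norm \<xi>)\<^sup>2) * integral\<^sup>L lborel w ^ k)" for s and \<xi> :: 'a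
    proof (cases "s < 0")
      case False
      have e: "exp (- (a + s) * (norm \<xi>)\<^sup>2) \<le> exp (- a * (norm \<xi>)\<^sup>2)"
        using False by (simp add: algebra_simps)
      have "\<bar>cos (x \<bullet> \<xi>)\<bar> * (exp (- (a + s) * (norm \<xi>)\<^sup>2) * g ((norm \<xi>)\<^sup>2) ^ k)
          \<le> 1 * (exp (- a * (norm \<xi>)\<^sup>2) * integral\<^sup>L lborel w ^ k)"
        using False g by (intro mult_mono power_mono e) auto
      then show ?thesis using w(2)[of s] g(1)
        by (auto simp: abs_mult mult.commute[of "w s"] intro!: mult_right_mono)
    qed (use w in auto)
  qed (use w in measurable)
  have "0 \<le> (LINT s|lborel. (LINT \<xi>|lborel. ?F (s, \<xi>)))"
  proof (rule integral_nonneg_AE[OF AE_I2])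
    fix s
    show "0 \<le> (LINT \<xi>|lborel. ?F (s, \<xi>))"
      using Suc.IH[of "a + s"] w(2,3)[of s] Suc.prems by (cases "s < 0") auto
  qed
  also have "\<dots> = (LINT \<xi>|lborel. (LINT s|lborel. ?F (s, \<xi>)))"
    using lborel_pair.Fubini_integral[of "\<lambda>s \<xi>. ?F (s, \<xi>)"] int by (simp add: case_prod_beta')
  also have "\<dots> = (LINT \<xi>|lborel. cos (x \<bullet> \<xi>) * (exp (- a * (norm \<xi>)\<^sup>2) * g ((norm \<xi>)\<^sup>2) ^ Suc k))"
  proof (rule Bochner_Integration.integral_cong[OF refl])
    fix \<xi> :: 'a
    have "(LINT s|lborel. ?F (s, \<xi>)) = (LINT s|lborel. cos (x \<bullet> \<xi>) * (exp (- a * (norm \<xi>)\<^sup>2) * g ((norm \<xi>)\<^sup>2) ^ k) * (exp (- s * (norm \<xi>)\<^sup>2) * w s))"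
      by (intro Bochner_Integration.integral_cong) (auto simp: ring_distribs exp_diff exp_minus field_simps)
    also have "\<dots> = cos (x \<bullet> \<xi>) * (exp (- a * (norm \<xi>)\<^sup>2) * g ((norm \<xi>)\<^sup>2) ^ k) * g ((norm \<xi>)\<^sup>2)"
      unfolding g_def by (rule integral_mult_right_zero)
    finally show "(LINT s|lborel. ?F (s, \<xi>)) = cos (x \<bullet> \<xi>) * (exp (- a * (norm \<xi>)\<^sup>2) * g ((norm \<xi>)\<^sup>2) ^ Suc k)"
      by (simp add: mult_ac)
  qed
  finally show ?case .
qed

text \<open>\<psi> is the total mass of w minus the Laplace transform g of w, so exp(-\<psi>) is a
  positive constant times the exponential series in g, whose terms fall under
  \<open>gaussian_mixture_power_nonneg\<close>. The partial sums stay below exp g, and g below the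
  mass of w.\<close>

lemma gaussian_mixture_exp_nonneg:
  fixes x :: "'a::euclidean_space" and w :: "real \<Rightarrow> real"
  assumes w: "integrable lborel w" "\<And>s. 0 \<le> w s" "\<And>s. s < 0 \<Longrightarrow> w s = 0" and a: "0 < a"
  defines "\<psi> \<equiv> \<lambda>l. LINT s|lborel. (1 - exp (- s * l)) * w s"
  shows "0 \<le> (LINT \<xi>|lborel. cos (x \<bullet> \<xi>) * (exp (- a * (norm \<xi>)\<^sup>2) * exp (- \<psi> ((norm \<xi>)\<^sup>2))))"
proof -
  define g where "g = (\<lambda>l. LINT s|lborel. exp (- s * l) * w s)"
  have [measurable]: "w \<in> borel_measurable borel" using w by auto
  have [measurable]: "g \<in> borel_measurable borel" unfolding g_def by measurable
  have g: "0 \<le> g l" "g l \<le> integral\<^sup>L lborel w" "\<psi> l = integral\<^sup>L lborel w - g l" if "0 \<le> l" for l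
    unfolding g_def \<psi>_def using laplace_nonneg[OF w that] laplace_le[OF w that] integrable_laplace[OF w that] w(1)
    by (simp_all add: left_diff_distrib)
  let ?T = "\<lambda>n \<xi>::'a. cos (x \<bullet> \<xi>) * (exp (- a * (norm \<xi>)\<^sup>2) * (\<Sum>k<n. g ((norm \<xi>)\<^sup>2) ^ k /\<^sub>R fact k))"
  let ?L = "\<lambda>\<xi>::'a. cos (x \<bullet> \<xi>) * (exp (- a * (norm \<xi>)\<^sup>2) * exp (g ((norm \<xi>)\<^sup>2)))"
  let ?I = "integral\<^sup>L lborel w"
  have T_bound: "norm (cos (x \<bullet> \<xi>) * (exp (- a * (norm \<xi>)\<^sup>2) * v)) \<le> exp (- a * (norm \<xi>)\<^sup>2) * exp ?I"
    if "0 \<le> v" "v \<le> exp (g ((norm \<xi>)\<^sup>2))" for \<xi> v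
  proof -
    have "\<bar>cos (x \<bullet> \<xi>)\<bar> * (exp (- a * (norm \<xi>)\<^sup>2) * v) \<le> 1 * (exp (- a * (norm \<xi>)\<^sup>2) * exp ?I)"
      using that g(2)[of "(norm \<xi>)\<^sup>2"] by (intro mult_mono) (auto intro: order_trans)
    then show ?thesis using that by (simp add: abs_mult)
  qed
  have part: "0 \<le> (\<Sum>k<n. g ((norm \<xi>)\<^sup>2) ^ k /\<^sub>R fact k)" "(\<Sum>k<n. g ((norm \<xi>)\<^sup>2) ^ k /\<^sub>R fact k) \<le> exp (g ((norm \<xi>)\<^sup>2))" for n and \<xi> :: 'a
  proof -
    show "0 \<le> (\<Sum>k<n. g ((norm \<xi>)\<^sup>2) ^ k /\<^sub>R fact k)" using g by (intro sum_nonneg) auto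
    show "(\<Sum>k<n. g ((norm \<xi>)\<^sup>2) ^ k /\<^sub>R fact k) \<le> exp (g ((norm \<xi>)\<^sup>2))"
      unfolding exp_def by (rule sum_le_suminf[OF summable_exp_generic]) (use g in auto)
  qed
  have eG: "integrable lborel (\<lambda>\<xi>::'a. exp (- a * (norm \<xi>)\<^sup>2) * exp ?I)"
    using integrable_gaussian[OF a] by simp
  have "(\<lambda>n. integral\<^sup>L lborel (?T n)) \<longlonglongrightarrow> integral\<^sup>L lborel ?L"
  proof (rule integral_dominated_convergence[OF _ _ eG])
    show "AE \<xi> in lborel. (\<lambda>n. ?T n \<xi>) \<longlonglongrightarrow> ?L \<xi>"
      using exp_converges[of "g _"] by (auto simp: sums_def intro!: tendsto_intros AE_I2)
    show "AE \<xi> in lborel. norm (?T n \<xi>) \<le> exp (- a * (norm \<xi>)\<^sup>2) * exp ?I" for n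
      using part by (intro AE_I2 T_bound) auto
  qed measurable
  moreover have "0 \<le> integral\<^sup>L lborel (?T n)" for n
  proof -
    have "integrable lborel (\<lambda>\<xi>. cos (x \<bullet> \<xi>) * (exp (- a * (norm \<xi>)\<^sup>2) * (g ((norm \<xi>)\<^sup>2) ^ k /\<^sub>R fact k)))" for k
    proof (rule Bochner_Integration.integrable_bound[OF eG])
      show "AE \<xi> in lborel. norm (cos (x \<bullet> \<xi>) * (exp (- a * (norm \<xi>)\<^sup>2) * (g ((norm \<xi>)\<^sup>2) ^ k /\<^sub>R fact k)))
          \<le> norm (exp (- a * (norm \<xi>)\<^sup>2) * exp ?I)"
      proof (intro AE_I2)
        fix \<xi> :: 'a
        have "g ((norm \<xi>)\<^sup>2) ^ k /\<^sub>R fact k \<le> (\<Sum>k<Suc k. g ((norm \<xi>)\<^sup>2) ^ k /\<^sub>R fact k)"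
          using part(1)[of \<xi> k] by simp
        then show "norm (cos (x \<bullet> \<xi>) * (exp (- a * (norm \<xi>)\<^sup>2) * (g ((norm \<xi>)\<^sup>2) ^ k /\<^sub>R fact k)))
          \<le> norm (exp (- a * (norm \<xi>)\<^sup>2) * exp ?I)"
          using T_bound[of "g ((norm \<xi>)\<^sup>2) ^ k /\<^sub>R fact k" \<xi>] part(2)[of \<xi> "Suc k"] g(1) by simp
      qed
    qed measurable
    then have "integral\<^sup>L lborel (?T n) = (\<Sum>k<n. LINT \<xi>|lborel. cos (x \<bullet> \<xi>) * (exp (- a * (norm \<xi>)\<^sup>2) * (g ((norm \<xi>)\<^sup>2) ^ k /\<^sub>R fact k)))"
      unfolding sum_distrib_left by (rule Bochner_Integration.integral_sum)
    also have "\<dots> = (\<Sum>k<n. (LINT \<xi>|lborel. cos (x \<bullet> \<xi>) * (exp (- a * (norm \<xi>)\<^sup>2) * g ((norm \<xi>)\<^sup>2) ^ k)) / fact k)"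
      by (intro sum.cong refl) (simp add: divide_inverse mult_ac)
    also have "0 \<le> \<dots>"
      unfolding g_def using gaussian_mixture_power_nonneg[OF w a, of x] by (intro sum_nonneg) auto
    finally show ?thesis .
  qed
  ultimately have "0 \<le> integral\<^sup>L lborel ?L" by (intro LIMSEQ_le_const[of _ _ 0]) auto
  then have "0 \<le> exp (- ?I) * integral\<^sup>L lborel ?L" by simp
  also have "\<dots> = (LINT \<xi>|lborel. cos (x \<bullet> \<xi>) * (exp (- a * (norm \<xi>)\<^sup>2) * exp (- \<psi> ((norm \<xi>)\<^sup>2))))"
    by (subst integral_mult_right_zero[symmetric])
       (auto intro!: Bochner_Integration.integral_cong simp: g(3) exp_diff exp_minus field_simps)
  finally show ?thesis .
qed

text \<open>Substituting s / l for s turns the integral with l into l^\<sigma> times the one with l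
  = 1; thus l^\<sigma> becomes a mixture of the functions 1 - exp(-s l). The constant is kept as an
  integral and later serves as a divisor, hence the separate positivity.\<close>

lemma
  fixes \<sigma> :: real
  assumes \<sigma>: "0 < \<sigma>" "\<sigma> < 1"
  defines "f \<equiv> \<lambda>s. indicator {0<..} s * ((1 - exp (- s)) * s powr (- 1 - \<sigma>))"
  shows integral_levy_density_pos: "0 < integral\<^sup>L lborel f"
    and integral_levy_density_scale: "0 \<le> l \<Longrightarrow>
      has_bochner_integral lborel (\<lambda>s. indicator {0<..} s * ((1 - exp (- s * l)) * s powr (- 1 - \<sigma>)))
        (l powr \<sigma> * integral\<^sup>L lborel f)"
proof -
  have [measurable]: "f \<in> borel_measurable borel" unfolding f_def by measurable
  have f0: "0 \<le> f s" for s by (simp add: f_def indicator_def)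
  \<comment> \<open>The majorant has two pieces: on (0,1] the bound 1 - exp(-s) \<le> s leaves
    s^(-\<sigma>), integrable as \<sigma> < 1; beyond 1 the tail s^(-1-\<sigma>) is integrable as
    \<sigma> > 0.\<close>
  have "integrable lebesgue (\<lambda>s::real. indicator {0..1} s *\<^sub>R s powr (- \<sigma>))"
    using \<sigma> nonnegative_absolutely_integrable_1[OF integrable_on_powr_from_0[of "-\<sigma>" 1]] by (auto simp: set_integrable_def)
  then have 1: "integrable lborel (\<lambda>s::real. indicator {0..1} s *\<^sub>R s powr (- \<sigma>))"
    by (subst (asm) integrable_completion) auto
  have "(\<lambda>s::real. s powr (- 1 - \<sigma>)) integrable_on {1..}"
    using has_integral_powr_to_inf[of "- 1 - \<sigma>" 1] \<sigma> by (auto simp: integrable_on_def)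
  then have "integrable lebesgue (\<lambda>s::real. indicator {1..} s *\<^sub>R s powr (- 1 - \<sigma>))"
    using nonnegative_absolutely_integrable_1[of "\<lambda>s. s powr (- 1 - \<sigma>)" "{1..}"] by (auto simp: set_integrable_def)
  then have 2: "integrable lborel (\<lambda>s::real. indicator {1..} s *\<^sub>R s powr (- 1 - \<sigma>))"
    by (subst (asm) integrable_completion) auto
  have int: "integrable lborel f"
  proof (rule Bochner_Integration.integrable_bound[OF Bochner_Integration.integrable_add[OF 1 2]])
    have "f s \<le> indicator {0..1} s *\<^sub>R s powr (- \<sigma>) + indicator {1..} s *\<^sub>R s powr (- 1 - \<sigma>)" for s
    proof -
      have "(1 - exp (- s)) * s powr (- 1 - \<sigma>) \<le> s * s powr (- 1 - \<sigma>)" if "0 < s"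
        using exp_ge_add_one_self[of "-s"] by (intro mult_right_mono) auto
      moreover have "s * s powr (- 1 - \<sigma>) = s powr (- \<sigma>)" if "0 < s"
        using that powr_add[of s 1 "- 1 - \<sigma>"] by simp
      moreover have "(1 - exp (- s)) * s powr (- 1 - \<sigma>) \<le> 1 * s powr (- 1 - \<sigma>)"
        by (intro mult_right_mono) auto
      ultimately show ?thesis by (cases "s \<le> 1") (auto simp: f_def indicator_def add_increasing add_increasing2)
    qed
    then show "AE s in lborel. norm (f s) \<le>
        norm (indicator {0..1} s *\<^sub>R s powr (- \<sigma>) + indicator {1..} s *\<^sub>R s powr (- 1 - \<sigma>))"
      using f0 by (intro AE_I2) (auto intro: order_trans[OF _ abs_ge_self])
  qed measurable
  show "0 < integral\<^sup>L lborel f"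
  proof -
    have "integral\<^sup>L lborel f \<noteq> 0"
    proof
      assume "integral\<^sup>L lborel f = 0"
      then have "AE s in lborel. f s = 0"
        using integral_nonneg_eq_0_iff_AE[OF int] f0 by auto
      then have "AE s in lborel. s \<notin> {1..2::real}"
        by eventually_elim (auto simp: f_def indicator_def)
      then have "{1..2::real} \<in> null_sets lborel" by (subst AE_iff_null_sets) auto
      then show False by (simp add: null_sets_def)
    qed
    moreover have "0 \<le> integral\<^sup>L lborel f" using f0 by simp
    ultimately show ?thesis by simp
  qed
  show "has_bochner_integral lborel (\<lambda>s. indicator {0<..} s * ((1 - exp (- s * l)) * s powr (- 1 - \<sigma>)))
        (l powr \<sigma> * integral\<^sup>L lborel f)" if l: "0 \<le> l"
  proof (cases "l = 0")
    case False
    with l have l: "0 < l" by simp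
    have "has_bochner_integral lborel f (integral\<^sup>L lborel f)"
      using int by (simp add: has_bochner_integral_iff)
    then have "has_bochner_integral lborel (\<lambda>s. f (0 + l * s)) (integral\<^sup>L lborel f /\<^sub>R \<bar>l\<bar>)"
      using lborel_has_bochner_integral_real_affine_iff[of l f _ 0] l by simp
    then have H: "has_bochner_integral lborel (\<lambda>s. l powr (1 + \<sigma>) * f (0 + l * s)) (l powr (1 + \<sigma>) * (integral\<^sup>L lborel f /\<^sub>R \<bar>l\<bar>))"
      by (rule has_bochner_integral_mult_right)
    have eq1: "l powr (1 + \<sigma>) * f (0 + l * s) = indicator {0<..} s * ((1 - exp (- s * l)) * s powr (- 1 - \<sigma>))" for s
    proof -
      have "l powr (1 + \<sigma>) * l powr (- 1 - \<sigma>) = 1" using l by (simp flip: powr_add)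
      then show ?thesis using l by (auto simp: f_def indicator_def powr_mult zero_less_mult_iff mult_ac)
    qed
    have eq2: "l powr (1 + \<sigma>) * (integral\<^sup>L lborel f /\<^sub>R \<bar>l\<bar>) = l powr \<sigma> * integral\<^sup>L lborel f"
      using l by (simp add: powr_add)
    show ?thesis using H unfolding eq1 eq2 .
  qed (simp add: has_bochner_integral_zero)
qed

locale fractional_order =
  fixes \<sigma> :: real
  assumes \<sigma>: "0 < \<sigma>" "\<sigma> < 1"
begin

definition symbol :: "real \<Rightarrow> real \<Rightarrow> 'a::euclidean_space \<Rightarrow> real" where
  "symbol a b \<xi> = exp (- a * (norm \<xi>)\<^sup>2 - b * norm \<xi> powr (2 * \<sigma>))"

text \<open>The function \<open>S(a,b)\<close> of the introductory comment; \<open>p\<^sub>t\<close> is \<open>p_kernel t t\<close>.\<close>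

definition p_kernel :: "real \<Rightarrow> real \<Rightarrow> 'a::euclidean_space \<Rightarrow> real" where
  "p_kernel a b x = (LINT \<xi>|lborel. cos (x \<bullet> \<xi>) * symbol a b \<xi>) / (2 * pi) ^ DIM('a)"

lemma symbol_measurable [measurable]:
  fixes \<xi> :: "'b \<Rightarrow> 'a::euclidean_space"
  assumes [measurable]: "a \<in> borel_measurable M" "b \<in> borel_measurable M" "\<xi> \<in> borel_measurable M"
  shows "(\<lambda>x. symbol (a x) (b x) (\<xi> x)) \<in> borel_measurable M"
  unfolding symbol_def by measurable

lemma symbol_borel_measurable [measurable]: "symbol a b \<in> borel_measurable borel"
  unfolding symbol_def by measurable

text \<open>Measurability is joint in all three arguments, because in a Duhamel integral both
  parameters and the point vary together.\<close>

lemma p_kernel_measurable [measurable]: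
  fixes x :: "'b \<Rightarrow> 'a::euclidean_space"
  assumes [measurable]: "a \<in> borel_measurable M" "b \<in> borel_measurable M" "x \<in> borel_measurable M"
  shows "(\<lambda>z. p_kernel (a z) (b z) (x z)) \<in> borel_measurable M"
proof -
  have *: "(\<lambda>(a, b, x::'a). p_kernel a b x) \<in> borel_measurable (borel \<Otimes>\<^sub>M borel \<Otimes>\<^sub>M borel)"
    unfolding p_kernel_def by measurable
  have "(\<lambda>z. (a z, b z, x z)) \<in> M \<rightarrow>\<^sub>M borel \<Otimes>\<^sub>M borel \<Otimes>\<^sub>M borel" by measurable
  from measurable_compose[OF this *] show ?thesis by simp
qed

lemma p_kernel_borel_measurable [measurable]: "p_kernel a b \<in> borel_measurable borel"
  using p_kernel_measurable[of "\<lambda>_. a" borel "\<lambda>_. b" "\<lambda>x. x"] by simp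

lemma symbol_pos [simp]: "0 < symbol a b \<xi>"
  and symbol_nonneg [simp]: "0 \<le> symbol a b \<xi>"
  by (simp_all add: symbol_def)

lemma symbol_add: "symbol a b \<xi> * symbol a' b' \<xi> = symbol (a + a') (b + b') \<xi>"
  by (simp add: symbol_def ring_distribs flip: exp_add)

lemma symbol_mono: "a' \<le> a \<Longrightarrow> b' \<le> b \<Longrightarrow> symbol a b \<xi> \<le> symbol a' b' \<xi>"
  by (auto simp: symbol_def intro!: diff_mono mult_right_mono)

lemma symbol_gaussian: "symbol a 0 \<xi> = exp (- a * (norm \<xi>)\<^sup>2)"
  by (simp add: symbol_def)

lemma integrable_symbol:
  assumes "0 \<le> a" "0 \<le> b" "0 < a \<or> 0 < b"
  shows "integrable lborel (symbol a b :: 'a::euclidean_space \<Rightarrow> real)"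
proof (cases "0 < a")
  case True
  show ?thesis
    by (rule Bochner_Integration.integrable_bound[OF integrable_gaussian[OF True]])
       (use assms \<sigma> in \<open>auto simp: symbol_def intro!: AE_I2\<close>)
next
  case False
  with assms have "0 < b" by auto
  show ?thesis
    by (rule Bochner_Integration.integrable_bound[OF integrable_exp_neg_norm_powr[OF \<open>0 < b\<close>, of "2 * \<sigma>"]])
       (use assms \<sigma> in \<open>auto simp: symbol_def intro!: AE_I2\<close>)
qed

lemma p_kernel_nonneg:
  fixes x :: "'a::euclidean_space"
  assumes a: "0 < a" and b: "0 \<le> b"
  shows "0 \<le> p_kernel a b x"
proof -
  define f where "f = (\<lambda>s. indicator {0<..} s * ((1 - exp (- s)) * s powr (- 1 - \<sigma>)) :: real)"
  define c where "c = integral\<^sup>L lborel f"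
  have c: "0 < c" unfolding c_def f_def by (rule integral_levy_density_pos[OF \<sigma>])
  \<comment> \<open>The density s^(-1-\<sigma>) has infinite mass near 0; restricted to a compact
    interval of positive numbers it is integrable, as a mixing weight must be. The factor b / c
    makes the exponents converge to b l^\<sigma>.\<close>
  define w where "w = (\<lambda>n s. indicator {1 / real (Suc n) .. real (Suc n)} s * (b / c * s powr (- 1 - \<sigma>)))"
  define \<psi> where "\<psi> = (\<lambda>n l. LINT s|lborel. (1 - exp (- s * l)) * w n s)"
  have w_nonpos: "w n s = 0" if "s \<le> 0" for n s
  proof -
    have "0 < 1 / real (Suc n)" by simp
    with that have "s \<notin> {1 / real (Suc n) .. real (Suc n)}" unfolding atLeastAtMost_iff by linarith
    then show ?thesis by (simp add: w_def)
  qed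
  have w: "integrable lborel (w n)" "0 \<le> w n s" "s < 0 \<Longrightarrow> w n s = 0" for n s
  proof -
    show "0 \<le> w n s" using b c by (simp add: w_def)
    show "s < 0 \<Longrightarrow> w n s = 0" by (simp add: w_nonpos)
    have "1 / real (Suc n) > 0" by simp
    have "continuous_on {1 / real (Suc n)..real (Suc n)} (\<lambda>s. b / c * s powr (- 1 - \<sigma>))"
      using \<open>1 / real (Suc n) > 0\<close> by (intro continuous_intros) (auto simp del: of_nat_Suc)
    from borel_integrable_atLeastAtMost'[OF this] show "integrable lborel (w n)"
      unfolding w_def by (simp only: set_integrable_def real_scaleR_def)
  qed
  have [measurable]: "w n \<in> borel_measurable borel" for n unfolding w_def by measurable
  have \<psi>: "(\<lambda>n. \<psi> n l) \<longlonglongrightarrow> b * l powr \<sigma>" if l: "0 \<le> l" for l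
  proof -
    let ?g = "\<lambda>s. b / c * (indicator {0<..} s * ((1 - exp (- s * l)) * s powr (- 1 - \<sigma>)))"
    have g: "has_bochner_integral lborel ?g (b / c * (l powr \<sigma> * c))"
      unfolding c_def f_def by (intro has_bochner_integral_mult_right integral_levy_density_scale[OF \<sigma> l])
    have "(\<lambda>n. \<psi> n l) \<longlonglongrightarrow> integral\<^sup>L lborel ?g"
      unfolding \<psi>_def
    proof (rule integral_dominated_convergence[where w="?g"])
      show "integrable lborel ?g" using g has_bochner_integral_iff by blast
      show "AE s in lborel. (\<lambda>n. (1 - exp (- s * l)) * w n s) \<longlonglongrightarrow> ?g s"
      proof (rule AE_I2)
        fix s :: real
        have "eventually (\<lambda>n. (1 - exp (- s * l)) * w n s = ?g s) sequentially"
        proof (cases "0 < s")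
          case True
          have "eventually (\<lambda>n. s < real (Suc n)) sequentially" by real_asymp
          moreover have "eventually (\<lambda>n. 1 / real (Suc n) < s) sequentially" using True by real_asymp
          ultimately show ?thesis by eventually_elim (use True in \<open>auto simp: w_def\<close>)
        next
          case False
          then have "w n s = 0" for n by (simp add: w_nonpos)
          with False show ?thesis by simp
        qed
        then show "(\<lambda>n. (1 - exp (- s * l)) * w n s) \<longlonglongrightarrow> ?g s" by (rule tendsto_eventually)
      qed
      show "AE s in lborel. norm ((1 - exp (- s * l)) * w n s) \<le> ?g s" for n
      proof (rule AE_I2)
        fix s :: real
        show "norm ((1 - exp (- s * l)) * w n s) \<le> ?g s"
        proof (cases "0 < s")
          case True
          then show ?thesis using b c l by (auto simp: w_def indicator_def abs_mult mult_ac)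
        next
          case False
          then have "w n s = 0" by (simp add: w_nonpos)
          then show ?thesis using False by simp
        qed
      qed
    qed measurable
    moreover have "integral\<^sup>L lborel ?g = b * l powr \<sigma>"
      using has_bochner_integral_integral_eq[OF g] c by simp
    ultimately show ?thesis by simp
  qed
  have \<psi>0: "0 \<le> \<psi> n l" if "0 \<le> l" for n l
  proof -
    have "0 \<le> (1 - exp (- s * l)) * w n s" for s
      using that w(2)[of n s] w(3)[of s n] by (cases "s < 0") auto
    then show ?thesis unfolding \<psi>_def by simp
  qed
  have [measurable]: "\<psi> n \<in> borel_measurable borel" for n unfolding \<psi>_def by measurable
  have "(\<lambda>n. LINT \<xi>|lborel. cos (x \<bullet> \<xi>) * (exp (- a * (norm \<xi>)\<^sup>2) * exp (- \<psi> n ((norm \<xi>)\<^sup>2))))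
      \<longlonglongrightarrow> (LINT \<xi>|lborel. cos (x \<bullet> \<xi>) * (exp (- a * (norm \<xi>)\<^sup>2) * exp (- (b * ((norm \<xi>)\<^sup>2) powr \<sigma>))))"
  \<comment> \<open>The Gaussian factor dominates uniformly in n because the exponents
    \<open>\<psi> n\<close> are nonnegative.\<close>
  proof (rule integral_dominated_convergence[OF _ _ integrable_gaussian[OF a]])
    show "AE \<xi> in lborel. norm (cos (x \<bullet> \<xi>) * (exp (- a * (norm \<xi>)\<^sup>2) * exp (- \<psi> n ((norm \<xi>)\<^sup>2))))
        \<le> exp (- a * (norm \<xi>)\<^sup>2)" for n
    proof (rule AE_I2)
      fix \<xi> :: 'a
      have "\<bar>cos (x \<bullet> \<xi>)\<bar> * (exp (- a * (norm \<xi>)\<^sup>2) * exp (- \<psi> n ((norm \<xi>)\<^sup>2))) \<le> 1 * (exp (- a * (norm \<xi>)\<^sup>2) * 1)"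
        using \<psi>0 by (intro mult_mono) auto
      then show "norm (cos (x \<bullet> \<xi>) * (exp (- a * (norm \<xi>)\<^sup>2) * exp (- \<psi> n ((norm \<xi>)\<^sup>2)))) \<le> exp (- a * (norm \<xi>)\<^sup>2)"
        by (simp add: abs_mult)
    qed
  qed (use \<psi> in \<open>auto intro!: tendsto_intros AE_I2\<close>)
  then have "0 \<le> (LINT \<xi>|lborel. cos (x \<bullet> \<xi>) * (exp (- a * (norm \<xi>)\<^sup>2) * exp (- (b * ((norm \<xi>)\<^sup>2) powr \<sigma>))))"
    by (rule LIMSEQ_le_const)
       (use gaussian_mixture_exp_nonneg[OF w a, of x] in \<open>auto simp: \<psi>_def\<close>)
  moreover have "((norm \<xi>)\<^sup>2) powr \<sigma> = norm \<xi> powr (2 * \<sigma>)" for \<xi> :: 'a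
    by (cases "\<xi> = 0") (auto simp: powr_powr simp flip: powr_numeral)
  ultimately show ?thesis
    unfolding p_kernel_def symbol_def by (simp add: exp_diff exp_minus field_simps)
qed

section \<open>Fourier inversion and the semigroup property\<close>

lemma p_kernel_uminus: "p_kernel a b (- x) = p_kernel a b x"
  by (simp add: p_kernel_def)

lemma symbol_uminus: "symbol a b (- x) = symbol a b x"
  by (simp add: symbol_def)

lemma p_kernel_abs_le:
  fixes x :: "'a::euclidean_space"
  assumes "integrable lborel (symbol a b :: 'a \<Rightarrow> real)"
  shows "\<bar>p_kernel a b x\<bar> \<le> integral\<^sup>L lborel (symbol a b :: 'a \<Rightarrow> real) / (2 * pi) ^ DIM('a)"
proof -
  have "\<bar>LINT \<xi>|lborel. cos (x \<bullet> \<xi>) * symbol a b \<xi>\<bar> \<le> (LINT \<xi>|lborel. \<bar>cos (x \<bullet> \<xi>) * symbol a b \<xi>\<bar>)"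
    by (rule integral_abs_bound)
  also have "\<dots> \<le> integral\<^sup>L lborel (symbol a b :: 'a \<Rightarrow> real)"
    using assms by (intro integral_mono integrable_abs integrable_cos_symbol) (auto simp: abs_mult intro!: mult_left_le_one_le)
  finally show ?thesis by (simp add: p_kernel_def abs_mult divide_right_mono)
qed

text \<open>The bound does not depend on \<open>x\<close>. Combined with
  \<open>symbol_L1_tendsto\<close> it gives continuity of the kernels in their parameters with
  respect to the sup norm.\<close>

lemma p_kernel_diff_le:
  fixes x :: "'a::euclidean_space"
  assumes "integrable lborel (symbol a b :: 'a \<Rightarrow> real)" "integrable lborel (symbol a' b' :: 'a \<Rightarrow> real)"
  shows "\<bar>p_kernel a b x - p_kernel a' b' x\<bar>
    \<le> (LINT \<xi>::'a|lborel. \<bar>symbol a b \<xi> - symbol a' b' \<xi>\<bar>) / (2 * pi) ^ DIM('a)"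
proof -
  have d: "integrable lborel (\<lambda>\<xi>::'a. symbol a b \<xi> - symbol a' b' \<xi>)" using assms by simp
  have "p_kernel a b x - p_kernel a' b' x
      = (LINT \<xi>|lborel. cos (x \<bullet> \<xi>) * (symbol a b \<xi> - symbol a' b' \<xi>)) / (2 * pi) ^ DIM('a)"
    unfolding p_kernel_def right_diff_distrib
    by (subst Bochner_Integration.integral_diff) (auto intro!: integrable_cos_symbol assms simp: diff_divide_distrib)
  moreover have "\<bar>LINT \<xi>|lborel. cos (x \<bullet> \<xi>) * (symbol a b \<xi> - symbol a' b' \<xi>)\<bar>
      \<le> (LINT \<xi>|lborel. \<bar>cos (x \<bullet> \<xi>) * (symbol a b \<xi> - symbol a' b' \<xi>)\<bar>)"
    by (rule integral_abs_bound)
  moreover have "\<dots> \<le> (LINT \<xi>::'a|lborel. \<bar>symbol a b \<xi> - symbol a' b' \<xi>\<bar>)"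
    using d by (intro integral_mono integrable_abs integrable_cos_symbol) (auto simp: abs_mult intro!: mult_left_le_one_le)
  ultimately show ?thesis by (simp add: abs_mult divide_right_mono)
qed

text \<open>The heat parameters stay above a fixed \<alpha> > 0, so the single Gaussian
  \<open>symbol \<alpha> 0\<close> dominates all symbols in the sequence.\<close>

lemma symbol_L1_tendsto:
  fixes a b :: "nat \<Rightarrow> real"
  assumes a: "a \<longlonglongrightarrow> a'" "\<And>n. \<alpha> \<le> a n" "0 < \<alpha>" and b: "b \<longlonglongrightarrow> b'" "\<And>n. 0 \<le> b n"
  shows "(\<lambda>n. LINT \<xi>::'a::euclidean_space|lborel. \<bar>symbol (a n) (b n) \<xi> - symbol a' b' \<xi>\<bar>) \<longlonglongrightarrow> 0"
proof -
  have a': "\<alpha> \<le> a'" "0 \<le> b'" using a b by (auto intro: LIMSEQ_le_const)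
  have "(\<lambda>n. LINT \<xi>::'a|lborel. \<bar>symbol (a n) (b n) \<xi> - symbol a' b' \<xi>\<bar>) \<longlonglongrightarrow> (LINT \<xi>::'a|lborel. 0)"
  proof (rule integral_dominated_convergence)
    show "integrable lborel (symbol \<alpha> 0 :: 'a \<Rightarrow> real)"
      by (intro integrable_symbol) (use \<sigma> a in auto)
    show "AE \<xi> in lborel. norm \<bar>symbol (a n) (b n) \<xi> - symbol a' b' \<xi>\<bar> \<le> symbol \<alpha> 0 (\<xi> :: 'a)" for n
    proof (rule AE_I2)
      fix \<xi> :: 'a
      have "symbol (a n) (b n) \<xi> \<le> symbol \<alpha> 0 \<xi>" "symbol a' b' \<xi> \<le> symbol \<alpha> 0 \<xi>"
        using a b a' by (auto intro!: symbol_mono)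
      then show "norm \<bar>symbol (a n) (b n) \<xi> - symbol a' b' \<xi>\<bar> \<le> symbol \<alpha> 0 \<xi>"
        using symbol_pos[of "a n" "b n" \<xi>] symbol_pos[of a' b' \<xi>] unfolding real_norm_def by linarith
    qed
    show "AE \<xi> in lborel. (\<lambda>n. \<bar>symbol (a n) (b n) (\<xi>::'a) - symbol a' b' \<xi>\<bar>) \<longlonglongrightarrow> 0"
    proof (rule AE_I2)
      fix \<xi> :: 'a
      have "(\<lambda>n. \<bar>symbol (a n) (b n) \<xi> - symbol a' b' \<xi>\<bar>) \<longlonglongrightarrow> \<bar>symbol a' b' \<xi> - symbol a' b' \<xi>\<bar>"
        unfolding symbol_def by (intro tendsto_intros a b)
      then show "(\<lambda>n. \<bar>symbol (a n) (b n) \<xi> - symbol a' b' \<xi>\<bar>) \<longlonglongrightarrow> 0" by simp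
    qed
  qed measurable
  then show ?thesis by simp
qed

lemma p_kernel_tendsto:
  fixes a b :: "nat \<Rightarrow> real" and x :: "'a::euclidean_space"
  assumes a: "a \<longlonglongrightarrow> a'" "\<And>n. \<alpha> \<le> a n" "0 < \<alpha>" and b: "b \<longlonglongrightarrow> b'" "\<And>n. 0 \<le> b n"
  shows "(\<lambda>n. p_kernel (a n) (b n) x) \<longlonglongrightarrow> p_kernel a' b' x"
proof -
  have a': "\<alpha> \<le> a'" "0 \<le> b'" using a b by (auto intro: LIMSEQ_le_const)
  have an: "0 < a n" "0 \<le> b n" for n using a(2)[of n] a(3) b(2)[of n] by auto
  have "(\<lambda>n. p_kernel (a n) (b n) x - p_kernel a' b' x) \<longlonglongrightarrow> 0"
  proof (rule Lim_null_comparison)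
    show "\<forall>\<^sub>F n in sequentially. norm (p_kernel (a n) (b n) x - p_kernel a' b' x)
        \<le> (LINT \<xi>::'a|lborel. \<bar>symbol (a n) (b n) \<xi> - symbol a' b' \<xi>\<bar>) / (2 * pi) ^ DIM('a)"
      unfolding real_norm_def using an a' a(3) \<sigma>
      by (intro always_eventually allI p_kernel_diff_le integrable_symbol) (auto intro: less_imp_le)
    show "(\<lambda>n. (LINT \<xi>::'a|lborel. \<bar>symbol (a n) (b n) \<xi> - symbol a' b' \<xi>\<bar>) / (2 * pi) ^ DIM('a)) \<longlonglongrightarrow> 0"
      using tendsto_divide[OF symbol_L1_tendsto[where 'a='a, OF assms] tendsto_const[of "(2 * pi) ^ DIM('a)"]] by simp
  qed
  then show ?thesis by (simp add: LIM_zero_iff)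
qed

lemma p_kernel_gaussian:
  fixes x :: "'a::euclidean_space"
  assumes a: "0 < a"
  shows "p_kernel a 0 x = (4 * pi * a) powr (- real DIM('a) / 2) * exp (- (norm x)\<^sup>2 / (4 * a))"
proof -
  have "sqrt (pi / a) / (2 * pi) = (4 * pi * a) powr (- 1 / 2)"
  proof -
    have "(4 * pi * a) powr (- 1 / 2) = inverse (sqrt (4 * pi * a))"
      using a by (simp add: powr_minus powr_half_sqrt)
    also have "\<dots> = sqrt (pi / a) / (2 * pi)"
      using a by (simp add: real_sqrt_mult real_sqrt_divide field_simps)
    finally show ?thesis by simp
  qed
  then have "(sqrt (pi / a) / (2 * pi)) ^ DIM('a) = (4 * pi * a) powr (- real DIM('a) / 2)"
    using a by (simp add: powr_realpow[symmetric] powr_powr)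
  moreover have "p_kernel a 0 x = (sqrt (pi / a) / (2 * pi)) ^ DIM('a) * exp (- (norm x)\<^sup>2 / (4 * a))"
    unfolding p_kernel_def symbol_gaussian gaussian_fourier[OF a] by (simp add: power_divide)
  ultimately show ?thesis by simp
qed

text \<open>The damping exp(-e^2 |y|^2) makes Fubini available before the kernel is known to be
  integrable. The inner integral is then a Gauss kernel centred at \<eta> or at -\<eta>; both occur
  because cos u cos v is half of cos (u + v) + cos (u - v).\<close>

lemma p_kernel_gauss_regularized:
  fixes \<eta> :: "'a::euclidean_space"
  assumes ab: "0 < a" "0 \<le> b" and e: "0 < e"
  shows "(LINT y|lborel. cos (y \<bullet> \<eta>) * (p_kernel a b y * exp (- (e\<^sup>2) * (norm y)\<^sup>2)))
    = (LINT z|lborel. (symbol a b (\<eta> + e *\<^sub>R z) + symbol a b (- \<eta> + e *\<^sub>R z)) / 2 * p_kernel 1 0 z)"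
proof -
  let ?\<Phi> = "symbol a b :: 'a \<Rightarrow> real"
  let ?G = "\<lambda>y::'a. exp (- (e\<^sup>2) * (norm y)\<^sup>2)"
  have \<Phi>: "integrable lborel ?\<Phi>" using \<sigma> ab by (intro integrable_symbol) auto
  have G: "integrable lborel ?G" using e by (intro integrable_gaussian) auto
  let ?F = "\<lambda>(y::'a, \<xi>). cos (y \<bullet> \<eta>) * (cos (y \<bullet> \<xi>) * ?\<Phi> \<xi>) * ?G y"
  have F: "integrable (lborel \<Otimes>\<^sub>M lborel) ?F"
  proof (rule integrable_lborel_pair_bound[OF _ G \<Phi>])
    fix y \<xi> :: 'a
    have "\<bar>cos (y \<bullet> \<eta>)\<bar> * (\<bar>cos (y \<bullet> \<xi>)\<bar> * ?\<Phi> \<xi>) * ?G y \<le> 1 * (1 * ?\<Phi> \<xi>) * ?G y"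
      by (intro mult_mono mult_nonneg_nonneg) auto
    then show "\<bar>?F (y, \<xi>)\<bar> \<le> ?G y * ?\<Phi> \<xi>" by (simp add: abs_mult mult.commute)
  qed measurable
  have "(LINT y|lborel. cos (y \<bullet> \<eta>) * (p_kernel a b y * ?G y))
      = (LINT y|lborel. (LINT \<xi>|lborel. ?F (y, \<xi>)) / (2 * pi) ^ DIM('a))"
  proof (intro Bochner_Integration.integral_cong refl)
    fix y :: 'a
    have "(LINT \<xi>|lborel. ?F (y, \<xi>)) = cos (y \<bullet> \<eta>) * (LINT \<xi>|lborel. cos (y \<bullet> \<xi>) * ?\<Phi> \<xi>) * ?G y"
      unfolding prod.case by (simp only: integral_mult_left_zero integral_mult_right_zero)
    then show "cos (y \<bullet> \<eta>) * (p_kernel a b y * ?G y) = (LINT \<xi>|lborel. ?F (y, \<xi>)) / (2 * pi) ^ DIM('a)"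
      by (simp only: p_kernel_def times_divide_eq_right times_divide_eq_left mult.assoc)
  qed
  also have "\<dots> = (LINT y|lborel. (LINT \<xi>|lborel. ?F (y, \<xi>))) / (2 * pi) ^ DIM('a)"
    by (rule integral_divide_zero)
  also have "\<dots> = (LINT \<xi>|lborel. (LINT y|lborel. ?F (y, \<xi>))) / (2 * pi) ^ DIM('a)"
    using lborel_pair.Fubini_integral[of "\<lambda>y \<xi>. ?F (y, \<xi>)"] F by (simp add: case_prod_beta')
  also have "\<dots> = (LINT \<xi>|lborel. (LINT y|lborel. ?F (y, \<xi>)) / (2 * pi) ^ DIM('a))"
    by (rule integral_divide_zero[symmetric])
  also have "\<dots> = (LINT \<xi>|lborel. ?\<Phi> \<xi> / 2 * p_kernel (e\<^sup>2) 0 (\<xi> + \<eta>) + ?\<Phi> \<xi> / 2 * p_kernel (e\<^sup>2) 0 (\<xi> - \<eta>))"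
  proof (intro Bochner_Integration.integral_cong refl)
    fix \<xi> :: 'a
    have c: "integrable lborel (\<lambda>y::'a. cos (v \<bullet> y) * ?G y)" for v by (rule integrable_cos_symbol[OF G]) measurable
    have "(LINT y|lborel. ?F (y, \<xi>)) = (LINT y|lborel. ?\<Phi> \<xi> / 2 * (cos ((\<xi> + \<eta>) \<bullet> y) * ?G y) + ?\<Phi> \<xi> / 2 * (cos ((\<xi> - \<eta>) \<bullet> y) * ?G y))"
      by (intro Bochner_Integration.integral_cong refl)
         (simp add: inner_add_left inner_diff_left inner_commute[of _ \<eta>] inner_commute[of _ \<xi>] cos_add cos_diff field_simps)
    also have "\<dots> = ?\<Phi> \<xi> / 2 * (LINT y|lborel. cos ((\<xi> + \<eta>) \<bullet> y) * ?G y) + ?\<Phi> \<xi> / 2 * (LINT y|lborel. cos ((\<xi> - \<eta>) \<bullet> y) * ?G y)"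
      using c[of "\<xi> + \<eta>"] c[of "\<xi> - \<eta>"] by simp
    finally show "(LINT y|lborel. ?F (y, \<xi>)) / (2 * pi) ^ DIM('a) =
       ?\<Phi> \<xi> / 2 * p_kernel (e\<^sup>2) 0 (\<xi> + \<eta>) + ?\<Phi> \<xi> / 2 * p_kernel (e\<^sup>2) 0 (\<xi> - \<eta>)"
      by (simp add: p_kernel_def symbol_gaussian add_divide_distrib)
  qed
  \<comment> \<open>Translation to the centre of each Gauss kernel and dilation by e normalise both
    to \<open>p_kernel 1 0\<close>, so that e remains only inside the symbol.\<close>
  also have "\<dots> = (LINT z|lborel. ?\<Phi> (- \<eta> + e *\<^sub>R z) / 2 * p_kernel 1 0 z + ?\<Phi> (\<eta> + e *\<^sub>R z) / 2 * p_kernel 1 0 z)"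
  proof -
    have scale: "p_kernel (e\<^sup>2) 0 (e *\<^sub>R z) * e ^ DIM('a) = p_kernel 1 0 z" for z :: 'a
    proof -
      have "(4 * pi * e\<^sup>2) powr (- real DIM('a) / 2) * e ^ DIM('a) = (4 * pi) powr (- real DIM('a) / 2)"
      proof -
        have "(4 * pi * e\<^sup>2) powr (- real DIM('a) / 2) = (4 * pi) powr (- real DIM('a) / 2) * (e\<^sup>2) powr (- real DIM('a) / 2)"
          using e by (simp add: powr_mult)
        also have "(e\<^sup>2) powr (- real DIM('a) / 2) = e powr (- real DIM('a))"
          using e by (simp add: powr_powr flip: powr_numeral)
        finally show ?thesis using e by (simp add: powr_minus powr_realpow field_simps)
      qed
      then show ?thesis using e
        by (simp add: p_kernel_gaussian power_mult_distrib mult_ac)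
    qed
    have K: "integrable lborel (\<lambda>\<xi>. ?\<Phi> \<xi> / 2 * p_kernel (e\<^sup>2) 0 (\<xi> + v))" for v
    proof (rule Bochner_Integration.integrable_bound)
      show "integrable lborel (\<lambda>\<xi>. ?\<Phi> \<xi> / 2 * (4 * pi * e\<^sup>2) powr (- real DIM('a) / 2))" using \<Phi> by simp
      show "AE \<xi> in lborel. norm (?\<Phi> \<xi> / 2 * p_kernel (e\<^sup>2) 0 (\<xi> + v)) \<le> norm (?\<Phi> \<xi> / 2 * (4 * pi * e\<^sup>2) powr (- real DIM('a) / 2))"
        using e by (auto intro!: AE_I2 mult_left_mono simp: p_kernel_gaussian abs_mult mult_left_le)
    qed measurable
    have eq: "?\<Phi> (- v + e *\<^sub>R z) / 2 * p_kernel 1 0 z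
        = e ^ DIM('a) * (?\<Phi> (- v + e *\<^sub>R z) / 2 * p_kernel (e\<^sup>2) 0 (- v + e *\<^sub>R z + v))" for v z
      by (simp add: mult_ac flip: scale)
    have I: "(LINT \<xi>|lborel. ?\<Phi> \<xi> / 2 * p_kernel (e\<^sup>2) 0 (\<xi> + v)) = (LINT z|lborel. ?\<Phi> (- v + e *\<^sub>R z) / 2 * p_kernel 1 0 z)" for v
      unfolding eq integral_mult_right_zero using integral_lborel_affine[OF _ K, of e v "- v"] e by simp
    have J: "integrable lborel (\<lambda>z. ?\<Phi> (- v + e *\<^sub>R z) / 2 * p_kernel 1 0 z)" for v
      unfolding eq using integrable_lborel_affine[OF _ K, of e "- v" v] e by (intro integrable_mult_right) simp
    show ?thesis
      using I[of \<eta>] I[of "- \<eta>"] J[of \<eta>] J[of "- \<eta>"] K[of \<eta>] K[of "- \<eta>"] by simp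
  qed
  also have "\<dots> = (LINT z|lborel. (?\<Phi> (\<eta> + e *\<^sub>R z) + ?\<Phi> (- \<eta> + e *\<^sub>R z)) / 2 * p_kernel 1 0 z)"
    by (intro Bochner_Integration.integral_cong refl) (simp add: field_simps)
  finally show ?thesis .
qed

text \<open>As the damping is removed, the damped transforms converge to the symbol by continuity of
  the latter. For \<eta> = 0 the damped kernels increase, by nonnegativity, so monotone convergence
  gives integrability. The kernel itself then serves as majorant for the transform at every
  \<eta>.\<close>

lemma
  fixes \<eta> :: "'a::euclidean_space"
  assumes ab: "0 < a" "0 \<le> b"
  shows integrable_p_kernel: "integrable lborel (p_kernel a b :: 'a \<Rightarrow> real)"
    and p_kernel_fourier: "(LINT y|lborel. cos (y \<bullet> \<eta>) * p_kernel a b y) = symbol a b \<eta>"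
    and integral_p_kernel: "integral\<^sup>L lborel (p_kernel a b :: 'a \<Rightarrow> real) = 1"
proof -
  let ?S = "p_kernel a b :: 'a \<Rightarrow> real"
  let ?N = "p_kernel 1 0 :: 'a \<Rightarrow> real"
  let ?\<Phi> = "symbol a b :: 'a \<Rightarrow> real"
  define e where "e = (\<lambda>n. 1 / real (Suc n))"
  have e: "0 < e n" "e n \<le> 1" for n by (auto simp: e_def)
  have e_lim: "e \<longlonglongrightarrow> 0" unfolding e_def by real_asymp
  have S0: "0 \<le> ?S y" for y by (rule p_kernel_nonneg[OF ab])
  have N0: "0 \<le> ?N y" for y by (rule p_kernel_nonneg) auto
  have N: "integrable lborel ?N" "integral\<^sup>L lborel ?N = 1"
  proof -
    have N_eq: "?N = (\<lambda>x. (4 * pi) powr (- real DIM('a) / 2) * exp (- (1 / 4) * (norm x)\<^sup>2))"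
      by (simp add: p_kernel_gaussian fun_eq_iff)
    show "integrable lborel ?N" unfolding N_eq using integrable_gaussian[where 'a='a, of "1 / 4"] by (intro integrable_mult_right) auto
    have "(4 * pi) powr (- real DIM('a) / 2) * sqrt (pi / (1 / 4)) ^ DIM('a) = 1"
      by (simp add: powr_half_sqrt[symmetric] powr_powr powr_minus mult.commute[of pi] flip: powr_realpow)
    then show "integral\<^sup>L lborel ?N = 1" unfolding N_eq using gaussian_fourier[of "1 / 4" "0::'a"] by simp
  qed
  have \<Phi>1: "?\<Phi> z \<le> 1" for z
  proof -
    have "0 \<le> a * (norm z)\<^sup>2" "0 \<le> b * norm z powr (2 * \<sigma>)" using ab by auto
    then show ?thesis unfolding symbol_def exp_le_one_iff by linarith
  qed
  have lim: "(\<lambda>n. LINT y|lborel. cos (y \<bullet> \<eta>) * (?S y * exp (- ((e n)\<^sup>2) * (norm y)\<^sup>2))) \<longlonglongrightarrow> ?\<Phi> \<eta>" for \<eta>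
  proof -
    have "(\<lambda>n. LINT z|lborel. (?\<Phi> (\<eta> + e n *\<^sub>R z) + ?\<Phi> (- \<eta> + e n *\<^sub>R z)) / 2 * ?N z) \<longlonglongrightarrow> (LINT z|lborel. (?\<Phi> \<eta> + ?\<Phi> (- \<eta>)) / 2 * ?N z)"
    proof (rule integral_dominated_convergence[OF _ _ N(1)])
      show "AE z in lborel. norm ((?\<Phi> (\<eta> + e n *\<^sub>R z) + ?\<Phi> (- \<eta> + e n *\<^sub>R z)) / 2 * ?N z) \<le> ?N z" for n
      proof (rule AE_I2)
        fix z
        have "(?\<Phi> (\<eta> + e n *\<^sub>R z) + ?\<Phi> (- \<eta> + e n *\<^sub>R z)) / 2 * ?N z \<le> 1 * ?N z"
          using \<Phi>1[of "\<eta> + e n *\<^sub>R z"] \<Phi>1[of "- \<eta> + e n *\<^sub>R z"] N0[of z] by (intro mult_right_mono) auto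
        then show "norm ((?\<Phi> (\<eta> + e n *\<^sub>R z) + ?\<Phi> (- \<eta> + e n *\<^sub>R z)) / 2 * ?N z) \<le> ?N z"
          using N0[of z] by (simp add: abs_mult)
      qed
      have c: "isCont ?\<Phi> v" for v
        unfolding symbol_def using \<sigma> by (intro continuous_intros continuous_at_within_powr) auto
      have "(\<lambda>n. ?\<Phi> (v + e n *\<^sub>R z)) \<longlonglongrightarrow> ?\<Phi> (v + 0 *\<^sub>R z)" for v z
        by (intro isCont_tendsto_compose[OF c] tendsto_intros e_lim)
      then show "AE z in lborel. (\<lambda>n. (?\<Phi> (\<eta> + e n *\<^sub>R z) + ?\<Phi> (- \<eta> + e n *\<^sub>R z)) / 2 * ?N z) \<longlonglongrightarrow> (?\<Phi> \<eta> + ?\<Phi> (- \<eta>)) / 2 * ?N z"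
        by (intro AE_I2 tendsto_mult tendsto_divide tendsto_add tendsto_const) (simp_all del: add_uminus_conv_diff uminus_add_conv_diff)
    qed measurable
    moreover have "(LINT z|lborel. (?\<Phi> \<eta> + ?\<Phi> (- \<eta>)) / 2 * ?N z) = ?\<Phi> \<eta>"
      using N by (simp add: symbol_uminus)
    ultimately show ?thesis
      unfolding p_kernel_gauss_regularized[OF ab e(1)] by (simp only:)
  qed
  have Gint: "integrable lborel (\<lambda>y. ?S y * exp (- ((e n)\<^sup>2) * (norm y)\<^sup>2))" for n
  proof (rule Bochner_Integration.integrable_bound)
    show "integrable lborel (\<lambda>y::'a. integral\<^sup>L lborel ?\<Phi> / (2 * pi) ^ DIM('a) * exp (- ((e n)\<^sup>2) * (norm y)\<^sup>2))"
      using e[of n] by (intro integrable_mult_right integrable_gaussian) auto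
    have "\<bar>?S y\<bar> \<le> integral\<^sup>L lborel ?\<Phi> / (2 * pi) ^ DIM('a)" for y
      using \<sigma> ab by (intro p_kernel_abs_le integrable_symbol) auto
    then show "AE y in lborel. norm (?S y * exp (- ((e n)\<^sup>2) * (norm y)\<^sup>2)) \<le>
        norm (integral\<^sup>L lborel ?\<Phi> / (2 * pi) ^ DIM('a) * exp (- ((e n)\<^sup>2) * (norm y)\<^sup>2))"
      unfolding real_norm_def abs_mult abs_exp_cancel
      by (intro AE_I2 mult_right_mono order_trans[OF _ abs_ge_self]) auto
  qed measurable
  have conv: "(\<lambda>n. ?S y * exp (- ((e n)\<^sup>2) * (norm y)\<^sup>2)) \<longlonglongrightarrow> ?S y" for y
  proof -
    have "(\<lambda>n. ?S y * exp (- ((e n)\<^sup>2) * (norm y)\<^sup>2)) \<longlonglongrightarrow> ?S y * exp (- (0\<^sup>2) * (norm y)\<^sup>2)"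
      by (intro tendsto_intros e_lim)
    then show ?thesis by simp
  qed
  have int: "integrable lborel ?S"
  proof (rule integrable_monotone_convergence[OF Gint])
    show "AE y in lborel. mono (\<lambda>n. ?S y * exp (- ((e n)\<^sup>2) * (norm y)\<^sup>2))"
    proof (intro AE_I2 monoI)
      fix y and m n :: nat assume "m \<le> n"
      then have "e n \<le> e m" by (simp add: e_def frac_le)
      then have "(e n)\<^sup>2 \<le> (e m)\<^sup>2" using e[of n] by (intro power_mono) auto
      then show "?S y * exp (- ((e m)\<^sup>2) * (norm y)\<^sup>2) \<le> ?S y * exp (- ((e n)\<^sup>2) * (norm y)\<^sup>2)"
        using S0 by (intro mult_left_mono) (auto intro: mult_right_mono)
    qed
    show "(\<lambda>n. LINT y|lborel. ?S y * exp (- ((e n)\<^sup>2) * (norm y)\<^sup>2)) \<longlonglongrightarrow> ?\<Phi> 0"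
      using lim[of 0] by simp
  qed (use conv in auto)
  then show "integrable lborel ?S" .
  show F: "(LINT y|lborel. cos (y \<bullet> \<eta>) * ?S y) = ?\<Phi> \<eta>" for \<eta>
  proof (rule LIMSEQ_unique[OF _ lim])
    show "(\<lambda>n. LINT y|lborel. cos (y \<bullet> \<eta>) * (?S y * exp (- ((e n)\<^sup>2) * (norm y)\<^sup>2))) \<longlonglongrightarrow> (LINT y|lborel. cos (y \<bullet> \<eta>) * ?S y)"
    proof (rule integral_dominated_convergence[OF _ _ int])
      show "AE y in lborel. norm (cos (y \<bullet> \<eta>) * (?S y * exp (- ((e n)\<^sup>2) * (norm y)\<^sup>2))) \<le> ?S y" for n
      proof (rule AE_I2)
        fix y
        have "\<bar>cos (y \<bullet> \<eta>)\<bar> * (?S y * exp (- ((e n)\<^sup>2) * (norm y)\<^sup>2)) \<le> 1 * (?S y * 1)"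
          using S0 by (intro mult_mono) auto
        then show "norm (cos (y \<bullet> \<eta>) * (?S y * exp (- ((e n)\<^sup>2) * (norm y)\<^sup>2))) \<le> ?S y"
          using S0[of y] by (simp add: abs_mult)
      qed
      show "AE y in lborel. (\<lambda>n. cos (y \<bullet> \<eta>) * (?S y * exp (- ((e n)\<^sup>2) * (norm y)\<^sup>2))) \<longlonglongrightarrow> cos (y \<bullet> \<eta>) * ?S y"
        by (intro AE_I2 tendsto_mult_left conv)
    qed measurable
  qed
  show "integral\<^sup>L lborel ?S = 1"
    using F[of 0] \<sigma> by (simp add: symbol_def)
qed

text \<open>The first kernel is expanded as a Fourier integral, which requires only an integrable
  symbol, while the second is integrated against cosines and has to be integrable itself. This
  asymmetry admits a = 0, the purely fractional kernel, in first position.\<close>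

lemma p_kernel_convolution:
  fixes x :: "'a::euclidean_space"
  assumes ab: "0 \<le> a" "0 \<le> b" "0 < a \<or> 0 < b" and ab': "0 < a'" "0 \<le> b'"
  shows "(LINT y|lborel. p_kernel a b (x - y) * p_kernel a' b' y) = p_kernel (a + a') (b + b') x"
proof -
  let ?S = "p_kernel a' b' :: 'a \<Rightarrow> real"
  let ?\<Phi> = "symbol a b :: 'a \<Rightarrow> real"
  have S: "integrable lborel ?S" by (rule integrable_p_kernel[OF ab'])
  have S0: "0 \<le> ?S y" for y by (rule p_kernel_nonneg[OF ab'])
  have \<Phi>: "integrable lborel ?\<Phi>" using \<sigma> ab by (intro integrable_symbol) auto
  let ?F = "\<lambda>(y::'a, \<xi>). cos ((x - y) \<bullet> \<xi>) * ?S y * ?\<Phi> \<xi>"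
  have F: "integrable (lborel \<Otimes>\<^sub>M lborel) ?F"
  proof (rule integrable_lborel_pair_bound[OF _ S \<Phi>])
    fix y \<xi> :: 'a
    have "\<bar>cos ((x - y) \<bullet> \<xi>)\<bar> * (?S y * ?\<Phi> \<xi>) \<le> 1 * (?S y * ?\<Phi> \<xi>)"
      using S0 by (intro mult_right_mono) auto
    then show "\<bar>?F (y, \<xi>)\<bar> \<le> ?S y * ?\<Phi> \<xi>" using S0 by (simp add: abs_mult mult_ac)
  qed measurable
  have "(LINT y|lborel. p_kernel a b (x - y) * ?S y) = (LINT y|lborel. (LINT \<xi>|lborel. ?F (y, \<xi>)) / (2 * pi) ^ DIM('a))"
  proof (intro Bochner_Integration.integral_cong refl)
    fix y :: 'a
    have "(LINT \<xi>|lborel. ?F (y, \<xi>)) = (LINT \<xi>|lborel. (cos ((x - y) \<bullet> \<xi>) * ?\<Phi> \<xi>) * ?S y)"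
      by (simp add: mult_ac)
    also have "\<dots> = (LINT \<xi>|lborel. (cos ((x - y) \<bullet> \<xi>) * ?\<Phi> \<xi>)) * ?S y"
      by (rule integral_mult_left_zero)
    finally show "p_kernel a b (x - y) * ?S y = (LINT \<xi>|lborel. ?F (y, \<xi>)) / (2 * pi) ^ DIM('a)"
      by (simp only: p_kernel_def[of a b] times_divide_eq_left)
  qed
  also have "\<dots> = (LINT y|lborel. (LINT \<xi>|lborel. ?F (y, \<xi>))) / (2 * pi) ^ DIM('a)"
    by (rule integral_divide_zero)
  also have "(LINT y|lborel. (LINT \<xi>|lborel. ?F (y, \<xi>))) = (LINT \<xi>|lborel. (LINT y|lborel. ?F (y, \<xi>)))"
    using lborel_pair.Fubini_integral[of "\<lambda>y \<xi>. ?F (y, \<xi>)"] F by (simp add: case_prod_beta')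
  also have "\<dots> = (LINT \<xi>|lborel. cos (x \<bullet> \<xi>) * symbol (a + a') (b + b') \<xi>)"
  proof (intro Bochner_Integration.integral_cong refl)
    fix \<xi> :: 'a
    have "(LINT y|lborel. ?F (y, \<xi>)) = (LINT y|lborel. cos ((x - y) \<bullet> \<xi>) * ?S y) * ?\<Phi> \<xi>"
      unfolding prod.case by (rule integral_mult_left_zero)
    also have "\<dots> = cos (x \<bullet> \<xi>) * (?\<Phi> \<xi> * symbol a' b' \<xi>)"
      by (simp add: integral_cos_shift_even[OF S] p_kernel_uminus p_kernel_fourier[OF ab'])
    finally show "(LINT y|lborel. ?F (y, \<xi>)) = cos (x \<bullet> \<xi>) * symbol (a + a') (b + b') \<xi>"
      by (simp only: symbol_add)
  qed
  finally show ?thesis by (simp only: p_kernel_def)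
qed

lemma frac_heat_kernel_eq:
  assumes "0 < t"
  shows "frac_heat_kernel \<sigma> t (x :: 'a::euclidean_space) = p_kernel 0 t x"
proof -
  have \<Phi>: "integrable lborel (symbol 0 t :: 'a \<Rightarrow> real)" using assms by (intro integrable_symbol) auto
  have "integrable lborel (\<lambda>\<xi>::'a. cis (x \<bullet> \<xi>) * of_real (symbol 0 t \<xi>))"
    by (rule Bochner_Integration.integrable_bound[OF \<Phi>]) (auto simp: norm_mult intro!: AE_I2)
  then have "Re (LINT \<xi>|lborel. cis (x \<bullet> \<xi>) * of_real (symbol 0 t \<xi>))
      = (LINT \<xi>|lborel. Re (cis (x \<bullet> \<xi>) * of_real (symbol 0 t \<xi>)))"
    by (rule integral_Re[symmetric])
  also have "\<dots> = (LINT \<xi>|lborel. cos (x \<bullet> \<xi>) * symbol 0 t \<xi>)" by simp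
  finally show ?thesis
    unfolding frac_heat_kernel_def p_kernel_def by (simp add: symbol_def frac_laplacian_symbol_def)
qed

lemma mixed_heat_kernel_eq:
  fixes x :: "'a::euclidean_space"
  assumes t: "0 < t"
  shows "mixed_heat_kernel \<sigma> t x = p_kernel t t x"
proof -
  have "mixed_heat_kernel \<sigma> t x = (LINT \<xi>|lborel. p_kernel t 0 (x - \<xi>) * p_kernel 0 t \<xi>)"
    unfolding mixed_heat_kernel_def p_kernel_gaussian[OF t] frac_heat_kernel_eq[OF t]
    by (simp add: mult.assoc)
  \<comment> \<open>The factors are exchanged so that the Gauss kernel takes the second place, where
    a positive heat parameter is demanded.\<close>
  also have "\<dots> = (LINT \<xi>|lborel. p_kernel 0 t (x - \<xi>) * p_kernel t 0 \<xi>)"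
    by (subst integral_lborel_reflect[of _ x, symmetric]) (simp add: mult.commute)
  also have "\<dots> = p_kernel (0 + t) (t + 0) x"
    using t by (intro p_kernel_convolution) auto
  finally show ?thesis by simp
qed

section \<open>Kernel bounds\<close>

lemma symbol_scale:
  assumes "0 < l"
  shows "symbol a b (l *\<^sub>R \<xi>) = symbol (a * l\<^sup>2) (b * l powr (2 * \<sigma>)) \<xi>"
  using assms by (simp add: symbol_def power_mult_distrib powr_mult mult.assoc)

lemma p_kernel_scale:
  fixes x :: "'a::euclidean_space"
  assumes "0 \<le> a" "0 \<le> b" "0 < a \<or> 0 < b" and l: "0 < l"
  shows "p_kernel a b x = l ^ DIM('a) * p_kernel (a * l\<^sup>2) (b * l powr (2 * \<sigma>)) (l *\<^sub>R x)"
proof -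
  have "integrable lborel (\<lambda>\<xi>. cos (x \<bullet> \<xi>) * symbol a b \<xi>)"
    by (intro integrable_cos_symbol integrable_symbol assms) measurable
  from integral_lborel_affine[OF _ this, of l 0] l show ?thesis
    by (simp add: p_kernel_def symbol_scale)
qed

text \<open>Dilation by l = t^(-1/(2\<sigma>)) normalises the fractional time to 1. Its Jacobian l^d
  is the decay factor t^(-d/(2\<sigma>)).\<close>

lemma integral_symbol_scale:
  assumes t: "0 < t"
  shows "integral\<^sup>L lborel (symbol 0 t :: 'a::euclidean_space \<Rightarrow> real)
    = t powr (- real DIM('a) / (2 * \<sigma>)) * integral\<^sup>L lborel (symbol 0 1 :: 'a \<Rightarrow> real)"
proof -
  let ?l = "t powr (- 1 / (2 * \<sigma>))"
  have "integrable lborel (symbol 0 t :: 'a \<Rightarrow> real)"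
    using \<sigma> t by (intro integrable_symbol) auto
  from integral_lborel_affine[OF _ this, of ?l 0] t
  have "integral\<^sup>L lborel (symbol 0 t :: 'a \<Rightarrow> real)
      = ?l ^ DIM('a) * integral\<^sup>L lborel (symbol 0 (t * ?l powr (2 * \<sigma>)) :: 'a \<Rightarrow> real)"
    by (simp add: symbol_scale)
  moreover have "?l powr (2 * \<sigma>) = t powr - 1" using \<sigma> by (simp add: powr_powr)
  then have "t * ?l powr (2 * \<sigma>) = 1" using t by (simp add: powr_minus)
  moreover have "?l ^ DIM('a) = t powr (- real DIM('a) / (2 * \<sigma>))"
    using t by (simp add: powr_powr flip: powr_realpow)
  ultimately show ?thesis by simp
qed

text \<open>From |\<xi>|^(2\<sigma>) \<le> 1 + |\<xi>|^2, the extra unit of heat time can be traded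
  for a unit of fractional time at the price of a factor e. This leaves the symbol of purely
  fractional time 1 + s, whose integral scales exactly.\<close>

lemma p_kernel_upper:
  obtains A where "0 < A"
    "\<And>s (x::'a::euclidean_space). 0 \<le> s \<Longrightarrow> p_kernel (1 + s) s x \<le> A * (1 + s) powr (- real DIM('a) / (2 * \<sigma>))"
proof -
  let ?A = "exp 1 * integral\<^sup>L lborel (symbol 0 1 :: 'a \<Rightarrow> real) / (2 * pi) ^ DIM('a)"
  show thesis
  proof
    have "0 < integral\<^sup>L lborel (symbol 0 1 :: 'a \<Rightarrow> real)"
      using \<sigma> by (intro integral_lborel_pos integrable_symbol) auto
    then show "0 < ?A" by simp
    fix s :: real and x :: 'a assume s: "0 \<le> s"
    have "symbol (1 + s) s \<xi> \<le> exp 1 * symbol 0 (1 + s) \<xi>" for \<xi> :: 'a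
    proof -
      have "norm \<xi> powr (2 * \<sigma>) \<le> 1 + (norm \<xi>)\<^sup>2"
      proof (cases "norm \<xi> \<le> 1")
        case True
        then have "norm \<xi> powr (2 * \<sigma>) \<le> 1" using \<sigma> by (intro powr_le1) auto
        then show ?thesis using zero_le_power2[of "norm \<xi>"] by linarith
      next
        case False
        then have "norm \<xi> powr (2 * \<sigma>) \<le> norm \<xi> powr 2" using \<sigma> by (intro powr_mono) auto
        then show ?thesis using False by simp
      qed
      moreover have "0 \<le> s * (norm \<xi>)\<^sup>2" using s by simp
      ultimately have "- (1 + s) * (norm \<xi>)\<^sup>2 - s * norm \<xi> powr (2 * \<sigma>) \<le> 1 - (1 + s) * norm \<xi> powr (2 * \<sigma>)"
        by (simp add: algebra_simps)
      then show ?thesis by (simp add: symbol_def flip: exp_add)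
    qed
    then have "integral\<^sup>L lborel (symbol (1 + s) s :: 'a \<Rightarrow> real) \<le> (LINT \<xi>::'a|lborel. exp 1 * symbol 0 (1 + s) \<xi>)"
      using s \<sigma> by (intro integral_mono integrable_mult_right integrable_symbol) auto
    also have "\<dots> = exp 1 * ((1 + s) powr (- real DIM('a) / (2 * \<sigma>)) * integral\<^sup>L lborel (symbol 0 1 :: 'a \<Rightarrow> real))"
      using s \<sigma> by (subst integral_mult_right_zero, subst integral_symbol_scale) auto
    finally have "integral\<^sup>L lborel (symbol (1 + s) s :: 'a \<Rightarrow> real) / (2 * pi) ^ DIM('a) \<le> ?A * (1 + s) powr (- real DIM('a) / (2 * \<sigma>))"
      by (simp add: divide_right_mono mult_ac)
    moreover have "\<bar>p_kernel (1 + s) s x\<bar> \<le> integral\<^sup>L lborel (symbol (1 + s) s :: 'a \<Rightarrow> real) / (2 * pi) ^ DIM('a)"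
      using s \<sigma> by (intro p_kernel_abs_le integrable_symbol) auto
    ultimately show "p_kernel (1 + s) s x \<le> ?A * (1 + s) powr (- real DIM('a) / (2 * \<sigma>))" by linarith
  qed
qed

text \<open>Dilation by t^(-1/(2\<sigma>)) reduces p_t to a kernel with fractional time 1 and some
  heat time \<delta> in [0,1]. What remains is a lower bound near the origin that is uniform in
  \<delta>.\<close>

lemma p_kernel_lower:
  obtains c R where "0 < c" "0 < R"
    "\<And>t (x::'a::euclidean_space). 1 \<le> t \<Longrightarrow> norm x \<le> R * t powr (1 / (2 * \<sigma>)) \<Longrightarrow>
       c * t powr (- real DIM('a) / (2 * \<sigma>)) \<le> p_kernel t t x"
proof -
  let ?\<Phi> = "\<lambda>\<delta>. symbol \<delta> 1 :: 'a \<Rightarrow> real"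
  \<comment> \<open>\<open>M\<close> is the integral of the smallest symbol (\<delta> = 1) and
    \<open>Q\<close> the loss away from the origin for the largest (\<delta> = 0). Bounding the
    value at 0 by one and the loss by the other removes the dependence on \<delta>.\<close>
  define M where "M = integral\<^sup>L lborel (?\<Phi> 1)"
  define Q where "Q = (\<lambda>y. LINT \<xi>|lborel. (1 - cos (y \<bullet> \<xi>)) * ?\<Phi> 0 \<xi>)"
  have \<Phi>: "integrable lborel (?\<Phi> \<delta>)" if "0 \<le> \<delta>" for \<delta> using \<sigma> that by (intro integrable_symbol) auto
  have C: "integrable lborel (\<lambda>\<xi>. (1 - cos (y \<bullet> \<xi>)) * ?\<Phi> \<delta> \<xi>)" if "0 \<le> \<delta>" for \<delta> y
    unfolding left_diff_distrib mult_1
    by (intro Bochner_Integration.integrable_diff integrable_cos_symbol \<Phi> that) measurable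
  have M: "0 < M" unfolding M_def by (intro integral_lborel_pos \<Phi>) auto
  have "(Q \<longlongrightarrow> 0) (at 0)"
    unfolding tendsto_at_iff_sequentially
  proof (intro allI impI)
    fix X :: "nat \<Rightarrow> 'a" assume X: "X \<longlonglongrightarrow> 0"
    have "(\<lambda>n. Q (X n)) \<longlonglongrightarrow> (LINT \<xi>::'a|lborel. 0)"
      unfolding Q_def
    proof (rule integral_dominated_convergence)
      show "integrable lborel (\<lambda>\<xi>. 2 * ?\<Phi> 0 \<xi>)" by (intro integrable_mult_right \<Phi>) auto
      show "AE \<xi> in lborel. norm ((1 - cos (X n \<bullet> \<xi>)) * ?\<Phi> 0 \<xi>) \<le> 2 * ?\<Phi> 0 \<xi>" for n
      proof (rule AE_I2)
        fix \<xi> :: 'a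
        have "\<bar>1 - cos (X n \<bullet> \<xi>)\<bar> \<le> 2" using cos_ge_minus_one[of "X n \<bullet> \<xi>"] cos_le_one[of "X n \<bullet> \<xi>"] by linarith
        then show "norm ((1 - cos (X n \<bullet> \<xi>)) * ?\<Phi> 0 \<xi>) \<le> 2 * ?\<Phi> 0 \<xi>" by (simp add: abs_mult)
      qed
      show "AE \<xi> in lborel. (\<lambda>n. (1 - cos (X n \<bullet> \<xi>)) * ?\<Phi> 0 \<xi>) \<longlonglongrightarrow> 0"
      proof (rule AE_I2)
        fix \<xi> :: 'a
        have "(\<lambda>n. (1 - cos (X n \<bullet> \<xi>)) * ?\<Phi> 0 \<xi>) \<longlonglongrightarrow> (1 - cos (0 \<bullet> \<xi>)) * ?\<Phi> 0 \<xi>" by (intro tendsto_intros X)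
        then show "(\<lambda>n. (1 - cos (X n \<bullet> \<xi>)) * ?\<Phi> 0 \<xi>) \<longlonglongrightarrow> 0" by simp
      qed
    qed measurable
    then show "(Q \<circ> X) \<longlonglongrightarrow> 0" by (simp add: o_def)
  qed
  then have "\<forall>\<^sub>F y in at 0. Q y < M / 2" using M by (intro order_tendstoD) auto
  then obtain \<rho> where \<rho>: "0 < \<rho>" "\<And>y. y \<noteq> 0 \<Longrightarrow> norm y < \<rho> \<Longrightarrow> Q y < M / 2"
    by (auto simp: eventually_at dist_norm)
  have Q: "Q y \<le> M / 2" if "norm y \<le> \<rho> / 2" for y
    using \<rho>(2)[of y] \<rho>(1) that M by (cases "y = 0") (auto simp: Q_def)
  have low: "M / 2 / (2 * pi) ^ DIM('a) \<le> p_kernel \<delta> 1 y" if "0 \<le> \<delta>" "\<delta> \<le> 1" "norm y \<le> \<rho> / 2" for \<delta> and y :: 'a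
  proof -
    have "M \<le> integral\<^sup>L lborel (?\<Phi> \<delta>)"
      unfolding M_def using that by (intro integral_mono \<Phi> symbol_mono) auto
    moreover have "(LINT \<xi>|lborel. (1 - cos (y \<bullet> \<xi>)) * ?\<Phi> \<delta> \<xi>) \<le> Q y"
      unfolding Q_def using that by (intro integral_mono C mult_left_mono symbol_mono) auto
    moreover have "(LINT \<xi>|lborel. cos (y \<bullet> \<xi>) * ?\<Phi> \<delta> \<xi>) = integral\<^sup>L lborel (?\<Phi> \<delta>) - (LINT \<xi>|lborel. (1 - cos (y \<bullet> \<xi>)) * ?\<Phi> \<delta> \<xi>)"
      using \<Phi>[OF that(1)] C[OF that(1), of y] by (subst Bochner_Integration.integral_diff[symmetric]) (auto simp: algebra_simps)
    ultimately have "M / 2 \<le> (LINT \<xi>|lborel. cos (y \<bullet> \<xi>) * ?\<Phi> \<delta> \<xi>)"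
      using Q[OF that(3)] by linarith
    then show ?thesis unfolding p_kernel_def by (intro divide_right_mono) auto
  qed
  show thesis
  proof
    show "0 < M / 2 / (2 * pi) ^ DIM('a)" using M by simp
    show "0 < \<rho> / 2" using \<rho> by simp
    fix t :: real and x :: 'a assume t: "1 \<le> t" and x: "norm x \<le> \<rho> / 2 * t powr (1 / (2 * \<sigma>))"
    define l where "l = t powr (- 1 / (2 * \<sigma>))"
    have l: "0 < l" using t by (simp add: l_def)
    have "l powr (2 * \<sigma>) = t powr - 1" using \<sigma> by (simp add: l_def powr_powr)
    then have tl: "t * l powr (2 * \<sigma>) = 1" using t by (simp add: powr_minus)
    \<comment> \<open>Here \<sigma> < 1 and t \<ge> 1 enter: the rescaled heat time is t^(1 -
      1/\<sigma>), with a negative exponent.\<close>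
    have tl2: "t * l\<^sup>2 \<le> 1"
    proof -
      have "l\<^sup>2 = t powr (- 1 / \<sigma>)" using t by (simp add: l_def powr_powr flip: powr_numeral)
      then have "t * l\<^sup>2 = t powr (1 + - 1 / \<sigma>)" using t unfolding powr_add by simp
      also have "\<dots> \<le> t powr 0" using t \<sigma> by (intro powr_mono) (auto simp: field_simps)
      finally show ?thesis using t by simp
    qed
    have "norm (l *\<^sub>R x) \<le> l * (\<rho> / 2 * t powr (1 / (2 * \<sigma>)))" using x l by simp
    also have "\<dots> = \<rho> / 2" using t by (simp add: l_def powr_minus)
    finally have "M / 2 / (2 * pi) ^ DIM('a) \<le> p_kernel (t * l\<^sup>2) 1 (l *\<^sub>R x)"
      using t tl2 by (intro low) auto
    then have "l ^ DIM('a) * (M / 2 / (2 * pi) ^ DIM('a)) \<le> l ^ DIM('a) * p_kernel (t * l\<^sup>2) 1 (l *\<^sub>R x)"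
      using l by (intro mult_left_mono) auto
    also have "\<dots> = p_kernel t t x"
      using p_kernel_scale[of t t l x] l t \<sigma> tl by simp
    finally have "l ^ DIM('a) * (M / 2 / (2 * pi) ^ DIM('a)) \<le> p_kernel t t x" .
    moreover have "l ^ DIM('a) = t powr (- real DIM('a) / (2 * \<sigma>))"
      using t by (simp add: l_def powr_powr flip: powr_realpow)
    ultimately show "M / 2 / (2 * pi) ^ DIM('a) * t powr (- real DIM('a) / (2 * \<sigma>)) \<le> p_kernel t t x"
      by (simp add: mult.commute)
  qed
qed

text \<open>The semigroup with values in [0,\<infinity>], where all exchanges of integrals are
  instances of Tonelli. It is meant for t > 0; unlike \<open>heat_semigroup\<close> it is not the
  identity at t = 0, so later time integrals run over half-open intervals.\<close>

definition heat_nn :: "real \<Rightarrow> ('a::euclidean_space \<Rightarrow> ennreal) \<Rightarrow> 'a \<Rightarrow> ennreal" where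
  "heat_nn t \<phi> x = (\<integral>\<^sup>+y. ennreal (p_kernel t t (x - y)) * \<phi> y \<partial>lborel)"

lemma nn_integral_p_kernel:
  assumes "0 < a" "0 \<le> b"
  shows "(\<integral>\<^sup>+x. ennreal (p_kernel a b (x :: 'a::euclidean_space)) \<partial>lborel) = 1"
  using nn_integral_eq_integral[OF integrable_p_kernel[OF assms, where 'a='a]]
  by (simp add: integral_p_kernel[OF assms] p_kernel_nonneg[OF assms])

lemma nn_integral_p_kernel_reflect:
  assumes "0 < a" "0 \<le> b"
  shows "(\<integral>\<^sup>+y. ennreal (p_kernel a b (x - y :: 'a::euclidean_space)) \<partial>lborel) = 1"
  using nn_integral_lborel_reflect[of "\<lambda>x. ennreal (p_kernel a b x)" x] nn_integral_p_kernel[OF assms, where 'a='a] by simp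

lemma nn_integral_p_kernel_convolution:
  fixes x y :: "'a::euclidean_space"
  assumes ab: "0 < a" "0 \<le> b" and ab': "0 < a'" "0 \<le> b'"
  shows "(\<integral>\<^sup>+z. ennreal (p_kernel a b (x - z)) * ennreal (p_kernel a' b' (z - y)) \<partial>lborel)
    = ennreal (p_kernel (a + a') (b + b') (x - y))"
proof -
  let ?f = "\<lambda>z. p_kernel a b (x - y - z) * p_kernel a' b' z"
  have "(\<integral>\<^sup>+z. ennreal (p_kernel a b (x - z)) * ennreal (p_kernel a' b' (z - y)) \<partial>lborel)
      = (\<integral>\<^sup>+z. ennreal (?f (z - y)) \<partial>lborel)"
    by (simp add: ennreal_mult' p_kernel_nonneg[OF ab])
  also have "\<dots> = (\<integral>\<^sup>+z. ennreal (?f z) \<partial>lborel)"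
    by (rule nn_integral_lborel_shift) measurable
  also have "\<dots> = ennreal (LINT z|lborel. ?f z)"
  proof (rule nn_integral_eq_integral)
    show "integrable lborel ?f"
    proof (rule Bochner_Integration.integrable_bound)
      let ?C = "integral\<^sup>L lborel (symbol a b :: 'a \<Rightarrow> real) / (2 * pi) ^ DIM('a)"
      show "integrable lborel (\<lambda>z::'a. ?C * p_kernel a' b' z)"
        by (intro integrable_mult_right integrable_p_kernel ab')
      have "\<bar>p_kernel a b (x - y - z)\<bar> \<le> ?C" for z
        using \<sigma> ab by (intro p_kernel_abs_le integrable_symbol) auto
      then show "AE z in lborel. norm (?f z) \<le> norm (?C * p_kernel a' b' z)"
        unfolding real_norm_def abs_mult by (intro AE_I2 mult_right_mono order_trans[OF _ abs_ge_self] abs_ge_zero)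
    qed measurable
  qed (auto simp: p_kernel_nonneg[OF ab] p_kernel_nonneg[OF ab'])
  finally show ?thesis using ab ab' by (simp add: p_kernel_convolution)
qed

lemma heat_nn_measurable [measurable]:
  assumes [measurable]: "\<phi> \<in> borel_measurable borel"
  shows "heat_nn a \<phi> \<in> borel_measurable borel"
  unfolding heat_nn_def by measurable

lemma heat_nn_semigroup:
  fixes x :: "'a::euclidean_space"
  assumes ab: "0 < a" "0 < b" and [measurable]: "\<phi> \<in> borel_measurable borel"
  shows "heat_nn a (heat_nn b \<phi>) x = heat_nn (a + b) \<phi> x"
proof -
  have "heat_nn a (heat_nn b \<phi>) x
      = (\<integral>\<^sup>+z. (\<integral>\<^sup>+y. ennreal (p_kernel a a (x - z)) * (ennreal (p_kernel b b (z - y)) * \<phi> y) \<partial>lborel) \<partial>lborel)"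
    unfolding heat_nn_def by (intro nn_integral_cong nn_integral_cmult[symmetric]) measurable
  also have "\<dots> = (\<integral>\<^sup>+y. (\<integral>\<^sup>+z. ennreal (p_kernel a a (x - z)) * (ennreal (p_kernel b b (z - y)) * \<phi> y) \<partial>lborel) \<partial>lborel)"
    by (rule lborel_pair.Fubini') measurable
  also have "\<dots> = (\<integral>\<^sup>+y. (\<integral>\<^sup>+z. ennreal (p_kernel a a (x - z)) * ennreal (p_kernel b b (z - y)) \<partial>lborel) * \<phi> y \<partial>lborel)"
    unfolding mult.assoc[symmetric] by (intro nn_integral_cong nn_integral_multc) measurable
  also have "\<dots> = heat_nn (a + b) \<phi> x"
    unfolding heat_nn_def nn_integral_p_kernel_convolution[OF ab(1) less_imp_le[OF ab(1)] ab(2) less_imp_le[OF ab(2)]] ..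
  finally show ?thesis .
qed

lemma nn_integral_heat_nn:
  fixes \<phi> :: "'a::euclidean_space \<Rightarrow> ennreal"
  assumes a: "0 < a" and [measurable]: "\<phi> \<in> borel_measurable borel"
  shows "(\<integral>\<^sup>+x. heat_nn a \<phi> x \<partial>lborel) = (\<integral>\<^sup>+x. \<phi> x \<partial>lborel)"
proof -
  have "(\<integral>\<^sup>+x. heat_nn a \<phi> x \<partial>lborel) = (\<integral>\<^sup>+y. (\<integral>\<^sup>+x. ennreal (p_kernel a a (x - y)) * \<phi> y \<partial>lborel) \<partial>lborel)"
    unfolding heat_nn_def by (rule lborel_pair.Fubini') measurable
  also have "\<dots> = (\<integral>\<^sup>+y. (\<integral>\<^sup>+x. ennreal (p_kernel a a (x - y)) \<partial>lborel) * \<phi> y \<partial>lborel)"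
    by (intro nn_integral_cong nn_integral_multc) measurable
  also have "\<dots> = (\<integral>\<^sup>+y. \<phi> y \<partial>lborel)"
  proof (intro nn_integral_cong)
    fix y :: 'a
    have "(\<integral>\<^sup>+x. ennreal (p_kernel a a (x - y)) \<partial>lborel) = 1"
      using nn_integral_lborel_shift[of "\<lambda>x. ennreal (p_kernel a a x)" y] nn_integral_p_kernel[OF a less_imp_le[OF a], where 'a='a] by simp
    then show "(\<integral>\<^sup>+x. ennreal (p_kernel a a (x - y)) \<partial>lborel) * \<phi> y = \<phi> y" by simp
  qed
  finally show ?thesis .
qed

lemma heat_nn_const:
  fixes x :: "'a::euclidean_space"
  assumes a: "0 < a"
  shows "heat_nn a (\<lambda>_. c) x = c"
proof -
  have "heat_nn a (\<lambda>_. c) x = (\<integral>\<^sup>+y. ennreal (p_kernel a a (x - y)) \<partial>lborel) * c"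
    unfolding heat_nn_def by (rule nn_integral_multc) measurable
  also have "\<dots> = c"
    by (simp add: nn_integral_p_kernel_reflect[OF a less_imp_le[OF a]])
  finally show ?thesis .
qed

lemma heat_nn_mono_AE: "AE y in lborel. \<phi> y \<le> \<psi> y \<Longrightarrow> heat_nn a \<phi> x \<le> heat_nn a \<psi> x"
  unfolding heat_nn_def by (rule nn_integral_mono_AE) (auto elim!: eventually_mono intro: mult_left_mono)

lemma heat_nn_cong_AE: "AE y in lborel. \<phi> y = \<psi> y \<Longrightarrow> heat_nn a \<phi> x = heat_nn a \<psi> x"
  unfolding heat_nn_def by (rule nn_integral_cong_AE) auto

text \<open>The bridge between the two versions. It survives divergence as well: a non-integrable
  product gives 0 on the left, and \<open>enn2real\<close> sends \<infinity> to 0 on the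
  right.\<close>

lemma heat_semigroup_eq_heat_nn:
  fixes x :: "'a::euclidean_space"
  assumes t: "0 < t" and [measurable]: "\<phi> \<in> borel_measurable borel" and \<phi>: "AE y in lborel. 0 \<le> \<phi> y"
  shows "heat_semigroup \<sigma> t \<phi> x = enn2real (heat_nn t (\<lambda>y. ennreal (\<phi> y)) x)"
proof -
  have "heat_semigroup \<sigma> t \<phi> x = (LINT y|lborel. p_kernel t t (x - y) * \<phi> y)"
    using t by (simp add: heat_semigroup_def mixed_heat_kernel_eq[OF t])
  also have "\<dots> = enn2real (\<integral>\<^sup>+y. ennreal (p_kernel t t (x - y) * \<phi> y) \<partial>lborel)"
    using \<phi> p_kernel_nonneg[OF t, of t] t
    by (intro integral_eq_nn_integral) (auto elim!: eventually_mono intro!: mult_nonneg_nonneg)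
  also have "\<dots> = enn2real (heat_nn t (\<lambda>y. ennreal (\<phi> y)) x)"
    unfolding heat_nn_def using t by (simp add: ennreal_mult' p_kernel_nonneg[OF t less_imp_le])
  finally show ?thesis .
qed

end

section \<open>Nonexistence\<close>

text \<open>Collects what a global mild solution supplies once it is replaced by a jointly
  measurable, everywhere nonnegative representative, with the Duhamel formula read in
  [0,\<infinity>]. Nonexistence then takes the form of inconsistency of these assumptions.\<close>

locale nn_global_solution = fractional_order \<sigma> for \<sigma> :: real +
  fixes r p :: real and u0 :: "'a::euclidean_space \<Rightarrow> real" and U :: "real \<Rightarrow> 'a \<Rightarrow> real"
  assumes r: "0 \<le> r" and p: "1 < p"
    and u0_measurable [measurable]: "u0 \<in> borel_measurable borel" and u0_pos: "\<And>x. 0 < u0 x"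
    and U_measurable_pair: "case_prod U \<in> borel_measurable (borel \<Otimes>\<^sub>M borel)"
    and U_nonneg: "\<And>s y. 0 \<le> U s y"
    and U_bounded: "\<And>t. 0 \<le> t \<Longrightarrow> \<exists>M. \<forall>s\<in>{0..t}. AE y in lborel. U s y \<le> M"
    and duhamel: "\<And>t. 0 < t \<Longrightarrow> AE x in lborel. ennreal (U t x) = heat_nn t (\<lambda>y. ennreal (u0 y)) x
      + (\<integral>\<^sup>+s. indicator {0..<t} s * heat_nn (t - s) (\<lambda>y. ennreal (s powr r * log_source p (U s y))) x \<partial>lborel)"
begin

lemmas U_measurable [measurable] = measurable_case_prod_comp[OF U_measurable_pair]

abbreviation g :: "real \<Rightarrow> 'a \<Rightarrow> ennreal" where
  "g s y \<equiv> ennreal (s powr r * log_source p (U s y))"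

lemma heat_nn_g_measurable [measurable]:
  assumes [measurable]: "a \<in> borel_measurable M" "s \<in> borel_measurable M" "x \<in> borel_measurable M"
  shows "(\<lambda>z. heat_nn (a z) (g (s z)) (x z)) \<in> borel_measurable M"
  unfolding heat_nn_def by measurable

lemma U_ge_linear:
  assumes "0 < t"
  shows "AE x in lborel. heat_nn t (\<lambda>y. ennreal (u0 y)) x \<le> ennreal (U t x)"
  using duhamel[OF assms] by eventually_elim simp

text \<open>Tonelli and conservation of mass by the semigroup. Both sides may be infinite; a finite
  bound on the left will come from elsewhere and be played against growth on the right.\<close>

lemma mass_identity:
  assumes t: "0 < t"
  shows "(\<integral>\<^sup>+x. ennreal (U t x) \<partial>lborel) = (\<integral>\<^sup>+x. ennreal (u0 x) \<partial>lborel)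
    + (\<integral>\<^sup>+s. indicator {0..<t} s * (\<integral>\<^sup>+y. g s y \<partial>lborel) \<partial>lborel)"
proof -
  have "(\<integral>\<^sup>+x. ennreal (U t x) \<partial>lborel) = (\<integral>\<^sup>+x. heat_nn t (\<lambda>y. ennreal (u0 y)) x
      + (\<integral>\<^sup>+s. indicator {0..<t} s * heat_nn (t - s) (g s) x \<partial>lborel) \<partial>lborel)"
    by (rule nn_integral_cong_AE[OF duhamel[OF t]])
  also have "\<dots> = (\<integral>\<^sup>+x. heat_nn t (\<lambda>y. ennreal (u0 y)) x \<partial>lborel)
      + (\<integral>\<^sup>+x. (\<integral>\<^sup>+s. indicator {0..<t} s * heat_nn (t - s) (g s) x \<partial>lborel) \<partial>lborel)"
    using \<sigma> by (intro nn_integral_add) measurable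
  also have "(\<integral>\<^sup>+x. heat_nn t (\<lambda>y. ennreal (u0 y)) x \<partial>lborel) = (\<integral>\<^sup>+x. ennreal (u0 x) \<partial>lborel)"
    using t by (intro nn_integral_heat_nn) auto
  also have "(\<integral>\<^sup>+x. (\<integral>\<^sup>+s. indicator {0..<t} s * heat_nn (t - s) (g s) x \<partial>lborel) \<partial>lborel)
      = (\<integral>\<^sup>+s. (\<integral>\<^sup>+x. indicator {0..<t} s * heat_nn (t - s) (g s) x \<partial>lborel) \<partial>lborel)"
    by (rule lborel_pair.Fubini') measurable
  also have "\<dots> = (\<integral>\<^sup>+s. indicator {0..<t} s * (\<integral>\<^sup>+y. g s y \<partial>lborel) \<partial>lborel)"
  proof (intro nn_integral_cong)
    fix s :: real
    have "(\<integral>\<^sup>+x. indicator {0..<t} s * heat_nn (t - s) (g s) x \<partial>lborel)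
        = indicator {0..<t} s * (\<integral>\<^sup>+x. heat_nn (t - s) (g s) x \<partial>lborel)"
      by (rule nn_integral_cmult) measurable
    also have "\<dots> = indicator {0..<t} s * (\<integral>\<^sup>+y. g s y \<partial>lborel)"
    proof (cases "s \<in> {0..<t}")
      case True
      then have "(\<integral>\<^sup>+x. heat_nn (t - s) (g s) x \<partial>lborel) = (\<integral>\<^sup>+y. g s y \<partial>lborel)"
        by (intro nn_integral_heat_nn) auto
      then show ?thesis by simp
    qed simp
    finally show "(\<integral>\<^sup>+x. indicator {0..<t} s * heat_nn (t - s) (g s) x \<partial>lborel)
        = indicator {0..<t} s * (\<integral>\<^sup>+y. g s y \<partial>lborel)" .
  qed
  finally show ?thesis .
qed

text \<open>Applying the semigroup for the remaining time T - t merges it with both Duhamel terms.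
  Afterwards the integrand depends on T alone and t appears only in the range of integration, which
  makes the expression monotone in t with a known rate of growth.\<close>

lemma duhamel_later:
  assumes t: "0 < t" "t < T"
  shows "heat_nn (T - t) (\<lambda>y. ennreal (U t y)) z = heat_nn T (\<lambda>y. ennreal (u0 y)) z
    + (\<integral>\<^sup>+s. indicator {0..<t} s * heat_nn (T - s) (g s) z \<partial>lborel)"
proof -
  let ?k = "\<lambda>x. ennreal (p_kernel (T - t) (T - t) (z - x))"
  have "heat_nn (T - t) (\<lambda>y. ennreal (U t y)) z
      = heat_nn (T - t) (\<lambda>x. heat_nn t (\<lambda>y. ennreal (u0 y)) x
      + (\<integral>\<^sup>+s. indicator {0..<t} s * heat_nn (t - s) (g s) x \<partial>lborel)) z"
    by (rule heat_nn_cong_AE[OF duhamel[OF t(1)]])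
  also have "\<dots> = heat_nn (T - t) (heat_nn t (\<lambda>y. ennreal (u0 y))) z
      + (\<integral>\<^sup>+x. ?k x * (\<integral>\<^sup>+s. indicator {0..<t} s * heat_nn (t - s) (g s) x \<partial>lborel) \<partial>lborel)"
    unfolding heat_nn_def[of "T - t"] distrib_left using \<sigma> by (intro nn_integral_add) measurable
  also have "heat_nn (T - t) (heat_nn t (\<lambda>y. ennreal (u0 y))) z = heat_nn T (\<lambda>y. ennreal (u0 y)) z"
    using heat_nn_semigroup[of "T - t" t "\<lambda>y. ennreal (u0 y)" z] t by simp
  also have "(\<integral>\<^sup>+x. ?k x * (\<integral>\<^sup>+s. indicator {0..<t} s * heat_nn (t - s) (g s) x \<partial>lborel) \<partial>lborel)
      = (\<integral>\<^sup>+x. (\<integral>\<^sup>+s. ?k x * (indicator {0..<t} s * heat_nn (t - s) (g s) x) \<partial>lborel) \<partial>lborel)"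
    by (intro nn_integral_cong nn_integral_cmult[symmetric]) measurable
  also have "\<dots> = (\<integral>\<^sup>+s. (\<integral>\<^sup>+x. ?k x * (indicator {0..<t} s * heat_nn (t - s) (g s) x) \<partial>lborel) \<partial>lborel)"
    by (rule lborel_pair.Fubini') measurable
  also have "\<dots> = (\<integral>\<^sup>+s. indicator {0..<t} s * heat_nn (T - s) (g s) z \<partial>lborel)"
  proof (intro nn_integral_cong)
    fix s :: real
    have "(\<integral>\<^sup>+x. ?k x * (indicator {0..<t} s * heat_nn (t - s) (g s) x) \<partial>lborel)
        = indicator {0..<t} s * heat_nn (T - t) (heat_nn (t - s) (g s)) z"
      unfolding heat_nn_def[of "T - t"] mult.left_commute[of "?k _"] by (rule nn_integral_cmult) measurable
    also have "\<dots> = indicator {0..<t} s * heat_nn (T - s) (g s) z"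
    proof (cases "s \<in> {0..<t}")
      case True
      then have "heat_nn (T - t) (heat_nn (t - s) (g s)) z = heat_nn (T - t + (t - s)) (g s) z"
        using t by (intro heat_nn_semigroup) auto
      then show ?thesis by simp
    qed simp
    finally show "(\<integral>\<^sup>+x. ?k x * (indicator {0..<t} s * heat_nn (t - s) (g s) x) \<partial>lborel)
        = indicator {0..<t} s * heat_nn (T - s) (g s) z" .
  qed
  finally show ?thesis .
qed

lemma heat_nn_U_bounded:
  assumes "0 \<le> t" "t < T" "AE y in lborel. U t y \<le> M"
  shows "heat_nn (T - t) (\<lambda>y. ennreal (U t y)) z \<le> ennreal M"
proof -
  have "heat_nn (T - t) (\<lambda>y. ennreal (U t y)) z \<le> heat_nn (T - t) (\<lambda>_. ennreal M) z"
    using assms by (intro heat_nn_mono_AE) (auto elim!: eventually_mono intro: ennreal_leI)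
  also have "\<dots> = ennreal M" using assms by (intro heat_nn_const) auto
  finally show ?thesis .
qed

text \<open>The tangent inequality at the mean \<open>w\<close> is integrated against the kernel,
  which is a probability density. The slope terms are placed on opposite sides to avoid subtraction
  in \<open>ennreal\<close>; they both integrate to the finite number D w and cancel.\<close>

lemma jensen:
  assumes s: "0 \<le> s" "s < T" and w: "0 < w" "ennreal w = heat_nn (T - s) (\<lambda>y. ennreal (U s y)) z"
  shows "ennreal (s powr r * log_source p w) \<le> heat_nn (T - s) (g s) z"
proof -
  let ?k = "\<lambda>y. p_kernel (T - s) (T - s) (z - y)"
  define D where "D = ln (1 + w) powr p + p * ln (1 + w) powr (p - 1)"
  have D0: "0 \<le> D" using p by (simp add: D_def)
  have k0: "0 \<le> ?k y" for y using s by (intro p_kernel_nonneg) auto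
  have k1: "(\<integral>\<^sup>+y. ennreal (?k y) \<partial>lborel) = 1"
    using s by (intro nn_integral_p_kernel_reflect) auto
  have pt: "ennreal (log_source p w) + ennreal D * ennreal (U s y) \<le> ennreal (log_source p (U s y)) + ennreal (D * w)" for y
  proof -
    have "log_source p w + D * U s y \<le> log_source p (U s y) + D * w"
      using log_source_tangent[OF p w(1) U_nonneg[of s y]] by (simp add: D_def algebra_simps)
    then show ?thesis
      using D0 w U_nonneg[of s y] log_source_nonneg[of w p] log_source_nonneg[OF U_nonneg, of p s y]
      by (simp flip: ennreal_plus ennreal_mult')
  qed
  have "ennreal (log_source p w) + ennreal (D * w) = (\<integral>\<^sup>+y. ennreal (?k y) * (ennreal (log_source p w) + ennreal D * ennreal (U s y)) \<partial>lborel)"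
  proof -
    have "(\<integral>\<^sup>+y. ennreal (?k y) * (ennreal (log_source p w) + ennreal D * ennreal (U s y)) \<partial>lborel)
        = (\<integral>\<^sup>+y. ennreal (log_source p w) * ennreal (?k y) + ennreal D * (ennreal (?k y) * ennreal (U s y)) \<partial>lborel)"
      by (simp add: distrib_left mult_ac)
    also have "\<dots> = ennreal (log_source p w) * (\<integral>\<^sup>+y. ennreal (?k y) \<partial>lborel) + ennreal D * (\<integral>\<^sup>+y. ennreal (?k y) * ennreal (U s y) \<partial>lborel)"
      by (simp add: nn_integral_add nn_integral_cmult)
    also have "\<dots> = ennreal (log_source p w) + ennreal D * ennreal w"
      unfolding k1 w(2) heat_nn_def by simp
    finally show ?thesis using D0 by (simp add: ennreal_mult')
  qed
  also have "\<dots> \<le> (\<integral>\<^sup>+y. ennreal (?k y) * (ennreal (log_source p (U s y)) + ennreal (D * w)) \<partial>lborel)"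
    by (intro nn_integral_mono mult_left_mono pt) auto
  also have "\<dots> = (\<integral>\<^sup>+y. ennreal (?k y) * ennreal (log_source p (U s y)) \<partial>lborel) + ennreal (D * w)"
    by (simp add: distrib_left nn_integral_add nn_integral_multc k1)
  finally have "ennreal (log_source p w) \<le> (\<integral>\<^sup>+y. ennreal (?k y) * ennreal (log_source p (U s y)) \<partial>lborel)"
    by simp
  then have "ennreal (s powr r) * ennreal (log_source p w) \<le> ennreal (s powr r) * (\<integral>\<^sup>+y. ennreal (?k y) * ennreal (log_source p (U s y)) \<partial>lborel)"
    by (rule mult_left_mono) simp
  also have "\<dots> = heat_nn (T - s) (g s) z"
    unfolding heat_nn_def by (subst nn_integral_cmult[symmetric]) (auto simp: ennreal_mult' mult_ac)
  finally show ?thesis by (simp add: ennreal_mult')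
qed

text \<open>The kernel is only known to be nonnegative, but its mass is 1, so it cannot vanish
  almost everywhere, and \<open>u0\<close> vanishes nowhere.\<close>

lemma heat_nn_u0_pos:
  assumes "0 < T"
  shows "0 < heat_nn T (\<lambda>y. ennreal (u0 y)) z"
proof (rule ccontr)
  assume "\<not> 0 < heat_nn T (\<lambda>y. ennreal (u0 y)) z"
  then have "AE y in lborel. ennreal (p_kernel T T (z - y)) * ennreal (u0 y) = 0"
    unfolding heat_nn_def by (subst (asm) zero_less_iff_neq_zero, subst (asm) nn_integral_0_iff_AE) auto
  then have "AE y in lborel. ennreal (p_kernel T T (z - y)) = 0"
  proof eventually_elim
    fix y assume "ennreal (p_kernel T T (z - y)) * ennreal (u0 y) = 0"
    then show "ennreal (p_kernel T T (z - y)) = 0" using u0_pos[of y] by (auto simp: ennreal_eq_0_iff)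
  qed
  then have "(\<integral>\<^sup>+y. ennreal (p_kernel T T (z - y)) \<partial>lborel) = 0"
    by (subst nn_integral_0_iff_AE) auto
  moreover have "(\<integral>\<^sup>+y. ennreal (p_kernel T T (z - y)) \<partial>lborel) = 1"
    using assms by (intro nn_integral_p_kernel_reflect) auto
  ultimately show False by simp
qed

section \<open>The functional J and its lifespan inequality\<close>

definition J :: "real \<Rightarrow> real \<Rightarrow> real" where
  "J T t = enn2real (heat_nn (T - t) (\<lambda>y. ennreal (U t y)) 0)"

lemma ennreal_J:
  assumes "0 \<le> t" "t < T"
  shows "ennreal (J T t) = heat_nn (T - t) (\<lambda>y. ennreal (U t y)) 0"
proof -
  obtain M where "\<forall>s\<in>{0..t}. AE y in lborel. U s y \<le> M" using U_bounded[OF assms(1)] by blast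
  then have "AE y in lborel. U t y \<le> M" using assms(1) by simp
  from heat_nn_U_bounded[OF assms this, of 0] show ?thesis
    unfolding J_def by (intro ennreal_enn2real) (auto simp: top_unique less_top[symmetric] le_less_trans)
qed

lemma J_nonneg: "0 \<le> J T t"
  by (simp add: J_def)

lemma J_pos:
  assumes "0 < t" "t < T"
  shows "0 < J T t"
proof -
  have "0 < ennreal (J T t)"
    using heat_nn_u0_pos[of T 0] assms by (simp add: ennreal_J duhamel_later add_pos_nonneg)
  then show ?thesis by simp
qed

lemma J_increment:
  assumes "0 < t" "t \<le> t'" "t' < T"
  shows "ennreal (J T t') = ennreal (J T t) + (\<integral>\<^sup>+s. indicator {t..<t'} s * heat_nn (T - s) (g s) 0 \<partial>lborel)"
proof -
  have "indicator {0..<t'} s = (indicator {0..<t} s + indicator {t..<t'} s :: ennreal)" for s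
    using assms by (auto simp: indicator_def)
  then have "(\<integral>\<^sup>+s. indicator {0..<t'} s * heat_nn (T - s) (g s) 0 \<partial>lborel)
      = (\<integral>\<^sup>+s. indicator {0..<t} s * heat_nn (T - s) (g s) 0 \<partial>lborel)
      + (\<integral>\<^sup>+s. indicator {t..<t'} s * heat_nn (T - s) (g s) 0 \<partial>lborel)"
    by (simp add: distrib_right nn_integral_add)
  then show ?thesis using assms by (simp add: ennreal_J duhamel_later add.assoc)
qed

lemma J_mono:
  assumes "0 < t" "t \<le> t'" "t' < T"
  shows "J T t \<le> J T t'"
proof -
  have "ennreal (J T t) \<le> ennreal (J T t')" unfolding J_increment[OF assms] by simp
  then show ?thesis by (simp add: J_nonneg)
qed

text \<open>On {0..b} the solution is bounded, hence so is the source, and the semigroup fixes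
  constants; thus the integrand in \<open>J_increment\<close> is bounded. This supplies the
  continuity required by the comparison with the differential equation.\<close>

lemma J_lipschitz:
  assumes b: "0 < b" "b < T"
  obtains C where "0 \<le> C" "\<And>t t'. 0 < t \<Longrightarrow> t \<le> t' \<Longrightarrow> t' \<le> b \<Longrightarrow> J T t' - J T t \<le> C * (t' - t)"
proof -
  obtain M where M: "\<forall>s\<in>{0..b}. AE y in lborel. U s y \<le> M" using U_bounded[of b] b by (meson less_imp_le)
  \<comment> \<open>\<open>max M 0\<close> keeps the argument in the range where
    \<open>log_source\<close> is monotone and nonnegative, whatever the sign of
    \<open>M\<close>.\<close>
  define C where "C = b powr r * log_source p (max M 0)"
  have C: "0 \<le> C" by (simp add: C_def log_source_nonneg)
  show thesis
  proof (rule that[OF C])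
    fix t t' assume t: "0 < t" "t \<le> t'" "t' \<le> b"
    have "heat_nn (T - s) (g s) 0 \<le> ennreal C" if s: "s \<in> {t..<t'}" for s
    proof -
      have "heat_nn (T - s) (g s) 0 \<le> heat_nn (T - s) (\<lambda>_. ennreal C) (0 :: 'a)"
      proof (rule heat_nn_mono_AE)
        have "AE y in lborel. U s y \<le> M" using M s t by auto
        then show "AE y in lborel. g s y \<le> ennreal C"
        proof eventually_elim
          fix y assume "U s y \<le> M"
          then have "s powr r * log_source p (U s y) \<le> C"
            unfolding C_def using s t r p U_nonneg[of s y]
            by (intro mult_mono powr_mono2 log_source_mono log_source_nonneg) auto
          then show "g s y \<le> ennreal C" by (rule ennreal_leI)
        qed
      qed
      also have "\<dots> = ennreal C" using s t b by (intro heat_nn_const) auto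
      finally show ?thesis .
    qed
    then have "(\<integral>\<^sup>+s. indicator {t..<t'} s * heat_nn (T - s) (g s) 0 \<partial>lborel) \<le> (\<integral>\<^sup>+s. ennreal C * indicator {t..<t'} s \<partial>lborel)"
      by (intro nn_integral_mono) (auto simp: indicator_def)
    also have "\<dots> = ennreal (C * (t' - t))"
      using t C by (simp add: nn_integral_cmult_indicator ennreal_mult')
    finally have "ennreal (J T t') \<le> ennreal (J T t) + ennreal (C * (t' - t))"
      using J_increment[of t t' T] t b by (simp add: add_left_mono)
    then have "J T t' \<le> J T t + C * (t' - t)"
      using C t J_nonneg[of T t] by (simp flip: ennreal_plus)
    then show "J T t' - J T t \<le> C * (t' - t)" by simp
  qed
qed

lemma continuous_on_J:
  assumes t1: "0 < t1"
  shows "continuous_on {t1..<T} (J T)"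
  unfolding continuous_on_eq_continuous_within
proof
  fix t assume t: "t \<in> {t1..<T}"
  \<comment> \<open>A point strictly between t and T: {t1..b} is then a neighbourhood of t within
    {t1..<T}, and the Lipschitz bound is available there.\<close>
  define b where "b = (t + T) / 2"
  have b: "0 < b" "b < T" "t < b" using t t1 by (auto simp: b_def field_simps)
  obtain C where C: "0 \<le> C" "\<And>t t'. 0 < t \<Longrightarrow> t \<le> t' \<Longrightarrow> t' \<le> b \<Longrightarrow> J T t' - J T t \<le> C * (t' - t)"
    using J_lipschitz[OF b(1,2)] by blast
  have "C-lipschitz_on {t1..b} (J T)"
  proof (rule lipschitz_onI[OF _ C(1)])
    fix x y assume xy: "x \<in> {t1..b}" "y \<in> {t1..b}"
    then show "dist (J T x) (J T y) \<le> C * dist x y"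
    proof (induction x y rule: linorder_wlog)
      case (le x y)
      then show ?case using C(2)[of x y] J_mono[of x y T] t1 b by (auto simp: dist_real_def)
    next
      case (sym x y)
      then show ?case by (simp add: dist_commute)
    qed
  qed
  then have "continuous_on {t1..b} (J T)" by (rule lipschitz_on_continuous_on)
  then have "continuous (at t within {t1..b}) (J T)" using t b by (auto simp: continuous_on_eq_continuous_within)
  moreover have "at t within {t1..b} = at t within {t1..<T}"
    by (rule at_within_nhd[of _ "{..<b}"]) (use b in auto)
  ultimately show "continuous (at t within {t1..<T}) (J T)" by simp
qed

text \<open>Jensen bounds the integrand in \<open>J_increment\<close> below by s^r f(J), which is
  the integral inequality of the comparison lemma. Since the solution is global, T is at free
  disposal.\<close>

lemma lifespan_bound:
  assumes t1: "0 < t1" "t1 < T"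
  shows "(p - 1) * (T powr (r + 1) - t1 powr (r + 1)) / (r + 1) \<le> ln (1 + J T t1) powr (1 - p)"
proof (rule superlinear_ode_lifespan[where y = "J T", OF p r t1 J_pos[OF t1] J_nonneg continuous_on_J[OF t1(1)]])
  fix t assume t: "t1 \<le> t" "t < T"
  let ?h = "\<lambda>s. s powr r * log_source p (J T s)"
  have h0: "0 \<le> ?h s" for s by (simp add: log_source_nonneg J_nonneg)
  have cont: "continuous_on {t1..t} ?h"
    using t t1 p by (intro continuous_intros continuous_on_compose2[OF continuous_on_log_source, of p _ "J T"]
        continuous_on_subset[OF continuous_on_J[OF t1(1)]]) (auto simp: J_nonneg)
  have int: "set_integrable lborel {t1..t} ?h" by (rule borel_integrable_atLeastAtMost'[OF cont])
  have "ennreal (integral {t1..t} ?h) = ennreal (LINT s:{t1..t}|lborel. ?h s)"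
    using set_borel_integral_eq_integral(2)[OF int] by simp
  also have "\<dots> = (\<integral>\<^sup>+s. ennreal (indicator {t1..t} s *\<^sub>R ?h s) \<partial>lborel)"
    unfolding set_lebesgue_integral_def using int h0
    by (intro nn_integral_eq_integral[symmetric]) (auto simp: set_integrable_def)
  also have "\<dots> \<le> (\<integral>\<^sup>+s. indicator {t1..<t} s * heat_nn (T - s) (g s) 0 \<partial>lborel)"
  proof (rule nn_integral_mono_AE)
    show "AE s in lborel. ennreal (indicator {t1..t} s *\<^sub>R ?h s) \<le> indicator {t1..<t} s * heat_nn (T - s) (g s) 0"
      using AE_lborel_singleton[of t]
    proof eventually_elim
      fix s assume "s \<noteq> t"
      show "ennreal (indicator {t1..t} s *\<^sub>R ?h s) \<le> indicator {t1..<t} s * heat_nn (T - s) (g s) 0"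
      proof (cases "s \<in> {t1..t}")
        case True
        with \<open>s \<noteq> t\<close> t t1 show ?thesis using jensen[of s T "J T s" 0] by (auto simp: J_pos ennreal_J)
      qed simp
    qed
  qed
  finally have "ennreal (J T t1) + ennreal (integral {t1..t} ?h) \<le> ennreal (J T t)"
    using J_increment[of t1 t T] t t1 by (simp add: add_left_mono)
  moreover have "0 \<le> integral {t1..t} ?h" using h0 cont by (intro Henstock_Kurzweil_Integration.integral_nonneg integrable_continuous_real) auto
  ultimately show "J T t1 + integral {t1..t} ?h \<le> J T t"
    by (simp add: J_nonneg flip: ennreal_plus)
qed

text \<open>For T large the ball of radius \<rho> lies where the kernel for time T - t is at least c
  T^(-\<beta>). Hence c T^(-\<beta>) times the mass in the ball is at most J, which in turn is at
  most 2 C1 T^(-\<beta>); T cancels, leaving a constant free of t and \<rho>.\<close>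

lemma ball_mass_bound:
  assumes p_le: "p \<le> 1 + 2 * \<sigma> * (1 + r) / real DIM('a)"
  obtains C where "0 \<le> C"
    "\<And>t \<rho>. 0 < t \<Longrightarrow> (\<integral>\<^sup>+y. indicator (cball 0 \<rho>) y * ennreal (U t y) \<partial>lborel) \<le> ennreal C"
proof -
  define \<beta> where "\<beta> = real DIM('a) / (2 * \<sigma>)"
  have \<beta>: "0 < \<beta>" using \<sigma> by (simp add: \<beta>_def)
  have "(p - 1) * real DIM('a) \<le> 2 * \<sigma> * (1 + r)" using p_le by (simp add: field_simps)
  then have \<beta>_le: "\<beta> \<le> (r + 1) / (p - 1)" using \<sigma> p by (simp add: \<beta>_def field_simps)
  obtain c R where c: "0 < c" and R: "0 < R" and low: "\<And>t (x::'a). 1 \<le> t \<Longrightarrow> norm x \<le> R * t powr (1 / (2 * \<sigma>)) \<Longrightarrow>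
       c * t powr (- real DIM('a) / (2 * \<sigma>)) \<le> p_kernel t t x"
    using p_kernel_lower by blast
  \<comment> \<open>The constant obtained by solving (p - 1) / (2 (r + 1)) T^(r+1) \<le> X^(1-p) for
    X = ln (1 + J). The 2 in the denominator comes from T \<ge> 2t, which makes t^(r+1) at most half
    of T^(r+1).\<close>
  define C1 where "C1 = ((p - 1) / (2 * (r + 1))) powr (- 1 / (p - 1))"
  have C1: "0 < C1" using p r by (simp add: C1_def)
  have log_bound: "ln (1 + J T t) \<le> C1 * T powr (- \<beta>)" if t: "0 < t" and T: "1 \<le> T" "2 * t \<le> T" for t T
  proof -
    let ?X = "ln (1 + J T t)" and ?Y = "(p - 1) / (2 * (r + 1)) * T powr (r + 1)"
    have X: "0 < ?X" using J_pos[of t T] t T by simp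
    have Y: "0 < ?Y" using p r T by simp
    have "t powr (r + 1) \<le> (T / 2) powr (r + 1)" using t T r by (intro powr_mono2) auto
    also have "\<dots> = T powr (r + 1) * (1 / 2) powr (r + 1)" using T by (simp flip: powr_mult)
    also have "\<dots> \<le> T powr (r + 1) * (1 / 2) powr 1" using r by (intro mult_left_mono powr_mono') auto
    finally have "T powr (r + 1) / 2 \<le> T powr (r + 1) - t powr (r + 1)" by simp
    then have "(p - 1) * (T powr (r + 1) / 2) / (r + 1) \<le> (p - 1) * (T powr (r + 1) - t powr (r + 1)) / (r + 1)"
      using p r by (intro divide_right_mono mult_left_mono) auto
    also have "\<dots> \<le> ?X powr (1 - p)" using t T by (intro lifespan_bound) auto
    finally have YX: "?Y \<le> ?X powr (1 - p)" by simp
    have "(1 - p) * (- 1 / (p - 1)) = 1" using p by (simp add: divide_simps)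
    then have "?X = (?X powr (1 - p)) powr (- 1 / (p - 1))" using X by (simp only: powr_powr powr_one less_imp_le)
    also have "\<dots> \<le> ?Y powr (- 1 / (p - 1))" using YX Y p by (intro powr_mono2') auto
    also have "\<dots> = C1 * (T powr (r + 1)) powr (- 1 / (p - 1))"
      unfolding C1_def using p r T by (subst powr_mult) auto
    also have "(T powr (r + 1)) powr (- 1 / (p - 1)) = T powr (- ((r + 1) / (p - 1)))" by (simp add: powr_powr)
    also have "C1 * \<dots> \<le> C1 * T powr (- \<beta>)" using \<beta>_le T C1 by (intro mult_left_mono powr_mono) auto
    finally show ?thesis .
  qed
  show thesis
  proof (rule that)
    show "0 \<le> 2 * C1 / c" using C1 c by simp
    fix t \<rho> :: real assume t: "0 < t"
    let ?m = "\<integral>\<^sup>+y. indicator (cball 0 \<rho>) y * ennreal (U t y) \<partial>lborel"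
    \<comment> \<open>T is chosen after t and \<rho>: large enough to make the logarithmic bound at
      most 1, to let the kernel ball contain the ball of radius \<rho>, and to ensure T \<ge> 1 and
      T \<ge> 2t.\<close>
    have "eventually (\<lambda>T. C1 * T powr (- \<beta>) \<le> 1) at_top" using C1 \<beta> by real_asymp
    moreover have "eventually (\<lambda>T. \<rho> \<le> R * (T - t) powr (1 / (2 * \<sigma>))) at_top"
    proof -
      have "filterlim (\<lambda>T. R * (T - t) powr (1 / (2 * \<sigma>))) at_top at_top" using R \<sigma> by real_asymp
      then show ?thesis by (simp add: filterlim_at_top)
    qed
    moreover have "eventually (\<lambda>T. 1 + 2 * t \<le> T) at_top" by (rule eventually_ge_at_top)
    ultimately have "eventually (\<lambda>T. C1 * T powr (- \<beta>) \<le> 1 \<and> \<rho> \<le> R * (T - t) powr (1 / (2 * \<sigma>)) \<and> 1 + 2 * t \<le> T) at_top"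
      by eventually_elim simp
    then obtain T where T: "C1 * T powr (- \<beta>) \<le> 1" "\<rho> \<le> R * (T - t) powr (1 / (2 * \<sigma>))" "1 + 2 * t \<le> T"
      by (metis (mono_tags, lifting) eventually_happens trivial_limit_at_top_linorder)
    have Tb: "0 < T powr (- \<beta>)" using T t by simp
    have "1 + J T t = exp (ln (1 + J T t))" using J_nonneg[of T t] by simp
    also have "\<dots> \<le> exp (C1 * T powr (- \<beta>))" using log_bound[of t T] t T by simp
    \<comment> \<open>The passage from ln (1 + J) to J: for 0 \<le> x \<le> 1, exp x \<le> 1 + x +
      x^2 \<le> 1 + 2x.\<close>
    also have "\<dots> \<le> 1 + C1 * T powr (- \<beta>) + (C1 * T powr (- \<beta>))\<^sup>2" using T C1 by (intro exp_bound) auto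
    also have "(C1 * T powr (- \<beta>))\<^sup>2 \<le> C1 * T powr (- \<beta>)"
      using T C1 by (simp add: power2_eq_square mult_left_le)
    finally have J_le: "J T t \<le> 2 * C1 * T powr (- \<beta>)" by simp
    have "ennreal (c * T powr (- \<beta>)) * ?m = (\<integral>\<^sup>+y. ennreal (c * T powr (- \<beta>)) * (indicator (cball 0 \<rho>) y * ennreal (U t y)) \<partial>lborel)"
      by (rule nn_integral_cmult[symmetric]) measurable
    also have "\<dots> \<le> (\<integral>\<^sup>+y. ennreal (p_kernel (T - t) (T - t) (0 - y)) * ennreal (U t y) \<partial>lborel)"
    proof (rule nn_integral_mono)
      fix y :: 'a
      show "ennreal (c * T powr (- \<beta>)) * (indicator (cball 0 \<rho>) y * ennreal (U t y)) \<le> ennreal (p_kernel (T - t) (T - t) (0 - y)) * ennreal (U t y)"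
      proof (cases "y \<in> cball 0 \<rho>")
        case True
        have "T powr (- \<beta>) \<le> (T - t) powr (- \<beta>)" using T t \<beta> by (intro powr_mono2') auto
        then have "c * T powr (- \<beta>) \<le> c * (T - t) powr (- \<beta>)" using c by simp
        also have "\<dots> \<le> p_kernel (T - t) (T - t) (0 - y)"
          using low[of "T - t" "0 - y"] T t True by (simp add: \<beta>_def)
        finally show ?thesis using True by (simp add: mult_right_mono ennreal_leI)
      qed simp
    qed
    also have "\<dots> = ennreal (J T t)" using t T by (simp add: ennreal_J heat_nn_def)
    also have "\<dots> \<le> ennreal (2 * C1 * T powr (- \<beta>))" by (rule ennreal_leI[OF J_le])
    also have "\<dots> = ennreal (c * T powr (- \<beta>)) * ennreal (2 * C1 / c)"
      using c C1 Tb by (simp flip: ennreal_mult')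
    finally show "?m \<le> ennreal (2 * C1 / c)"
      using c Tb by (subst (asm) ennreal_mult_le_mult_iff) auto
  qed
qed

theorem no_global_solution:
  assumes p_le: "p \<le> 1 + 2 * \<sigma> * (1 + r) / real DIM('a)"
  shows False
proof -
  define \<beta> where "\<beta> = real DIM('a) / (2 * \<sigma>)"
  have \<beta>: "0 < \<beta>" using \<sigma> by (simp add: \<beta>_def)
  have "(p - 1) * real DIM('a) \<le> 2 * \<sigma> * (1 + r)" using p_le by (simp add: field_simps)
  then have \<beta>_le: "\<beta> * (p - 1) \<le> r + 1" using \<sigma> by (simp add: \<beta>_def field_simps)
  obtain C where C: "0 \<le> C" and ball: "\<And>t \<rho>. 0 < t \<Longrightarrow> (\<integral>\<^sup>+y. indicator (cball 0 \<rho>) y * ennreal (U t y) \<partial>lborel) \<le> ennreal C"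
    using ball_mass_bound[OF p_le] by blast
  have mass: "(\<integral>\<^sup>+y. ennreal (U t y) \<partial>lborel) \<le> ennreal C" if t: "0 < t" for t
  \<comment> \<open>The bound on balls is uniform in the radius, so monotone convergence extends it
    to the whole space.\<close>
  proof (rule LIMSEQ_le_const2)
    show "(\<lambda>n. \<integral>\<^sup>+y. indicator (cball 0 (real n)) y * ennreal (U t y) \<partial>lborel) \<longlonglongrightarrow> (\<integral>\<^sup>+y. ennreal (U t y) \<partial>lborel)"
    proof (rule nn_integral_LIMSEQ)
      show "incseq (\<lambda>n y. indicator (cball 0 (real n)) y * ennreal (U t y))"
        by (auto simp: incseq_def le_fun_def indicator_def)
      fix y :: 'a
      obtain N where N: "norm y \<le> real N" using real_arch_simple by blast
      have "\<forall>\<^sub>F n in sequentially. indicator (cball 0 (real n)) y * ennreal (U t y) = ennreal (U t y)"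
        using eventually_ge_at_top[of N] by eventually_elim (use N in \<open>auto simp: indicator_def\<close>)
      then show "(\<lambda>n. indicator (cball 0 (real n)) y * ennreal (U t y)) \<longlonglongrightarrow> ennreal (U t y)" by (rule tendsto_eventually)
    next
      fix n :: nat
      show "(\<lambda>y. indicator (cball 0 (real n)) y * ennreal (U t y)) \<in> borel_measurable lborel" by measurable
    qed
  qed (use ball[OF t] in auto)
  obtain c R where c: "0 < c" and R: "0 < R" and low: "\<And>t (x::'a). 1 \<le> t \<Longrightarrow> norm x \<le> R * t powr (1 / (2 * \<sigma>)) \<Longrightarrow>
       c * t powr (- real DIM('a) / (2 * \<sigma>)) \<le> p_kernel t t x"
    using p_kernel_lower by blast
  let ?M = "\<integral>\<^sup>+y. indicator (cball 0 1) y * ennreal (u0 y) \<partial>lborel"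
  have "?M \<noteq> 0"
  proof
    assume "?M = 0"
    then have "AE y in lborel. indicator (cball 0 1) y * ennreal (u0 y) = 0" by (subst (asm) nn_integral_0_iff_AE) auto
    then have "AE y in lborel. y \<notin> cball (0::'a) 1"
    proof eventually_elim
      fix y assume "indicator (cball 0 1) y * ennreal (u0 y) = 0"
      then show "y \<notin> cball 0 1" using u0_pos[of y] by (auto simp: indicator_def ennreal_eq_0_iff)
    qed
    then have "cball (0::'a) 1 \<in> null_sets lborel" by (subst AE_iff_null_sets) auto
    then show False using unit_ball_vol_pos[of "real DIM('a)"] by (simp add: null_sets_def emeasure_cball)
  qed
  \<comment> \<open>Truncation at 1 gives a positive real number even if the mass of
    \<open>u0\<close> on the unit ball is infinite.\<close>
  define m where "m = enn2real (min ?M 1)"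
  have m_eq: "ennreal m = min ?M 1" unfolding m_def by (intro ennreal_enn2real) (simp add: min_less_iff_disj)
  have m: "0 < m" "ennreal m \<le> ?M"
  proof -
    have "0 < ennreal m" unfolding m_eq using \<open>?M \<noteq> 0\<close> by (simp add: zero_less_iff_neq_zero)
    then show "0 < m" by simp
    show "ennreal m \<le> ?M" unfolding m_eq by simp
  qed
  \<comment> \<open>From s0 on, the lower barrier c m s^(-\<beta>) is at most 1, as
    \<open>log_source_lower\<close> demands, and the unit ball fits into half of the kernel radius,
    leaving the other half for the evaluation point.\<close>
  have "eventually (\<lambda>s. c * m * s powr (- \<beta>) \<le> 1) at_top" using c m \<beta> by real_asymp
  moreover have "eventually (\<lambda>s. 2 \<le> R * s powr (1 / (2 * \<sigma>))) at_top"
  proof -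
    have "filterlim (\<lambda>s. R * s powr (1 / (2 * \<sigma>))) at_top at_top" using R \<sigma> by real_asymp
    then show ?thesis by (simp add: filterlim_at_top)
  qed
  moreover have "eventually (\<lambda>s::real. 1 \<le> s) at_top" by (rule eventually_ge_at_top)
  ultimately have "eventually (\<lambda>s. c * m * s powr (- \<beta>) \<le> 1 \<and> 2 \<le> R * s powr (1 / (2 * \<sigma>)) \<and> 1 \<le> s) at_top"
    by eventually_elim simp
  then obtain s0 where s0: "\<And>s. s0 \<le> s \<Longrightarrow> c * m * s powr (- \<beta>) \<le> 1 \<and> 2 \<le> R * s powr (1 / (2 * \<sigma>)) \<and> 1 \<le> s"
    by (auto simp: eventually_at_top_linorder)
  have s0_ge: "1 \<le> s0" using s0[of s0] by simp
  define \<omega> where "\<omega> = unit_ball_vol (real DIM('a)) * (R / 2) ^ DIM('a)"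
  have \<omega>: "0 < \<omega>" using R by (simp add: \<omega>_def)
  \<comment> \<open>Collects the factors of the source bound: (1/2)^p from the logarithm, (c m)^p
    from the barrier, and \<omega> from the volume of the ball of radius R/2 before scaling.\<close>
  define k where "k = (1 / 2) powr p * (c * m) powr p * \<omega>"
  have k: "0 < k" using c m \<omega> by (simp add: k_def)
  \<comment> \<open>The powers of s combine to r from the weight, -\<beta> p from the barrier and
    \<beta> from the volume of the ball. In the range of p considered, r - \<beta> (p - 1) \<ge>
    -1.\<close>
  have source: "ennreal (k * (1 / s)) \<le> (\<integral>\<^sup>+y. g s y \<partial>lborel)" if s: "s0 \<le> s" for s
  proof -
    have s1: "1 \<le> s" and sm: "c * m * s powr (- \<beta>) \<le> 1" and sR: "2 \<le> R * s powr (1 / (2 * \<sigma>))" using s0[OF s] by auto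
    define \<rho> where "\<rho> = R / 2 * s powr (1 / (2 * \<sigma>))"
    define v where "v = c * m * s powr (- \<beta>)"
    have v: "0 < v" "v \<le> 1" using sm c m s1 by (auto simp: v_def)
    have lin: "ennreal v \<le> heat_nn s (\<lambda>y. ennreal (u0 y)) x" if x: "x \<in> cball 0 \<rho>" for x
    proof -
      have "ennreal v = ennreal (c * s powr (- \<beta>)) * ennreal m"
        using c m by (simp add: v_def mult_ac flip: ennreal_mult')
      also have "\<dots> \<le> ennreal (c * s powr (- \<beta>)) * ?M" by (intro mult_left_mono m) auto
      also have "\<dots> = (\<integral>\<^sup>+y. ennreal (c * s powr (- \<beta>)) * (indicator (cball 0 1) y * ennreal (u0 y)) \<partial>lborel)"
        by (rule nn_integral_cmult[symmetric]) measurable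
      also have "\<dots> \<le> heat_nn s (\<lambda>y. ennreal (u0 y)) x"
        unfolding heat_nn_def
      proof (rule nn_integral_mono)
        fix y :: 'a
        show "ennreal (c * s powr (- \<beta>)) * (indicator (cball 0 1) y * ennreal (u0 y)) \<le> ennreal (p_kernel s s (x - y)) * ennreal (u0 y)"
        proof (cases "y \<in> cball 0 1")
          case True
          have "norm (x - y) \<le> norm x + norm y" by (rule norm_triangle_ineq4)
          also have "\<dots> \<le> R * s powr (1 / (2 * \<sigma>))" using True x sR by (simp add: \<rho>_def)
          finally have "c * s powr (- \<beta>) \<le> p_kernel s s (x - y)"
            using low[of s "x - y"] s1 by (simp add: \<beta>_def)
          then show ?thesis using True by (simp add: mult_right_mono ennreal_leI)
        qed simp
      qed
      finally show ?thesis .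
    qed
    define G where "G = s powr r * ((1 / 2) powr p * v powr p)"
    have G: "0 \<le> G" by (simp add: G_def)
    have "emeasure lborel (cball (0::'a) \<rho>) = ennreal (\<omega> * s powr \<beta>)"
    proof -
      have "(s powr (1 / (2 * \<sigma>))) ^ DIM('a) = s powr \<beta>"
        using s1 by (simp add: \<beta>_def powr_powr flip: powr_realpow)
      then have "\<rho> ^ DIM('a) = (R / 2) ^ DIM('a) * s powr \<beta>" unfolding \<rho>_def power_mult_distrib by simp
      moreover have "0 \<le> \<rho>" using R by (simp add: \<rho>_def)
      ultimately show ?thesis by (simp add: emeasure_cball \<omega>_def mult_ac)
    qed
    then have "ennreal (G * (\<omega> * s powr \<beta>)) = (\<integral>\<^sup>+y. ennreal G * indicator (cball (0::'a) \<rho>) y \<partial>lborel)"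
      using G by (simp add: nn_integral_cmult_indicator ennreal_mult')
    also have "\<dots> \<le> (\<integral>\<^sup>+y. g s y \<partial>lborel)"
    proof (rule nn_integral_mono_AE)
      have "AE x in lborel. heat_nn s (\<lambda>y. ennreal (u0 y)) x \<le> ennreal (U s x)" using s1 by (intro U_ge_linear) auto
      then show "AE y in lborel. ennreal G * indicator (cball 0 \<rho>) y \<le> g s y"
      proof eventually_elim
        fix x assume U: "heat_nn s (\<lambda>y. ennreal (u0 y)) x \<le> ennreal (U s x)"
        show "ennreal G * indicator (cball 0 \<rho>) x \<le> g s x"
        proof (cases "x \<in> cball 0 \<rho>")
          case True
          have "ennreal v \<le> ennreal (U s x)" using lin[OF True] U by (rule order_trans)
          then have "v \<le> U s x" using U_nonneg by (simp add: ennreal_le_iff)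
          then have "(1 / 2) powr p * v powr p \<le> log_source p (U s x)"
            using log_source_lower[of p v] log_source_mono[of p v "U s x"] v p by simp
          then have "G \<le> s powr r * log_source p (U s x)" unfolding G_def by (intro mult_left_mono) auto
          then show ?thesis using True by (simp add: ennreal_leI)
        qed simp
      qed
    qed
    finally have "ennreal (G * (\<omega> * s powr \<beta>)) \<le> (\<integral>\<^sup>+y. g s y \<partial>lborel)" .
    moreover have "k * (1 / s) \<le> G * (\<omega> * s powr \<beta>)"
    proof -
      have "v powr p = (c * m) powr p * s powr (- \<beta> * p)" using c m by (simp add: v_def powr_mult powr_powr)
      then have "G * (\<omega> * s powr \<beta>) = k * (s powr r * s powr (- \<beta> * p) * s powr \<beta>)" by (simp add: G_def k_def mult_ac)
      also have "s powr r * s powr (- \<beta> * p) * s powr \<beta> = s powr (r - \<beta> * (p - 1))" by (simp add: algebra_simps flip: powr_add)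
      finally have "G * (\<omega> * s powr \<beta>) = k * s powr (r - \<beta> * (p - 1))" .
      moreover have "s powr - 1 \<le> s powr (r - \<beta> * (p - 1))" using s1 \<beta>_le by (intro powr_mono) auto
      ultimately show ?thesis using k s1 by (simp add: powr_minus divide_inverse)
    qed
    ultimately show ?thesis by (meson ennreal_leI order_trans)
  qed
  \<comment> \<open>Chosen so that k (ln t - ln s0) = C + 1 exceeds the mass bound C.\<close>
  define t where "t = s0 * exp ((C + 1) / k)"
  have t: "s0 < t" using s0_ge C k by (simp add: t_def)
  have "ennreal (k * (ln t - ln s0)) = (\<integral>\<^sup>+s. ennreal (k * (1 / s)) * indicator {s0..t} s \<partial>lborel)"
  proof -
    have "(\<integral>\<^sup>+s. ennreal (k * (1 / s)) * indicator {s0..t} s \<partial>lborel) = ennreal (k * ln t - k * ln s0)"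
    proof (rule nn_integral_FTC_Icc)
      fix s assume "s \<in> {s0..t}"
      then have "0 < s" using s0_ge by simp
      then show "((\<lambda>s. k * ln s) has_real_derivative k * (1 / s)) (at s)"
        by (auto intro!: derivative_eq_intros)
      show "0 \<le> k * (1 / s)" using k \<open>0 < s\<close> by simp
    qed (use t in auto)
    then show ?thesis by (simp add: right_diff_distrib)
  qed
  also have "\<dots> \<le> (\<integral>\<^sup>+s. indicator {0..<t} s * (\<integral>\<^sup>+y. g s y \<partial>lborel) \<partial>lborel)"
  proof (rule nn_integral_mono_AE)
    show "AE s in lborel. ennreal (k * (1 / s)) * indicator {s0..t} s \<le> indicator {0..<t} s * (\<integral>\<^sup>+y. g s y \<partial>lborel)"
      using AE_lborel_singleton[of t]
    proof eventually_elim
      fix s assume "s \<noteq> t"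
      then show "ennreal (k * (1 / s)) * indicator {s0..t} s \<le> indicator {0..<t} s * (\<integral>\<^sup>+y. g s y \<partial>lborel)"
        using source[of s] s0_ge by (cases "s \<in> {s0..t}") auto
    qed
  qed
  also have "\<dots> \<le> (\<integral>\<^sup>+y. ennreal (U t y) \<partial>lborel)"
    using mass_identity[of t] t s0_ge by simp
  also have "\<dots> \<le> ennreal C" using mass[of t] t s0_ge by simp
  finally have "k * (ln t - ln s0) \<le> C" using C by (simp add: ennreal_le_iff)
  moreover have "ln t = ln s0 + (C + 1) / k" using s0_ge by (simp add: t_def ln_mult)
  ultimately show False using k by simp
qed

end

section \<open>Mild solutions with a jointly measurable representative\<close>

text \<open>At \<open>s = t\<close> the Duhamel integrand is an evaluation, not an integral against the kernel.\<close>

lemma set_integral_drop_endpoint: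
  fixes \<phi> \<psi> :: "real \<Rightarrow> real"
  assumes eq: "\<And>s. 0 \<le> s \<Longrightarrow> s < t \<Longrightarrow> \<phi> s = \<psi> s" and [measurable]: "\<psi> \<in> borel_measurable borel"
  shows "(LINT s:{0..t}|lborel. \<phi> s) = (LINT s|lborel. indicator {0..<t} s * \<psi> s)"
proof -
  define h where "h = (\<lambda>s. if s = t then indicator {0..t} t * \<phi> t else indicator {0..<t} s * \<psi> s)"
  have "(LINT s:{0..t}|lborel. \<phi> s) = integral\<^sup>L lborel h"
    unfolding set_lebesgue_integral_def
    by (intro Bochner_Integration.integral_cong refl) (auto simp: h_def indicator_def eq)
  also have "\<dots> = (LINT s|lborel. indicator {0..<t} s * \<psi> s)"
  proof (rule integral_cong_AE)
    show "AE s in lborel. h s = indicator {0..<t} s * \<psi> s"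
      using AE_lborel_singleton[of t] by eventually_elim (simp add: h_def)
    show "h \<in> borel_measurable lborel" unfolding h_def by measurable
  qed measurable
  finally show ?thesis .
qed

lemma Linf_normD:
  assumes "Linf_norm \<phi> \<le> ennreal c" "0 \<le> c"
  shows "AE x in lborel. \<bar>\<phi> x\<bar> \<le> c"
  using esssup_AE[of "\<lambda>x. ennreal \<bar>\<phi> x\<bar>" lborel] 
proof eventually_elim
  fix x assume "ennreal \<bar>\<phi> x\<bar> \<le> esssup lborel (\<lambda>x. ennreal \<bar>\<phi> x\<bar>)"
  with assms(1) have "ennreal \<bar>\<phi> x\<bar> \<le> ennreal c" unfolding Linf_norm_def by (rule order_trans[rotated])
  then show "\<bar>\<phi> x\<bar> \<le> c" using assms(2) by (simp add: ennreal_le_iff)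
qed

lemma Linf_normI:
  assumes "\<phi> \<in> borel_measurable borel" "AE x in lborel. \<bar>\<phi> x\<bar> \<le> c"
  shows "Linf_norm \<phi> \<le> ennreal c"
  unfolding Linf_norm_def
  by (rule esssup_I) (use assms in \<open>auto elim!: eventually_mono intro: ennreal_leI\<close>)

text \<open>A sequence brings only countably many exceptional null sets, so off one null set all the
  essential bounds hold pointwise.\<close>

lemma Linf_norm_tendsto_0_AE:
  assumes "(\<lambda>n. Linf_norm (\<lambda>x. v n x - w x)) \<longlonglongrightarrow> 0"
  shows "AE x in lborel. (\<lambda>n. v n x) \<longlonglongrightarrow> w x"
proof -
  have "AE x in lborel. \<forall>n. ennreal \<bar>v n x - w x\<bar> \<le> Linf_norm (\<lambda>x. v n x - w x)"
    unfolding AE_all_countable Linf_norm_def by (intro allI esssup_AE)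
  then show ?thesis
  proof eventually_elim
    fix x assume *: "\<forall>n. ennreal \<bar>v n x - w x\<bar> \<le> Linf_norm (\<lambda>x. v n x - w x)"
    have "(\<lambda>n. ennreal \<bar>v n x - w x\<bar>) \<longlonglongrightarrow> ennreal 0"
      unfolding ennreal_0 by (rule tendsto_sandwich[OF _ _ tendsto_const assms]) (use * in auto)
    then have "(\<lambda>n. \<bar>v n x - w x\<bar>) \<longlonglongrightarrow> 0" by (subst (asm) tendsto_ennreal_iff) auto
    then show "(\<lambda>n. v n x) \<longlonglongrightarrow> w x" by (simp add: tendsto_rabs_zero_iff LIM_zero_iff)
  qed
qed

text \<open>\<open>u t\<close> is only determined up to null sets, so \<open>u\<close> itself need not be jointly measurable. The representative
  is the limit of \<open>u (\<lfloor>n t\<rfloor> / n)\<close>.\<close>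

lemma continuous_Linf_jointly_measurable:
  fixes u :: "real \<Rightarrow> 'a::euclidean_space \<Rightarrow> real"
  assumes meas: "\<And>t. 0 \<le> t \<Longrightarrow> u t \<in> borel_measurable borel"
    and cont: "\<And>t X. 0 \<le> t \<Longrightarrow> (\<And>n. 0 \<le> X n) \<Longrightarrow> X \<longlonglongrightarrow> t \<Longrightarrow> (\<lambda>n. Linf_norm (\<lambda>x. u (X n) x - u t x)) \<longlonglongrightarrow> 0"
    and nonneg: "\<And>t. 0 \<le> t \<Longrightarrow> AE x in lborel. 0 \<le> u t x"
  shows "\<exists>U. case_prod U \<in> borel_measurable (borel \<Otimes>\<^sub>M borel) \<and> (\<forall>t x. 0 \<le> U t x) \<and>
    (\<forall>t\<ge>0. AE x in lborel. U t x = u t x)"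
proof -
  \<comment> \<open>\<open>max 0\<close> keeps the grid points at admissible times, also for
    negative arguments; \<open>Suc n\<close> avoids a division by zero.\<close>
  define e where "e = (\<lambda>(n::nat) (i::int). max 0 (real_of_int i / real (Suc n)))"
  define V where "V = (\<lambda>n (s, y). u (e n \<lfloor>real (Suc n) * s\<rfloor>) y)"
  have V: "V n \<in> borel_measurable (borel \<Otimes>\<^sub>M borel)" for n
  proof -
    have "(\<lambda>z. u (e n i) (snd z)) \<in> borel_measurable (borel \<Otimes>\<^sub>M borel)" for i
    proof -
      have [measurable]: "u (e n i) \<in> borel_measurable borel" by (rule meas) (simp add: e_def)
      show "(\<lambda>z. u (e n i) (snd z)) \<in> borel_measurable (borel \<Otimes>\<^sub>M borel)" by measurable
    qed
    \<comment> \<open>The discretised time takes countably many values and each slice is measurable,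
      so the slices glue to a jointly measurable function.\<close>
    then have "(\<lambda>z. u (e n \<lfloor>real (Suc n) * fst z\<rfloor>) (snd z)) \<in> borel_measurable (borel \<Otimes>\<^sub>M borel)"
      by (rule measurable_compose_countable) measurable
    then show ?thesis by (simp add: V_def case_prod_beta')
  qed
  \<comment> \<open>\<open>lim\<close> is measurable even where the sequence diverges and its value
    is arbitrary; \<open>max 0\<close> enforces nonnegativity at those points as well.\<close>
  define U where "U = (\<lambda>s y. max 0 (lim (\<lambda>n. V n (s, y))))"
  show ?thesis
  proof (intro exI[of _ U] conjI allI impI)
    have "(\<lambda>z. max 0 (lim (\<lambda>n. V n z))) \<in> borel_measurable (borel \<Otimes>\<^sub>M borel)" using V by measurable
    then show "case_prod U \<in> borel_measurable (borel \<Otimes>\<^sub>M borel)" by (simp add: U_def case_prod_beta')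
    show "0 \<le> U t x" for t x by (simp add: U_def)
    fix t :: real assume t: "0 \<le> t"
    have e_lim: "(\<lambda>n. e n \<lfloor>real (Suc n) * t\<rfloor>) \<longlonglongrightarrow> t"
    proof (rule tendsto_sandwich)
      show "\<forall>\<^sub>F n in sequentially. t - 1 / real (Suc n) \<le> e n \<lfloor>real (Suc n) * t\<rfloor>"
      proof (rule always_eventually, rule allI)
        fix n
        have "real (Suc n) * t - 1 \<le> real_of_int \<lfloor>real (Suc n) * t\<rfloor>" by linarith
        then have "(real (Suc n) * t - 1) / real (Suc n) \<le> real_of_int \<lfloor>real (Suc n) * t\<rfloor> / real (Suc n)"
          by (rule divide_right_mono) simp
        then show "t - 1 / real (Suc n) \<le> e n \<lfloor>real (Suc n) * t\<rfloor>"
          unfolding e_def diff_divide_distrib by (simp del: of_nat_Suc)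
      qed
      show "\<forall>\<^sub>F n in sequentially. e n \<lfloor>real (Suc n) * t\<rfloor> \<le> t"
      proof (rule always_eventually, rule allI)
        fix n
        have "real_of_int \<lfloor>real (Suc n) * t\<rfloor> / real (Suc n) \<le> real (Suc n) * t / real (Suc n)"
          by (intro divide_right_mono) auto
        then show "e n \<lfloor>real (Suc n) * t\<rfloor> \<le> t" unfolding e_def using t by (simp del: of_nat_Suc)
      qed
      show "(\<lambda>n. t - 1 / real (Suc n)) \<longlonglongrightarrow> t" by real_asymp
    qed simp
    have "AE x in lborel. (\<lambda>n. u (e n \<lfloor>real (Suc n) * t\<rfloor>) x) \<longlonglongrightarrow> u t x"
      by (rule Linf_norm_tendsto_0_AE[OF cont[OF t _ e_lim]]) (simp add: e_def)
    then show "AE x in lborel. U t x = u t x"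
      using nonneg[OF t]
    proof eventually_elim
      fix x assume "(\<lambda>n. u (e n \<lfloor>real (Suc n) * t\<rfloor>) x) \<longlonglongrightarrow> u t x" "0 \<le> u t x"
      then show "U t x = u t x" by (simp add: U_def V_def limI)
    qed
  qed
qed

text \<open>Otherwise there are times in {0..t} at which the solution is not essentially bounded by
  n; near the limit of a convergent subsequence, continuity in the sup norm contradicts
  this.\<close>

lemma continuous_Linf_locally_bounded:
  fixes u :: "real \<Rightarrow> 'a::euclidean_space \<Rightarrow> real"
  assumes bdd: "\<And>t. 0 \<le> t \<Longrightarrow> Linf_norm (u t) < \<infinity>"
    and cont: "\<And>t X. 0 \<le> t \<Longrightarrow> (\<And>n. 0 \<le> X n) \<Longrightarrow> X \<longlonglongrightarrow> t \<Longrightarrow> (\<lambda>n. Linf_norm (\<lambda>x. u (X n) x - u t x)) \<longlonglongrightarrow> 0"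
  shows "\<exists>M. \<forall>s\<in>{0..t}. AE y in lborel. u s y \<le> M"
proof (rule ccontr)
  assume "\<nexists>M. \<forall>s\<in>{0..t}. AE y in lborel. u s y \<le> M"
  then have "\<forall>n::nat. \<exists>s\<in>{0..t}. \<not> (AE y in lborel. u s y \<le> real n)" by blast
  then obtain s where s: "\<And>n. s n \<in> {0..t}" "\<And>n. \<not> (AE y in lborel. u (s n) y \<le> real n)" by metis
  obtain l \<rho> where l: "l \<in> {0..t}" "strict_mono \<rho>" "(s \<circ> \<rho>) \<longlonglongrightarrow> l"
    using compact_Icc[of 0 t, unfolded compact_def] s(1) by metis
  have "(\<lambda>n. Linf_norm (\<lambda>x. u ((s \<circ> \<rho>) n) x - u l x)) \<longlonglongrightarrow> 0"
    using l s(1) by (intro cont) (auto simp: o_def)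
  then have "eventually (\<lambda>n. Linf_norm (\<lambda>x. u ((s \<circ> \<rho>) n) x - u l x) < 1) sequentially"
    by (rule order_tendstoD) simp
  moreover define K where "K = enn2real (Linf_norm (u l))"
  obtain N where N: "K + 1 \<le> real N" using real_arch_simple by blast
  ultimately have "eventually (\<lambda>n. Linf_norm (\<lambda>x. u ((s \<circ> \<rho>) n) x - u l x) < 1 \<and> N \<le> n) sequentially"
    using eventually_conj eventually_ge_at_top by blast
  then obtain n where n: "Linf_norm (\<lambda>x. u (s (\<rho> n)) x - u l x) < 1" "N \<le> n"
    by (auto simp: eventually_sequentially)
  have "AE x in lborel. \<bar>u l x\<bar> \<le> K"
    using bdd[of l] l(1) by (intro Linf_normD) (auto simp: K_def less_top)
  moreover have "AE x in lborel. \<bar>u (s (\<rho> n)) x - u l x\<bar> \<le> 1"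
    using n(1) by (intro Linf_normD) auto
  ultimately have "AE x in lborel. u (s (\<rho> n)) x \<le> real (\<rho> n)"
  proof eventually_elim
    fix x assume "\<bar>u l x\<bar> \<le> K" "\<bar>u (s (\<rho> n)) x - u l x\<bar> \<le> 1"
    moreover have "real N \<le> real (\<rho> n)" using n(2) seq_suble[OF l(2), of n] by simp
    ultimately show "u (s (\<rho> n)) x \<le> real (\<rho> n)" using N by linarith
  qed
  with s(2) show False by blast
qed

context fractional_order
begin

text \<open>Passes from the Bochner form of the Duhamel term, written with an arbitrary
  representative \<phi>, to the \<open>ennreal\<close> form with a jointly measurable G. The slices
  may differ on null sets because the semigroup does not see them; the bound C keeps the result
  finite.\<close>

lemma
  fixes \<phi> G :: "real \<Rightarrow> 'a::euclidean_space \<Rightarrow> real" and x :: 'a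
  assumes t: "0 < t"
    and \<phi>: "\<And>s. 0 \<le> s \<Longrightarrow> s < t \<Longrightarrow> \<phi> s \<in> borel_measurable borel"
    and \<phi>G: "\<And>s. 0 \<le> s \<Longrightarrow> s < t \<Longrightarrow> AE y in lborel. \<phi> s y = G s y"
    and G [measurable]: "case_prod G \<in> borel_measurable (borel \<Otimes>\<^sub>M borel)"
    and G0: "\<And>s y. 0 \<le> G s y"
    and GC: "\<And>s. 0 \<le> s \<Longrightarrow> s < t \<Longrightarrow> AE y in lborel. G s y \<le> C"
  defines "X \<equiv> \<integral>\<^sup>+s. indicator {0..<t} s * heat_nn (t - s) (\<lambda>y. ennreal (G s y)) x \<partial>lborel"
  shows duhamel_integral_eq: "(LINT s:{0..t}|lborel. heat_semigroup \<sigma> (t - s) (\<phi> s) x) = enn2real X"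
    and duhamel_integral_finite: "X < \<infinity>"
proof -
  note [measurable] = measurable_case_prod_comp[OF G]
  let ?H = "\<lambda>s. heat_nn (t - s) (\<lambda>y. ennreal (G s y)) x"
  have [measurable]: "?H \<in> borel_measurable borel" unfolding heat_nn_def by measurable
  have H: "?H s \<le> ennreal C" if s: "0 \<le> s" "s < t" for s
  proof -
    have "?H s \<le> heat_nn (t - s) (\<lambda>_. ennreal C) x"
    proof (rule heat_nn_mono_AE)
      show "AE y in lborel. ennreal (G s y) \<le> ennreal C" using GC[OF s] by eventually_elim (rule ennreal_leI)
    qed
    also have "\<dots> = ennreal C" using s by (intro heat_nn_const) auto
    finally show ?thesis .
  qed
  have "X \<le> (\<integral>\<^sup>+s. ennreal C * indicator {0..<t} s \<partial>lborel)"
    unfolding X_def by (intro nn_integral_mono) (auto simp: indicator_def H)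
  also have "\<dots> < \<infinity>" using t by (simp add: nn_integral_cmult_indicator ennreal_mult_less_top)
  finally show "X < \<infinity>" .
  have "(LINT s:{0..t}|lborel. heat_semigroup \<sigma> (t - s) (\<phi> s) x) = (LINT s|lborel. indicator {0..<t} s * enn2real (?H s))"
  proof (rule set_integral_drop_endpoint)
    fix s assume s: "0 \<le> s" "s < t"
    have "heat_semigroup \<sigma> (t - s) (\<phi> s) x = enn2real (heat_nn (t - s) (\<lambda>y. ennreal (\<phi> s y)) x)"
    proof (rule heat_semigroup_eq_heat_nn[OF _ \<phi>[OF s]])
      show "AE y in lborel. 0 \<le> \<phi> s y" using \<phi>G[OF s] by eventually_elim (simp add: G0)
    qed (use s in auto)
    also have "heat_nn (t - s) (\<lambda>y. ennreal (\<phi> s y)) x = ?H s"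
      using \<phi>G[OF s] by (intro heat_nn_cong_AE) (auto elim!: eventually_mono)
    finally show "heat_semigroup \<sigma> (t - s) (\<phi> s) x = enn2real (?H s)" .
  qed measurable
  also have "\<dots> = enn2real (\<integral>\<^sup>+s. ennreal (indicator {0..<t} s * enn2real (?H s)) \<partial>lborel)"
    by (intro integral_eq_nn_integral) auto
  also have "(\<integral>\<^sup>+s. ennreal (indicator {0..<t} s * enn2real (?H s)) \<partial>lborel) = X"
    unfolding X_def
  proof (intro nn_integral_cong)
    fix s :: real
    show "ennreal (indicator {0..<t} s * enn2real (?H s)) = indicator {0..<t} s * ?H s"
    proof (cases "s \<in> {0..<t}")
      case True
      then have "?H s < \<infinity>" using H[of s] by (auto simp: le_less_trans)
      then show ?thesis using True by (simp add: less_top)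
    qed simp
  qed
  finally show "(LINT s:{0..t}|lborel. heat_semigroup \<sigma> (t - s) (\<phi> s) x) = enn2real X" .
qed

lemma heat_nn_finite:
  fixes x :: "'a::euclidean_space"
  assumes a: "0 < a" and [measurable]: "\<phi> \<in> borel_measurable borel"
    and fin: "(\<integral>\<^sup>+y. \<phi> y \<partial>lborel) < \<infinity>"
  shows "heat_nn a \<phi> x < \<infinity>"
proof -
  let ?C = "integral\<^sup>L lborel (symbol a a :: 'a \<Rightarrow> real) / (2 * pi) ^ DIM('a)"
  have C: "p_kernel a a z \<le> ?C" for z :: 'a
    using p_kernel_abs_le[OF integrable_symbol, of a a z] \<sigma> a by (auto intro: order_trans[OF abs_ge_self])
  have "heat_nn a \<phi> x \<le> (\<integral>\<^sup>+y. ennreal ?C * \<phi> y \<partial>lborel)"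
    unfolding heat_nn_def by (intro nn_integral_mono mult_right_mono ennreal_leI C) auto
  also have "\<dots> = ennreal ?C * (\<integral>\<^sup>+y. \<phi> y \<partial>lborel)" by (rule nn_integral_cmult) simp
  also have "\<dots> < \<infinity>" using fin by (simp add: ennreal_mult_less_top)
  finally show ?thesis .
qed

text \<open>Writing the real Duhamel identity in \<open>ennreal\<close> requires both terms to be
  finite: the linear one because \<open>u0\<close> is integrable against a bounded kernel, the
  integral because the solution is bounded on compact time intervals.\<close>

lemma global_mild_solution_imp_nn:
  fixes u0 :: "'a::euclidean_space \<Rightarrow> real"
  assumes r: "0 \<le> r" and p: "1 < p"
    and u0: "integrable lborel u0" "\<And>x. 0 < u0 x"
    and sol: "global_mild_solution \<sigma> (\<lambda>t. t powr r) (log_source p) u0 u"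
  obtains U where "nn_global_solution \<sigma> r p u0 U"
proof -
  have u0m [measurable]: "u0 \<in> borel_measurable borel" using u0 by auto
  have I: "{t. 0 \<le> t \<and> ereal t < \<infinity>} = {0..}" by auto
  have S: "\<And>t. 0 \<le> t \<Longrightarrow> u t \<in> Linf" "\<And>t. 0 \<le> t \<Longrightarrow> AE x in lborel. 0 \<le> u t x"
    "\<And>t. 0 \<le> t \<Longrightarrow> ((\<lambda>s. Linf_norm (\<lambda>x. u s x - u t x)) \<longlongrightarrow> 0) (at t within {0..})"
    "\<And>t. 0 \<le> t \<Longrightarrow> AE x in lborel. u t x = heat_semigroup \<sigma> t u0 x +
        (LINT s:{0..t}|lborel. heat_semigroup \<sigma> (t - s) (\<lambda>y. s powr r * log_source p (u s y)) x)"
    using sol unfolding global_mild_solution_def mild_solution_def Let_def I by auto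
  have meas: "u t \<in> borel_measurable borel" and bdd: "Linf_norm (u t) < \<infinity>" if "0 \<le> t" for t
    using S(1)[OF that] by (auto simp: Linf_def)
  have cont: "(\<lambda>n. Linf_norm (\<lambda>x. u (X n) x - u t x)) \<longlonglongrightarrow> 0" if "0 \<le> t" "\<And>n. 0 \<le> X n" "X \<longlonglongrightarrow> t" for t X
  proof -
    \<comment> \<open>The punctured limit says nothing about sequences that hit t. Since the norm of
      the difference is 0 at t, the limit is continuity there, and arbitrary sequences are
      allowed.\<close>
    have "Linf_norm (\<lambda>x. u t x - u t x) = 0"
      using Linf_normI[of "\<lambda>x::'a. 0" 0] by simp
    then have "continuous (at t within {0..}) (\<lambda>s. Linf_norm (\<lambda>x. u s x - u t x))"
      using S(3)[OF that(1)] by (simp add: continuous_within)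
    then show ?thesis
      using that \<open>Linf_norm (\<lambda>x. u t x - u t x) = 0\<close> unfolding continuous_within_sequentially by (auto simp: o_def)
  qed
  have "\<exists>U. case_prod U \<in> borel_measurable (borel \<Otimes>\<^sub>M borel) \<and> (\<forall>t x. 0 \<le> U t x) \<and>
    (\<forall>t\<ge>0. AE x in lborel. U t x = u t x)"
    by (rule continuous_Linf_jointly_measurable[of u, OF meas cont S(2)])
  then obtain U where U: "case_prod U \<in> borel_measurable (borel \<Otimes>\<^sub>M borel)" "\<And>t x. 0 \<le> U t x"
    "\<And>t. 0 \<le> t \<Longrightarrow> AE x in lborel. U t x = u t x" by auto
  have bounded: "\<exists>M. \<forall>s\<in>{0..t}. AE y in lborel. U s y \<le> M" for t
  proof -
    have "\<exists>M. \<forall>s\<in>{0..t}. AE y in lborel. u s y \<le> M"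
      by (rule continuous_Linf_locally_bounded[of u, OF bdd cont])
    then obtain M where M: "\<forall>s\<in>{0..t}. AE y in lborel. u s y \<le> M" ..
    have "AE y in lborel. U s y \<le> M" if "s \<in> {0..t}" for s
    proof -
      have "AE y in lborel. u s y \<le> M" "AE y in lborel. U s y = u s y" using M that U(3) by auto
      then show ?thesis by eventually_elim simp
    qed
    then show ?thesis by blast
  qed
  have "nn_global_solution \<sigma> r p u0 U"
  proof
    fix t :: real assume t: "0 < t"
    define X where "X = (\<lambda>x. \<integral>\<^sup>+s. indicator {0..<t} s * heat_nn (t - s) (\<lambda>y. ennreal (s powr r * log_source p (U s y))) x \<partial>lborel)"
    obtain M where M: "\<forall>s\<in>{0..t}. AE y in lborel. U s y \<le> M" using bounded by blast
    have Gm: "(\<lambda>(s, y). s powr r * log_source p (U s y)) \<in> borel_measurable (borel \<Otimes>\<^sub>M borel)"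
      using measurable_compose[OF U(1) log_source_measurable[of p]] by (simp add: case_prod_beta')
    have phi_meas: "(\<lambda>y. s powr r * log_source p (u s y)) \<in> borel_measurable borel" if "0 \<le> s" for s
      using measurable_compose[OF meas[OF that] log_source_measurable] by simp
    have phi_eq: "AE y in lborel. s powr r * log_source p (u s y) = s powr r * log_source p (U s y)" if "0 \<le> s" for s
      using U(3)[OF that] by eventually_elim simp
    have bound: "AE y in lborel. s powr r * log_source p (U s y) \<le> t powr r * log_source p (max M 0)" if s: "0 \<le> s" "s < t" for s
    proof -
      have "AE y in lborel. U s y \<le> M" using M s by auto
      then show ?thesis
      proof eventually_elim
        fix y assume "U s y \<le> M"
        then show "s powr r * log_source p (U s y) \<le> t powr r * log_source p (max M 0)"
          using s r p U(2)[of s y] by (intro mult_mono powr_mono2 log_source_mono log_source_nonneg) auto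
      qed
    qed
    have G0: "0 \<le> s powr r * log_source p (U s y)" for s y by (simp add: log_source_nonneg U(2))
    have eq: "(LINT s:{0..t}|lborel. heat_semigroup \<sigma> (t - s) (\<lambda>y. s powr r * log_source p (u s y)) x) = enn2real (X x)"
      and fin: "X x < \<infinity>" for x
      using duhamel_integral_eq[OF t phi_meas phi_eq Gm G0 bound] duhamel_integral_finite[OF t phi_meas phi_eq Gm G0 bound]
      unfolding X_def by auto
    have u0_nn: "(\<integral>\<^sup>+y. ennreal (u0 y) \<partial>lborel) < \<infinity>"
      using u0 by (subst nn_integral_eq_integral) (auto intro: less_imp_le)
    have lin: "heat_semigroup \<sigma> t u0 x = enn2real (heat_nn t (\<lambda>y. ennreal (u0 y)) x)" for x
      by (rule heat_semigroup_eq_heat_nn[OF t u0m]) (auto intro!: AE_I2 less_imp_le u0)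
    have lin_fin: "heat_nn t (\<lambda>y. ennreal (u0 y)) x < \<infinity>" for x
      by (rule heat_nn_finite[OF _ _ u0_nn]) (use t in auto)
    have "AE x in lborel. u t x = heat_semigroup \<sigma> t u0 x +
        (LINT s:{0..t}|lborel. heat_semigroup \<sigma> (t - s) (\<lambda>y. s powr r * log_source p (u s y)) x)"
      using S(4) t by simp
    moreover have "AE x in lborel. U t x = u t x" using U(3) t by simp
    ultimately show "AE x in lborel. ennreal (U t x) = heat_nn t (\<lambda>y. ennreal (u0 y)) x + X x"
    proof eventually_elim
      fix x assume "u t x = heat_semigroup \<sigma> t u0 x +
        (LINT s:{0..t}|lborel. heat_semigroup \<sigma> (t - s) (\<lambda>y. s powr r * log_source p (u s y)) x)" "U t x = u t x"
      then have "U t x = enn2real (heat_nn t (\<lambda>y. ennreal (u0 y)) x) + enn2real (X x)" by (simp add: eq lin)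
      then show "ennreal (U t x) = heat_nn t (\<lambda>y. ennreal (u0 y)) x + X x"
        using fin[of x] lin_fin[of x] by (simp add: less_top)
    qed
  qed (use \<sigma> r p u0 U bounded in auto)
  then show thesis by (rule that)
qed

end

section \<open>Monotone iteration\<close>

text \<open>Clipping makes the source monotone and continuous on all of \<open>[0,\<infinity>]\<close>; the solutions constructed
  below stay under \<open>1\<close>, where it has no effect.\<close>

definition clipped_source :: "real \<Rightarrow> ennreal \<Rightarrow> ennreal" where
  "clipped_source p v = ennreal (log_source p (enn2real (min v 1)))"

lemma mono_clipped_source: "0 \<le> p \<Longrightarrow> mono (clipped_source p)"
  unfolding clipped_source_def
  by (intro monoI ennreal_leI log_source_mono enn2real_mono min.mono) (auto simp: min_less_iff_disj)

lemma clipped_source_measurable [measurable]: "clipped_source p \<in> borel_measurable borel"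
  unfolding clipped_source_def by measurable

lemma clipped_source_eq: "0 \<le> v \<Longrightarrow> v \<le> 1 \<Longrightarrow> clipped_source p (ennreal v) = ennreal (log_source p v)"
  by (simp add: clipped_source_def min_absorb1)

text \<open>Clipping confines the argument to [0,1], where \<open>enn2real\<close> and
  \<open>log_source\<close> are continuous; for an increasing sequence the limit is the
  supremum.\<close>

lemma clipped_source_SUP:
  assumes p: "0 < p" and v: "incseq v"
  shows "clipped_source p (SUP n. v n) = (SUP n. clipped_source p (v n))"
proof (rule LIMSEQ_unique)
  show "(\<lambda>n. clipped_source p (v n)) \<longlonglongrightarrow> (SUP n. clipped_source p (v n))"
    using v mono_clipped_source[of p] p by (intro LIMSEQ_SUP) (auto simp: incseq_def mono_def)
  have "(\<lambda>n. min (v n) 1) \<longlonglongrightarrow> min (SUP n. v n) 1"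
    by (intro tendsto_min LIMSEQ_SUP v tendsto_const)
  then have "(\<lambda>n. enn2real (min (v n) 1)) \<longlonglongrightarrow> enn2real (min (SUP n. v n) 1)"
    by (intro tendsto_enn2real) (auto simp: min_less_iff_disj)
  then have "(\<lambda>n. log_source p (enn2real (min (v n) 1))) \<longlonglongrightarrow> log_source p (enn2real (min (SUP n. v n) 1))"
    by (rule continuous_on_tendsto_compose[OF continuous_on_log_source[OF p]]) auto
  then show "(\<lambda>n. clipped_source p (v n)) \<longlonglongrightarrow> clipped_source p (SUP n. v n)"
    unfolding clipped_source_def by (rule tendsto_ennrealI)
qed

context fractional_order
begin

text \<open>The Duhamel map on arbitrary [0,\<infinity>]-valued functions: no finiteness has to be
  checked while iterating.\<close>

definition picard_op :: "real \<Rightarrow> (ennreal \<Rightarrow> ennreal) \<Rightarrow> (real \<Rightarrow> 'a::euclidean_space \<Rightarrow> ennreal) \<Rightarrow>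
    (real \<Rightarrow> 'a \<Rightarrow> ennreal) \<Rightarrow> real \<Rightarrow> 'a \<Rightarrow> ennreal" where
  "picard_op r f w V t x = w t x + (\<integral>\<^sup>+s. indicator {0..<t} s *
     heat_nn (t - s) (\<lambda>y. ennreal (s powr r) * f (V s y)) x \<partial>lborel)"

lemma picard_op_mono:
  assumes "mono f" "V \<le> W"
  shows "picard_op r f w V \<le> picard_op r f w W"
proof (intro le_funI)
  fix t and x :: 'a
  have "f (V s y) \<le> f (W s y)" for s y using assms by (auto dest: le_funD monoD)
  then show "picard_op r f w V t x \<le> picard_op r f w W t x"
    unfolding picard_op_def heat_nn_def by (intro add_left_mono nn_integral_mono mult_left_mono) auto
qed

lemma picard_integrand_measurable [measurable]:
  fixes V :: "real \<Rightarrow> 'a::euclidean_space \<Rightarrow> ennreal"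
  assumes V: "case_prod V \<in> borel_measurable (borel \<Otimes>\<^sub>M borel)" and [measurable]: "f \<in> borel_measurable borel"
    and [measurable]: "s \<in> borel_measurable M" "y \<in> borel_measurable M"
  shows "(\<lambda>z. ennreal (s z powr r) * f (V (s z) (y z))) \<in> borel_measurable M"
proof -
  note [measurable] = measurable_case_prod_comp[OF V]
  show ?thesis by measurable
qed

lemma picard_op_measurable:
  fixes V :: "real \<Rightarrow> 'a::euclidean_space \<Rightarrow> ennreal"
  assumes V [measurable]: "case_prod V \<in> borel_measurable (borel \<Otimes>\<^sub>M borel)" and [measurable]: "f \<in> borel_measurable borel"
    and w: "case_prod w \<in> borel_measurable (borel \<Otimes>\<^sub>M borel)"
  shows "case_prod (picard_op r f w V) \<in> borel_measurable (borel \<Otimes>\<^sub>M borel)"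
proof -
  have "(\<lambda>z. \<integral>\<^sup>+s. indicator {0..<fst z} s *
     heat_nn (fst z - s) (\<lambda>y. ennreal (s powr r) * f (V s y)) (snd z :: 'a) \<partial>lborel) \<in> borel_measurable (borel \<Otimes>\<^sub>M borel)"
    unfolding heat_nn_def indicator_def atLeastLessThan_iff by measurable
  with w have "(\<lambda>z. (case z of (t, x) \<Rightarrow> w t x) + (\<integral>\<^sup>+s. indicator {0..<fst z} s *
     heat_nn (fst z - s) (\<lambda>y. ennreal (s powr r) * f (V s y)) (snd z) \<partial>lborel)) \<in> borel_measurable (borel \<Otimes>\<^sub>M borel)"
    by (rule borel_measurable_add)
  then show ?thesis by (simp add: picard_op_def[abs_def] case_prod_beta')
qed

text \<open>Monotone convergence twice, in space inside the semigroup and then in time.\<close>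

lemma picard_op_SUP:
  fixes V :: "nat \<Rightarrow> real \<Rightarrow> 'a::euclidean_space \<Rightarrow> ennreal"
  assumes V: "\<And>n. case_prod (V n) \<in> borel_measurable (borel \<Otimes>\<^sub>M borel)" and inc: "incseq V"
    and f: "mono f" "f \<in> borel_measurable borel"
    and f_SUP: "\<And>v. incseq v \<Longrightarrow> f (SUP n. v n) = (SUP n. f (v n))"
  shows "picard_op r f w (\<lambda>t x. SUP n. V n t x) t x = (SUP n. picard_op r f w (V n) t x)"
proof -
  note [measurable] = f(2) V
  have incf: "incseq (\<lambda>n. f (V n s y))" "incseq (\<lambda>n. V n s y)" for s y
    using inc monoD[OF f(1)] by (auto simp: incseq_def le_fun_def)
  have mk: "heat_nn a (\<lambda>y. ennreal (s powr r) * f (V m s y)) x \<le> heat_nn a (\<lambda>y. ennreal (s powr r) * f (V n s y)) x"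
    if "m \<le> n" for a s m n
    unfolding heat_nn_def using incf(1)[of s] that by (intro nn_integral_mono mult_left_mono) (auto simp: incseq_def)
  have inner: "heat_nn a (\<lambda>y. ennreal (s powr r) * f (SUP n. V n s y)) x
      = (SUP n. heat_nn a (\<lambda>y. ennreal (s powr r) * f (V n s y)) x)" for a s
  proof -
    have "heat_nn a (\<lambda>y. ennreal (s powr r) * f (SUP n. V n s y)) x
        = (\<integral>\<^sup>+y. (SUP n. ennreal (p_kernel a a (x - y)) * (ennreal (s powr r) * f (V n s y))) \<partial>lborel)"
      unfolding heat_nn_def by (simp add: f_SUP incf SUP_mult_left_ennreal)
    also have "\<dots> = (SUP n. heat_nn a (\<lambda>y. ennreal (s powr r) * f (V n s y)) x)"
      unfolding heat_nn_def using incf(1)[of s]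
      by (intro nn_integral_monotone_convergence_SUP) (auto simp: incseq_def le_fun_def intro!: mult_left_mono)
    finally show ?thesis .
  qed
  have "picard_op r f w (\<lambda>t x. SUP n. V n t x) t x = w t x + (\<integral>\<^sup>+s. (SUP n. indicator {0..<t} s *
     heat_nn (t - s) (\<lambda>y. ennreal (s powr r) * f (V n s y)) x) \<partial>lborel)"
    unfolding picard_op_def inner by (simp add: SUP_mult_left_ennreal)
  also have "\<dots> = w t x + (SUP n. \<integral>\<^sup>+s. indicator {0..<t} s *
     heat_nn (t - s) (\<lambda>y. ennreal (s powr r) * f (V n s y)) x \<partial>lborel)"
  proof (subst nn_integral_monotone_convergence_SUP)
    show "incseq (\<lambda>n s. indicator {0..<t} s * heat_nn (t - s) (\<lambda>y. ennreal (s powr r) * f (V n s y)) x)"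
      unfolding incseq_def le_fun_def by (intro allI impI mult_left_mono mk) auto
    fix n
    show "(\<lambda>s. indicator {0..<t} s * heat_nn (t - s) (\<lambda>y. ennreal (s powr r) * f (V n s y)) x) \<in> borel_measurable lborel"
      unfolding heat_nn_def by measurable
  qed simp
  also have "\<dots> = (SUP n. picard_op r f w (V n) t x)"
    unfolding picard_op_def by (rule ennreal_SUP_add_right) simp
  finally show ?thesis .
qed

text \<open>The iterates from 0 increase because the map is monotone, and the supersolution caps
  them by induction. That the map commutes with increasing suprema makes their supremum a fixed
  point.\<close>

lemma picard_fixed_point:
  fixes w :: "real \<Rightarrow> 'a::euclidean_space \<Rightarrow> ennreal"
  assumes w: "case_prod w \<in> borel_measurable (borel \<Otimes>\<^sub>M borel)"
    and f: "mono f" "f \<in> borel_measurable borel"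
    and f_SUP: "\<And>v. incseq v \<Longrightarrow> f (SUP n. v n) = (SUP n. f (v n))"
    and super: "picard_op r f w W \<le> W"
  obtains V where "case_prod V \<in> borel_measurable (borel \<Otimes>\<^sub>M borel)" "picard_op r f w V = V" "V \<le> W"
proof -
  define P where "P = (\<lambda>n. (picard_op r f w ^^ n) (\<lambda>_ _. 0))"
  have P_Suc: "P (Suc n) = picard_op r f w (P n)" for n by (simp add: P_def)
  have P_meas: "case_prod (P n) \<in> borel_measurable (borel \<Otimes>\<^sub>M borel)" for n
  proof (induction n)
    case 0
    then show ?case by (simp add: P_def)
  qed (simp add: P_Suc picard_op_measurable f w)
  have "P n \<le> P (Suc n)" for n
  proof (induction n)
    case 0
    then show ?case by (simp add: P_def le_fun_def)
  qed (simp add: P_Suc picard_op_mono f)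
  then have inc: "incseq P" by (rule incseq_SucI)
  have PW: "P n \<le> W" for n
  proof (induction n)
    case 0
    then show ?case by (simp add: P_def le_fun_def)
  next
    case (Suc n)
    then show ?case unfolding P_Suc by (rule order_trans[OF picard_op_mono[OF f(1)] super])
  qed
  define V where "V = (\<lambda>t x. SUP n. P n t x)"
  show thesis
  proof (rule that)
    have "(\<lambda>z. SUP n. case_prod (P n) z) \<in> borel_measurable (borel \<Otimes>\<^sub>M borel)"
      using P_meas by (intro borel_measurable_SUP) auto
    then show "case_prod V \<in> borel_measurable (borel \<Otimes>\<^sub>M borel)" by (simp add: V_def case_prod_beta')
    show "picard_op r f w V = V"
    proof (intro ext)
      fix t x
      have "picard_op r f w V t x = (SUP n. P (Suc n) t x)"
        unfolding V_def P_Suc by (rule picard_op_SUP[OF P_meas inc f f_SUP])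
      also have "\<dots> = V t x"
        unfolding V_def
      proof (intro antisym SUP_mono)
        show "\<exists>m\<in>UNIV. P (Suc n) t x \<le> P m t x" for n by blast
        show "\<exists>m\<in>UNIV. P n t x \<le> P (Suc m) t x" for n
          using inc by (auto simp: incseq_Suc_iff le_fun_def)
      qed
      finally show "picard_op r f w V t x = V t x" .
    qed
    show "V \<le> W" unfolding V_def using PW by (auto simp: le_fun_def intro!: SUP_least)
  qed
qed

section \<open>Existence\<close>

text \<open>Heat kernel and time cutoff together form one integrable function on space-time.
  Continuity in t of the Duhamel term thereby reduces to continuity of this function in L1.\<close>

definition duhamel_kernel :: "real \<Rightarrow> real \<times> 'a::euclidean_space \<Rightarrow> real" where
  "duhamel_kernel t z = indicator {0..<t} (fst z) * p_kernel (t - fst z) (t - fst z) (snd z)"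

lemma duhamel_kernel_measurable [measurable]: "duhamel_kernel t \<in> borel_measurable (lborel \<Otimes>\<^sub>M lborel)"
  unfolding duhamel_kernel_def by measurable

lemma duhamel_kernel_nonneg:
  shows "0 \<le> duhamel_kernel t z"
  by (auto simp: duhamel_kernel_def indicator_def intro!: p_kernel_nonneg)

lemma nn_integral_duhamel_kernel:
  assumes t: "0 \<le> t"
  shows "(\<integral>\<^sup>+z. ennreal (duhamel_kernel t (z :: real \<times> 'a::euclidean_space)) \<partial>(lborel \<Otimes>\<^sub>M lborel)) = ennreal t"
proof -
  have "(\<integral>\<^sup>+z. ennreal (duhamel_kernel t (z :: real \<times> 'a)) \<partial>(lborel \<Otimes>\<^sub>M lborel))
      = (\<integral>\<^sup>+s. (\<integral>\<^sup>+y. ennreal (duhamel_kernel t (s, y :: 'a)) \<partial>lborel) \<partial>lborel)"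
    by (rule lborel.nn_integral_fst[symmetric]) measurable
  also have "\<dots> = (\<integral>\<^sup>+s. indicator {0..<t} s \<partial>lborel)"
  proof (intro nn_integral_cong)
    fix s :: real
    show "(\<integral>\<^sup>+y. ennreal (duhamel_kernel t (s, y :: 'a)) \<partial>lborel) = indicator {0..<t} s"
      using nn_integral_p_kernel[where 'a='a, of "t - s" "t - s"]
      by (cases "s \<in> {0..<t}") (auto simp: duhamel_kernel_def)
  qed
  also have "\<dots> = ennreal t" using t by simp
  finally show ?thesis .
qed

text \<open>By Scheffe's lemma, since the total mass of the kernel is \<open>t\<close>.\<close>

lemma duhamel_kernel_L1_tendsto:
  assumes t: "0 \<le> t" and X: "\<And>n. 0 \<le> X n" "X \<longlonglongrightarrow> t"
  shows "(\<lambda>n. \<integral>\<^sup>+z. ennreal \<bar>duhamel_kernel (X n) z - duhamel_kernel t (z :: real \<times> 'a::euclidean_space)\<bar> \<partial>(lborel \<Otimes>\<^sub>M lborel)) \<longlonglongrightarrow> 0"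
proof -
  let ?K = "\<lambda>t. duhamel_kernel t :: real \<times> 'a \<Rightarrow> real"
  have int: "integrable (lborel \<Otimes>\<^sub>M lborel) (?K t)" if "0 \<le> t" for t
    using nn_integral_duhamel_kernel[OF that, where 'a='a]
    by (intro integrableI_nonneg) (auto intro!: AE_I2 duhamel_kernel_nonneg)
  have norm_eq: "(\<integral>\<^sup>+z. ennreal (norm (?K t z)) \<partial>(lborel \<Otimes>\<^sub>M lborel)) = ennreal t" if "0 \<le> t" for t
    using nn_integral_duhamel_kernel[OF that, where 'a='a] by (simp add: duhamel_kernel_nonneg)
  have "(\<lambda>n. \<integral>\<^sup>+z. ennreal (norm (?K (X n) z - ?K t z)) \<partial>(lborel \<Otimes>\<^sub>M lborel)) \<longlonglongrightarrow> 0"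
  proof (rule Scheffe_lemma1)
    show "integrable (lborel \<Otimes>\<^sub>M lborel) (?K (X n))" for n by (rule int[OF X(1)])
    show "integrable (lborel \<Otimes>\<^sub>M lborel) (?K t)" by (rule int[OF t])
    have "(\<lambda>n. ennreal (X n)) \<longlonglongrightarrow> ennreal t" by (intro tendsto_ennrealI X)
    \<comment> \<open>The L1 norms are the times X n themselves, so their convergence is the
      convergence of X.\<close>
    then show "limsup (\<lambda>n. \<integral>\<^sup>+z. ennreal (norm (?K (X n) z)) \<partial>(lborel \<Otimes>\<^sub>M lborel)) \<le> (\<integral>\<^sup>+z. ennreal (norm (?K t z)) \<partial>(lborel \<Otimes>\<^sub>M lborel))"
      unfolding norm_eq[OF X(1)] norm_eq[OF t] by (simp add: lim_imp_Limsup)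
    \<comment> \<open>At s = t the cutoff need not converge, as X n may lie on either side; the
      hyperplane is a null set.\<close>
    have "AE z in lborel \<Otimes>\<^sub>M lborel. fst (z :: real \<times> 'a) \<noteq> t"
    proof (rule lborel_pair.AE_pair_measure)
      show "{z \<in> space (lborel \<Otimes>\<^sub>M lborel). fst (z :: real \<times> 'a) \<noteq> t} \<in> sets (lborel \<Otimes>\<^sub>M lborel)" by measurable
    qed (use AE_lborel_singleton[of t] in \<open>auto elim!: eventually_mono\<close>)
    then show "AE z in lborel \<Otimes>\<^sub>M lborel. (\<lambda>n. ?K (X n) z) \<longlonglongrightarrow> ?K t z"
    proof eventually_elim
      fix z :: "real \<times> 'a" assume ne: "fst z \<noteq> t"
      obtain s y where z: "z = (s, y)" by fastforce
      consider "s < 0" | "0 \<le> s" "s < t" | "t < s" using ne z by fastforce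
      then show "(\<lambda>n. ?K (X n) z) \<longlonglongrightarrow> ?K t z"
      proof cases
        case 1
        then show ?thesis by (simp add: duhamel_kernel_def z)
      next
        case 2
        \<comment> \<open>The maximum keeps the elapsed time above a fixed positive number for all
          n, as \<open>p_kernel_tendsto\<close> requires; eventually it equals X n - s.\<close>
        let ?a = "\<lambda>n. max (X n - s) ((t - s) / 2)"
        have "?a \<longlonglongrightarrow> max (t - s) ((t - s) / 2)" by (intro tendsto_intros X)
        then have a: "?a \<longlonglongrightarrow> t - s" using 2 by simp
        have a_ge: "(t - s) / 2 \<le> ?a n" "0 \<le> ?a n" for n using 2 by (auto simp: le_max_iff_disj)
        have "(\<lambda>n. p_kernel (?a n) (?a n) y) \<longlonglongrightarrow> p_kernel (t - s) (t - s) y"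
          by (rule p_kernel_tendsto[OF a a_ge(1) _ a a_ge(2)]) (use 2 in auto)
        moreover have "eventually (\<lambda>n. p_kernel (?a n) (?a n) y = ?K (X n) z) sequentially"
        proof -
          have "eventually (\<lambda>n. (s + t) / 2 < X n) sequentially" using X(2) 2 by (intro order_tendstoD) auto
          then show ?thesis
          proof eventually_elim
            fix n assume n: "(s + t) / 2 < X n"
            then have "?a n = X n - s" "s < X n" using 2 by (auto simp: max_def field_simps)
            then show "p_kernel (?a n) (?a n) y = ?K (X n) z" using 2 by (simp add: duhamel_kernel_def z)
          qed
        qed
        ultimately have "(\<lambda>n. ?K (X n) z) \<longlonglongrightarrow> p_kernel (t - s) (t - s) y" by (rule Lim_transform_eventually)
        then show ?thesis using 2 by (simp add: duhamel_kernel_def z)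
      next
        case 3
        have "eventually (\<lambda>n. X n < s) sequentially" using X(2) 3 by (intro order_tendstoD)
        then have "eventually (\<lambda>n. ?K (X n) z = ?K t z) sequentially"
          by eventually_elim (use 3 in \<open>simp add: duhamel_kernel_def z\<close>)
        then show ?thesis by (rule tendsto_eventually)
      qed
    qed
  qed
  then show ?thesis by simp
qed

text \<open>One-sided, so that no difference of \<open>ennreal\<close> values appears; exchanging t
  and t' gives the other side. Integration over all of space removes x from the error term, which
  makes the estimate a sup-norm one.\<close>

lemma duhamel_term_diff_le:
  fixes G :: "real \<Rightarrow> 'a::euclidean_space \<Rightarrow> ennreal" and x :: 'a
  assumes G [measurable]: "case_prod G \<in> borel_measurable (borel \<Otimes>\<^sub>M borel)"
    and L: "t' \<le> L" and GB: "\<And>s y. 0 \<le> s \<Longrightarrow> s \<le> L \<Longrightarrow> G s y \<le> B"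
  shows "(\<integral>\<^sup>+s. indicator {0..<t'} s * heat_nn (t' - s) (G s) x \<partial>lborel)
    \<le> (\<integral>\<^sup>+s. indicator {0..<t} s * heat_nn (t - s) (G s) x \<partial>lborel)
      + B * (\<integral>\<^sup>+z. ennreal \<bar>duhamel_kernel t' z - duhamel_kernel t (z :: real \<times> 'a)\<bar> \<partial>(lborel \<Otimes>\<^sub>M lborel))"
proof -
  let ?K = "\<lambda>t s z. duhamel_kernel t (s, z :: 'a)"
  have K0: "0 \<le> ?K t s z" for t s z by (rule duhamel_kernel_nonneg)
  note [measurable] = measurable_case_prod_comp[OF G]
  have [measurable]: "(\<lambda>z. ?K t (f z) (h z)) \<in> borel_measurable M"
    if [measurable]: "f \<in> borel_measurable M" "h \<in> borel_measurable M" for f :: "'m \<Rightarrow> real" and h M t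
    unfolding duhamel_kernel_def by measurable
  have D: "(\<integral>\<^sup>+s. indicator {0..<t} s * heat_nn (t - s) (G s) x \<partial>lborel)
      = (\<integral>\<^sup>+s. (\<integral>\<^sup>+y. ennreal (?K t s (x - y)) * G s y \<partial>lborel) \<partial>lborel)" for t
    by (intro nn_integral_cong) (auto simp: heat_nn_def duhamel_kernel_def indicator_def)
  have pt: "ennreal (?K t' s (x - y)) * G s y \<le> ennreal (?K t s (x - y)) * G s y + B * ennreal \<bar>?K t' s (x - y) - ?K t s (x - y)\<bar>" for s y
  proof (cases "s \<in> {0..<t'}")
    case True
    have "ennreal (?K t' s (x - y)) \<le> ennreal (?K t s (x - y)) + ennreal \<bar>?K t' s (x - y) - ?K t s (x - y)\<bar>"
    proof -
      have "ennreal (?K t' s (x - y)) \<le> ennreal (?K t s (x - y) + \<bar>?K t' s (x - y) - ?K t s (x - y)\<bar>)"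
        by (rule ennreal_leI) simp
      then show ?thesis by (simp add: ennreal_plus K0)
    qed
    then have "ennreal (?K t' s (x - y)) * G s y \<le> (ennreal (?K t s (x - y)) + ennreal \<bar>?K t' s (x - y) - ?K t s (x - y)\<bar>) * G s y"
      by (rule mult_right_mono) simp
    also have "\<dots> \<le> ennreal (?K t s (x - y)) * G s y + ennreal \<bar>?K t' s (x - y) - ?K t s (x - y)\<bar> * B"
      unfolding distrib_right using True L by (intro add_left_mono mult_left_mono GB) auto
    finally show ?thesis by (simp add: mult.commute)
  qed (simp add: duhamel_kernel_def)
  have "(\<integral>\<^sup>+s. indicator {0..<t'} s * heat_nn (t' - s) (G s) x \<partial>lborel)
      \<le> (\<integral>\<^sup>+s. (\<integral>\<^sup>+y. ennreal (?K t s (x - y)) * G s y + B * ennreal \<bar>?K t' s (x - y) - ?K t s (x - y)\<bar> \<partial>lborel) \<partial>lborel)"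
    unfolding D by (intro nn_integral_mono pt)
  also have "\<dots> = (\<integral>\<^sup>+s. (\<integral>\<^sup>+y. ennreal (?K t s (x - y)) * G s y \<partial>lborel) \<partial>lborel)
      + B * (\<integral>\<^sup>+s. (\<integral>\<^sup>+y. ennreal \<bar>?K t' s (x - y) - ?K t s (x - y)\<bar> \<partial>lborel) \<partial>lborel)"
    by (simp add: nn_integral_add nn_integral_cmult)
  also have "(\<integral>\<^sup>+s. (\<integral>\<^sup>+y. ennreal \<bar>?K t' s (x - y) - ?K t s (x - y)\<bar> \<partial>lborel) \<partial>lborel)
      = (\<integral>\<^sup>+s. (\<integral>\<^sup>+y. ennreal \<bar>?K t' s y - ?K t s y\<bar> \<partial>lborel) \<partial>lborel)"
    by (intro nn_integral_cong nn_integral_lborel_reflect) measurable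
  also have "\<dots> = (\<integral>\<^sup>+z. ennreal \<bar>duhamel_kernel t' z - duhamel_kernel t (z :: real \<times> 'a)\<bar> \<partial>(lborel \<Otimes>\<^sub>M lborel))"
    by (rule lborel.nn_integral_fst) measurable
  finally show ?thesis unfolding D .
qed

text \<open>For W = 2e S(1+s,s) the source is at most 2 W^p, and p - 1 of the powers of S are
  replaced by their decay rate. What is left is a multiple of S(1+s,s), which the semigroup carries
  to S(1+t,t), a factor independent of s. The remaining time integral of (1+s)^(-1-\<theta>) is at
  most 1/\<theta>, so the third condition on e closes the estimate; the second keeps W below the
  clipping level.\<close>

lemma supersolution:
  fixes x :: "'a::euclidean_space"
  assumes r: "0 \<le> r" and p: "1 < p"
    and \<beta>: "\<beta> = real DIM('a) / (2 * \<sigma>)" and \<theta>: "\<theta> = \<beta> * (p - 1) - r - 1" "0 < \<theta>"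
    and A: "0 < A" "\<And>s (x::'a). 0 \<le> s \<Longrightarrow> p_kernel (1 + s) s x \<le> A * (1 + s) powr (- \<beta>)"
    and e: "0 < e" "2 * e * A \<le> 1" "2 * (2 * e) powr p * A powr (p - 1) / \<theta> \<le> e"
    and t: "0 \<le> t" and W: "\<And>s y. 0 \<le> s \<Longrightarrow> W s y = ennreal (2 * e * p_kernel (1 + s) s y)"
  shows "picard_op r (clipped_source p) (\<lambda>t x. ennreal (e * p_kernel (1 + t) t x)) W t x
    \<le> ennreal (2 * e * p_kernel (1 + t) t x)"
proof -
  \<comment> \<open>The factors are 2 from \<open>log_source_upper\<close>, (2e)^p from the
    coefficient of W, and A^(p-1) from the kernel bound.\<close>
  define \<kappa> where "\<kappa> = 2 * (2 * e) powr p * A powr (p - 1)"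
  have \<kappa>: "0 \<le> \<kappa>" by (simp add: \<kappa>_def)
  let ?S = "\<lambda>s. p_kernel (1 + s) s :: 'a \<Rightarrow> real"
  have S0: "0 \<le> ?S s y" if "0 \<le> s" for s y using that by (intro p_kernel_nonneg) auto
  have S_le: "?S s y \<le> A" if "0 \<le> s" for s y
  proof -
    have "(1 + s) powr (- \<beta>) \<le> (1 + s) powr 0" using that \<sigma> by (intro powr_mono) (auto simp: \<beta>)
    then have "A * (1 + s) powr (- \<beta>) \<le> A * 1" using A(1) that by (intro mult_left_mono) auto
    then show ?thesis using A(2)[OF that, of y] by simp
  qed
  have src: "clipped_source p (W s y) \<le> ennreal (\<kappa> * (1 + s) powr (- \<beta> * (p - 1))) * ennreal (?S s y)" if s: "0 \<le> s" for s y
  proof -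
    let ?v = "2 * e * ?S s y"
    have v: "0 \<le> ?v" "?v \<le> 1"
    proof -
      show "0 \<le> ?v" using S0[OF s] e by simp
      have "?v \<le> 2 * e * A" using S_le[OF s] e by (intro mult_left_mono) auto
      then show "?v \<le> 1" using e(2) by linarith
    qed
    have "log_source p ?v \<le> 2 * ?v powr p" using v p by (intro log_source_upper) auto
    also have "?v powr p = (2 * e) powr p * (?S s y powr (p - 1) * ?S s y)"
    proof -
      have "?S s y powr p = ?S s y powr (p - 1) * ?S s y"
        using S0[OF s, of y] powr_add[of "?S s y" "p - 1" 1] by simp
      then show ?thesis using e S0[OF s, of y] by (simp add: powr_mult)
    qed
    also have "2 * ((2 * e) powr p * (?S s y powr (p - 1) * ?S s y)) \<le> 2 * ((2 * e) powr p * ((A * (1 + s) powr (- \<beta>)) powr (p - 1) * ?S s y))"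
      using A(2)[OF s] S0[OF s] p by (intro mult_left_mono mult_right_mono powr_mono2) auto
    also have "\<dots> = \<kappa> * (1 + s) powr (- \<beta> * (p - 1)) * ?S s y"
      using A(1) s by (simp add: \<kappa>_def powr_mult powr_powr)
    finally have "log_source p ?v \<le> \<kappa> * (1 + s) powr (- \<beta> * (p - 1)) * ?S s y" .
    then show ?thesis
      using v \<kappa> by (simp add: W[OF s] clipped_source_eq ennreal_leI flip: ennreal_mult')
  qed
  have inner: "heat_nn (t - s) (\<lambda>y. ennreal (s powr r) * clipped_source p (W s y)) x
      \<le> ennreal (\<kappa> * (1 + s) powr (- 1 - \<theta>)) * ennreal (?S t x)" if s: "0 \<le> s" "s < t" for s
  proof -
    let ?c = "\<kappa> * (1 + s) powr (- 1 - \<theta>)"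
    have c: "0 \<le> ?c" using \<kappa> by simp
    have "heat_nn (t - s) (\<lambda>y. ennreal (s powr r) * clipped_source p (W s y)) x
        \<le> heat_nn (t - s) (\<lambda>y. ennreal ?c * ennreal (?S s y)) x"
    proof (rule heat_nn_mono_AE, rule AE_I2)
      fix y :: 'a
      have "s powr r * (\<kappa> * (1 + s) powr (- \<beta> * (p - 1))) \<le> (1 + s) powr r * (\<kappa> * (1 + s) powr (- \<beta> * (p - 1)))"
        using s r \<kappa> by (intro mult_right_mono powr_mono2) auto
      also have "\<dots> = \<kappa> * ((1 + s) powr r * (1 + s) powr (- \<beta> * (p - 1)))" by simp
      also have "(1 + s) powr r * (1 + s) powr (- \<beta> * (p - 1)) = (1 + s) powr (- 1 - \<theta>)"
        by (simp add: \<theta>(1) algebra_simps flip: powr_add)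
      finally have *: "s powr r * (\<kappa> * (1 + s) powr (- \<beta> * (p - 1))) \<le> ?c" .
      have "ennreal (s powr r) * clipped_source p (W s y) \<le> ennreal (s powr r) * (ennreal (\<kappa> * (1 + s) powr (- \<beta> * (p - 1))) * ennreal (?S s y))"
        by (intro mult_left_mono src s) auto
      also have "\<dots> = ennreal (s powr r * (\<kappa> * (1 + s) powr (- \<beta> * (p - 1)))) * ennreal (?S s y)"
        using \<kappa> by (simp add: ennreal_mult' mult.assoc)
      also have "\<dots> \<le> ennreal ?c * ennreal (?S s y)" by (intro mult_right_mono ennreal_leI *) auto
      finally show "ennreal (s powr r) * clipped_source p (W s y) \<le> ennreal ?c * ennreal (?S s y)" .
    qed
    also have "\<dots> = ennreal ?c * (\<integral>\<^sup>+y. ennreal (p_kernel (t - s) (t - s) (x - y)) * ennreal (?S s (y - 0)) \<partial>lborel)"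
      unfolding heat_nn_def by (subst nn_integral_cmult[symmetric]) (auto simp: mult_ac)
    also have "(\<integral>\<^sup>+y. ennreal (p_kernel (t - s) (t - s) (x - y)) * ennreal (?S s (y - 0)) \<partial>lborel)
        = ennreal (p_kernel (t - s + (1 + s)) (t - s + s) (x - 0))"
      using s by (intro nn_integral_p_kernel_convolution) auto
    finally show ?thesis by (simp add: add.commute)
  qed
  have "(\<integral>\<^sup>+s. indicator {0..<t} s * heat_nn (t - s) (\<lambda>y. ennreal (s powr r) * clipped_source p (W s y)) x \<partial>lborel)
      \<le> (\<integral>\<^sup>+s. (ennreal (\<kappa> * (1 + s) powr (- 1 - \<theta>)) * indicator {0..t} s) * ennreal (?S t x) \<partial>lborel)"
    by (intro nn_integral_mono) (use inner in \<open>auto simp: indicator_def\<close>)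
  also have "\<dots> = (\<integral>\<^sup>+s. ennreal (\<kappa> * (1 + s) powr (- 1 - \<theta>)) * indicator {0..t} s \<partial>lborel) * ennreal (?S t x)"
    by (rule nn_integral_multc) measurable
  also have "(\<integral>\<^sup>+s. ennreal (\<kappa> * (1 + s) powr (- 1 - \<theta>)) * indicator {0..t} s \<partial>lborel)
      = ennreal (- \<kappa> / \<theta> * (1 + t) powr (- \<theta>) - - \<kappa> / \<theta> * (1 + 0) powr (- \<theta>))"
  proof (rule nn_integral_FTC_Icc)
    fix s assume "s \<in> {0..t}"
    then have s: "0 < 1 + s" by simp
    have "((\<lambda>s. 1 + s) has_real_derivative 1) (at s)" by (auto intro!: derivative_eq_intros)
    from DERIV_chain2[where g = "\<lambda>s. 1 + s" and f = "\<lambda>z. z powr (- \<theta>)", OF has_real_derivative_powr[OF s] this]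
    have "((\<lambda>s. - \<kappa> / \<theta> * (1 + s) powr (- \<theta>)) has_real_derivative - \<kappa> / \<theta> * (- \<theta> * (1 + s) powr (- \<theta> - 1) * 1)) (at s)"
      by (rule DERIV_cmult)
    moreover have "- \<theta> - 1 = - 1 - \<theta>" by simp
    ultimately show "((\<lambda>s. - \<kappa> / \<theta> * (1 + s) powr (- \<theta>)) has_real_derivative \<kappa> * (1 + s) powr (- 1 - \<theta>)) (at s)"
      using \<theta>(2) by simp
  qed (use \<kappa> t in auto)
  also have "\<dots> \<le> ennreal e"
  proof (rule ennreal_leI)
    have "- \<kappa> / \<theta> * (1 + t) powr (- \<theta>) - - \<kappa> / \<theta> * (1 + 0) powr (- \<theta>) \<le> \<kappa> / \<theta>"
      using \<kappa> \<theta>(2) t by simp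
    also have "\<dots> \<le> e" using e(3) by (simp add: \<kappa>_def)
    finally show "- \<kappa> / \<theta> * (1 + t) powr (- \<theta>) - - \<kappa> / \<theta> * (1 + 0) powr (- \<theta>) \<le> e" .
  qed
  finally have "(\<integral>\<^sup>+s. indicator {0..<t} s * heat_nn (t - s) (\<lambda>y. ennreal (s powr r) * clipped_source p (W s y)) x \<partial>lborel)
      \<le> ennreal e * ennreal (?S t x)" by (simp add: mult_right_mono)
  then have "picard_op r (clipped_source p) (\<lambda>t x. ennreal (e * p_kernel (1 + t) t x)) W t x
      \<le> ennreal (e * ?S t x) + ennreal (e * ?S t x)"
    unfolding picard_op_def using e(1) by (intro add_left_mono) (simp add: ennreal_mult')
  also have "\<dots> = ennreal (2 * e * ?S t x)"
    using e(1) S0[OF t, of x] by (simp flip: ennreal_plus)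
  finally show ?thesis .
qed

lemma ennreal_abs_diff_le:
  assumes "0 \<le> x" "0 \<le> y" "ennreal x \<le> ennreal y + c" "ennreal y \<le> ennreal x + c"
  shows "ennreal \<bar>x - y\<bar> \<le> c"
proof (cases c)
  case (real a)
  with assms have "x \<le> y + a" "y \<le> x + a" by (simp_all flip: ennreal_plus)
  then show ?thesis using real by (simp add: ennreal_leI abs_le_iff)
qed simp

lemma global_solution_exists:
  assumes r: "0 \<le> r" and p: "1 < p"
    and p_gt: "1 + 2 * \<sigma> * (1 + r) / real DIM('a) < p"
  obtains u0 :: "'a::euclidean_space \<Rightarrow> real" and u where "u0 \<in> C0" "integrable lborel u0" "\<And>x. 0 < u0 x"
    "global_mild_solution \<sigma> (\<lambda>t. t powr r) (log_source p) u0 u"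
proof -
  define \<beta> where "\<beta> = real DIM('a) / (2 * \<sigma>)"
  define \<theta> where "\<theta> = \<beta> * (p - 1) - r - 1"
  have "2 * \<sigma> * (1 + r) < (p - 1) * real DIM('a)" using p_gt by (simp add: field_simps)
  then have \<theta>: "0 < \<theta>" using \<sigma> by (simp add: \<theta>_def \<beta>_def field_simps)
  obtain A where A: "0 < A" "\<And>s (x::'a). 0 \<le> s \<Longrightarrow> p_kernel (1 + s) s x \<le> A * (1 + s) powr (- real DIM('a) / (2 * \<sigma>))"
    using p_kernel_upper by blast
  have A': "p_kernel (1 + s) s x \<le> A * (1 + s) powr (- \<beta>)" if "0 \<le> s" for s and x :: 'a
    using A(2)[OF that, of x] by (simp add: \<beta>_def)
  obtain e where e: "0 < e" "2 * e * A \<le> 1" "2 * (2 * e) powr p * A powr (p - 1) / \<theta> \<le> e"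
  proof -
    define C where "C = 2 * 2 powr p * A powr (p - 1) / \<theta>"
    have C: "0 < C" using A \<theta> by (simp add: C_def)
    \<comment> \<open>The second entry solves C e^(p-1) = 1, the equality case of the third
      condition divided by e; the first entry enforces the second condition.\<close>
    define e where "e = min (1 / (2 * A)) ((1 / C) powr (1 / (p - 1)))"
    have e0: "0 < e" using A C by (simp add: e_def)
    have "e powr (p - 1) \<le> ((1 / C) powr (1 / (p - 1))) powr (p - 1)"
      using e0 p by (intro powr_mono2) (auto simp: e_def)
    also have "\<dots> = 1 / C" using C p by (simp add: powr_powr)
    finally have "C * e powr (p - 1) \<le> 1" using C by (simp add: field_simps)
    then have "C * e powr (p - 1) * e \<le> 1 * e" using e0 by (intro mult_right_mono) auto
    moreover have "C * e powr (p - 1) * e = 2 * (2 * e) powr p * A powr (p - 1) / \<theta>"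
    proof -
      have "e powr p = e powr (p - 1) * e" using e0 powr_add[of e "p - 1" 1] by simp
      then show ?thesis using e0 by (simp add: C_def powr_mult)
    qed
    moreover have "2 * e * A \<le> 1"
    proof -
      have "e \<le> 1 / (2 * A)" by (simp add: e_def)
      then show ?thesis using A by (simp add: field_simps)
    qed
    ultimately show thesis using that[OF e0] by simp
  qed
  let ?S = "\<lambda>s. p_kernel (1 + s) s :: 'a \<Rightarrow> real"
  have S0: "0 \<le> ?S s y" if "0 \<le> s" for s y using that by (intro p_kernel_nonneg) auto
  have v_le: "2 * e * ?S s y \<le> 1" if "0 \<le> s" for s y
  proof -
    have "(1 + s) powr (- \<beta>) \<le> (1 + s) powr 0" using that \<sigma> by (intro powr_mono) (auto simp: \<beta>_def)
    then have "A * (1 + s) powr (- \<beta>) \<le> A * 1" using A(1) that by (intro mult_left_mono) auto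
    then have "2 * e * ?S s y \<le> 2 * e * A" using A'[OF that, of y] e(1) by (intro mult_left_mono) auto
    then show ?thesis using e(2) by linarith
  qed
  define w where "w = (\<lambda>t (x::'a). ennreal (e * ?S t x))"
  \<comment> \<open>Only \<open>t \<ge> 0\<close> matters; the value \<open>\<infinity>\<close> makes \<open>W\<close> a supersolution for all \<open>t\<close>.\<close>
  define W where "W = (\<lambda>t (x::'a). if t < 0 then \<infinity> else ennreal (2 * e * ?S t x))"
  have super: "picard_op r (clipped_source p) w W \<le> W"
  proof (intro le_funI)
    fix t and x :: 'a
    show "picard_op r (clipped_source p) w W t x \<le> W t x"
    proof (cases "t < 0")
      case False
      then have "picard_op r (clipped_source p) w W t x \<le> ennreal (2 * e * ?S t x)"
        unfolding w_def
        by (intro supersolution[OF r p \<beta>_def \<theta>_def \<theta> A(1) A' e]) (auto simp: W_def)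
      then show ?thesis using False by (simp add: W_def)
    qed (simp add: W_def)
  qed
  have w_meas: "case_prod w \<in> borel_measurable (borel \<Otimes>\<^sub>M borel)" unfolding w_def by measurable
  have mono: "mono (clipped_source p)" using p by (intro mono_clipped_source) auto
  obtain V where V: "case_prod V \<in> borel_measurable (borel \<Otimes>\<^sub>M borel)" "picard_op r (clipped_source p) w V = V" "V \<le> W"
    by (rule picard_fixed_point[OF w_meas mono clipped_source_measurable clipped_source_SUP super]) (use p in auto)
  \<comment> \<open>For t \<ge> 0 the fixed point lies below W and hence below 1, so passing to real
    values loses nothing and the clipping is inactive.\<close>
  define u where "u = (\<lambda>t x. enn2real (V t x))"
  have V_le: "V t x \<le> 1" if "0 \<le> t" for t x
  proof -
    have "V t x \<le> W t x" using V(3) by (auto dest: le_funD)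
    also have "\<dots> \<le> ennreal 1" using that v_le[OF that, of x] by (simp add: W_def ennreal_leI del: ennreal_1)
    finally show ?thesis by simp
  qed
  have Vu: "V t x = ennreal (u t x)" if "0 \<le> t" for t x
  proof -
    have "V t x < top" using V_le[OF that, of x] by (rule le_less_trans) simp
    then show ?thesis by (simp add: u_def)
  qed
  have u: "0 \<le> u t x" "u t x \<le> 1" if "0 \<le> t" for t x
  proof -
    show "0 \<le> u t x" by (simp add: u_def)
    show "u t x \<le> 1" using V_le[OF that, of x] unfolding Vu[OF that] by simp
  qed
  define u0 where "u0 = (\<lambda>x::'a. e * ?S 0 x)"
  have u0_eq: "u0 = (\<lambda>x. e * ((4 * pi) powr (- real DIM('a) / 2) * exp (- (1 / 4) * (norm x)\<^sup>2)))"
    unfolding u0_def using p_kernel_gaussian[where 'a='a, of 1] by auto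
  define D where "D = (\<lambda>t x. \<integral>\<^sup>+s. indicator {0..<t} s *
     heat_nn (t - s) (\<lambda>y. ennreal (s powr r) * clipped_source p (V s y)) x \<partial>lborel)"
  have D_eq: "ennreal (u t x) = ennreal (e * ?S t x) + D t x" if "0 \<le> t" for t x
  proof -
    have "V t x = picard_op r (clipped_source p) w V t x" using V(2) by simp
    then show ?thesis unfolding Vu[OF that] picard_op_def w_def D_def .
  qed
  have D_fin: "D t x < \<infinity>" if "0 \<le> t" for t x
  proof -
    have "D t x \<le> ennreal (u t x)" unfolding D_eq[OF that] by simp
    then show ?thesis by (rule le_less_trans) simp
  qed
  have u_eq: "u t x = e * ?S t x + enn2real (D t x)" if "0 \<le> t" for t x
  proof -
    have "ennreal (u t x) = ennreal (e * ?S t x + enn2real (D t x))"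
      using D_eq[OF that, of x] D_fin[OF that, of x] S0[OF that, of x] e(1) by (simp add: less_top)
    then show ?thesis
      by (subst (asm) ennreal_inj) (use u[OF that, of x] S0[OF that, of x] e(1) in auto)
  qed
  show thesis
  proof (rule that[of u0 u])
    show "integrable lborel u0"
      unfolding u0_eq by (intro integrable_mult_right integrable_gaussian) auto
    show "0 < u0 x" for x unfolding u0_eq using e(1) by simp
    have "((\<lambda>x::'a. exp (- (1 / 4) * (norm x)\<^sup>2)) \<longlongrightarrow> 0) at_infinity"
    proof (rule filterlim_compose[OF _ filterlim_norm_at_top])
      show "((\<lambda>z::real. exp (- (1 / 4) * z\<^sup>2)) \<longlongrightarrow> 0) at_top" by real_asymp
    qed
    then have "(u0 \<longlongrightarrow> e * ((4 * pi) powr (- real DIM('a) / 2) * 0)) at_infinity"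
      unfolding u0_eq by (intro tendsto_mult_left)
    then show "u0 \<in> C0"
      unfolding C0_def by (auto simp: u0_eq intro!: continuous_intros)
    have u0m: "u0 \<in> borel_measurable borel" unfolding u0_def by measurable
    have u_meas: "case_prod u \<in> borel_measurable (borel \<Otimes>\<^sub>M borel)"
      using measurable_compose[OF V(1) borel_measurable_enn2real] by (simp add: u_def case_prod_beta')
    have ut_meas: "u t \<in> borel_measurable borel" for t
      using measurable_Pair2[OF u_meas, of t] by simp
    have src: "ennreal (s powr r) * clipped_source p (V s y) = ennreal (s powr r * log_source p (u s y))" if "0 \<le> s" for s y
      using u[OF that, of y] by (simp add: Vu[OF that] clipped_source_eq ennreal_mult')
    define B where "B = (\<lambda>t. t powr r * log_source p 1)"
    have src_le: "s powr r * log_source p (u s y) \<le> B t" if "0 \<le> s" "s \<le> t" for s t y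
      unfolding B_def using that u[OF that(1), of y] r p
      by (intro mult_mono powr_mono2 log_source_mono log_source_nonneg) auto
    \<comment> \<open>Convolving p_t with S(1,0) adds the parameters, so the prescribed first term e
      S(1+t,t) of the iteration is the linear evolution of \<open>u0\<close>.\<close>
    have linear: "heat_semigroup \<sigma> t u0 x = e * ?S t x" if t: "0 < t" for t x
    proof -
      have "heat_nn t (\<lambda>y. ennreal (u0 y)) x
          = ennreal e * (\<integral>\<^sup>+y. ennreal (p_kernel t t (x - y)) * ennreal (p_kernel 1 0 (y - 0)) \<partial>lborel)"
        unfolding heat_nn_def u0_def using e(1)
        by (subst nn_integral_cmult[symmetric]) (auto simp: ennreal_mult' mult_ac)
      also have "\<dots> = ennreal e * ennreal (p_kernel (t + 1) (t + 0) (x - 0))"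
        using t by (subst nn_integral_p_kernel_convolution) auto
      also have "\<dots> = ennreal (e * ?S t x)" using e(1) by (simp add: ennreal_mult' add.commute)
      finally have "heat_nn t (\<lambda>y. ennreal (u0 y)) x = ennreal (e * ?S t x)" .
      moreover have "heat_semigroup \<sigma> t u0 x = enn2real (heat_nn t (\<lambda>y. ennreal (u0 y)) x)"
        using S0[of 0] e(1) by (intro heat_semigroup_eq_heat_nn[OF t u0m] AE_I2) (simp add: u0_def)
      ultimately show ?thesis using e(1) S0[of t x] t by simp
    qed
    have mild: "u t x = heat_semigroup \<sigma> t u0 x + (LINT s:{0..t}|lborel. heat_semigroup \<sigma> (t - s) (\<lambda>y. s powr r * log_source p (u s y)) x)"
      if t: "0 \<le> t" for t x
    proof (cases "t = 0")
      case True
      \<comment> \<open>At t = 0 the integral runs over a single point and the semigroup is the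
        identity by definition.\<close>
      have "(LINT s:{0..0}|lborel. heat_semigroup \<sigma> (0 - s) (\<lambda>y. s powr r * log_source p (u s y)) x) = 0"
        using set_integral_drop_endpoint[of 0 "\<lambda>s. heat_semigroup \<sigma> (0 - s) (\<lambda>y. s powr r * log_source p (u s y)) x" "\<lambda>_. 0"]
        by simp
      moreover have "D 0 x = 0" by (simp add: D_def)
      ultimately show ?thesis using True u_eq[of 0 x] by (simp add: heat_semigroup_def u0_def)
    next
      case False
      with t have t: "0 < t" by simp
      have "(LINT s:{0..t}|lborel. heat_semigroup \<sigma> (t - s) (\<lambda>y. s powr r * log_source p (u s y)) x)
          = enn2real (\<integral>\<^sup>+s. indicator {0..<t} s * heat_nn (t - s) (\<lambda>y. ennreal (s powr r * log_source p (u s y))) x \<partial>lborel)"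
      proof (rule duhamel_integral_eq[OF t, where C = "B t"])
        show "(\<lambda>y. s powr r * log_source p (u s y)) \<in> borel_measurable borel" for s
          using measurable_compose[OF ut_meas log_source_measurable] by simp
        show "(\<lambda>(s, y). s powr r * log_source p (u s y)) \<in> borel_measurable (borel \<Otimes>\<^sub>M borel)"
          using measurable_compose[OF u_meas log_source_measurable[of p]] by (simp add: case_prod_beta')
        show "0 \<le> s powr r * log_source p (u s y)" for s y
          by (simp add: log_source_nonneg u_def)
        show "AE y in lborel. s powr r * log_source p (u s y) \<le> B t" if "0 \<le> s" "s < t" for s
          using src_le[of s t] that by simp
      qed simp
      also have "(\<integral>\<^sup>+s. indicator {0..<t} s * heat_nn (t - s) (\<lambda>y. ennreal (s powr r * log_source p (u s y))) x \<partial>lborel) = D t x"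
        unfolding D_def by (intro nn_integral_cong) (auto simp: indicator_def src)
      finally show ?thesis using u_eq[of t x] linear[OF t, of x] t by simp
    qed
    have cont: "(\<lambda>n. Linf_norm (\<lambda>x. u (X n) x - u t x)) \<longlonglongrightarrow> 0" if t: "0 \<le> t" and X: "\<And>n. 0 \<le> X n" "X \<longlonglongrightarrow> t" for t X
    proof -
      let ?a = "\<lambda>n. (LINT \<xi>::'a|lborel. \<bar>symbol (1 + X n) (X n) \<xi> - symbol (1 + t) t \<xi>\<bar>) / (2 * pi) ^ DIM('a)"
      let ?d = "\<lambda>n. \<integral>\<^sup>+z. ennreal \<bar>duhamel_kernel (X n) z - duhamel_kernel t (z :: real \<times> 'a)\<bar> \<partial>(lborel \<Otimes>\<^sub>M lborel)"
      obtain L0 where L0: "\<And>n. \<bar>X n\<bar> \<le> L0"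
        using convergent_imp_Bseq[OF convergentI[OF X(2)]] by (auto simp: Bseq_def)
      \<comment> \<open>One bound for the whole sequence of times and its limit, so that a single
        constant \<open>B L\<close> controls every source term involved.\<close>
      define L where "L = max L0 t"
      have L: "X n \<le> L" "t \<le> L" for n using L0[of n] by (auto simp: L_def)
      let ?G = "\<lambda>s y. ennreal (s powr r) * clipped_source p (V s y)"
      have G_meas: "case_prod ?G \<in> borel_measurable (borel \<Otimes>\<^sub>M borel)"
        using picard_integrand_measurable[OF V(1) clipped_source_measurable measurable_fst measurable_snd, of r p]
        by (simp add: case_prod_beta')
      have GB: "?G s y \<le> ennreal (B L)" if "0 \<le> s" "s \<le> L" for s y
        unfolding src[OF that(1)] by (rule ennreal_leI[OF src_le[OF that]])
      have D1: "D (X n) x \<le> D t x + ennreal (B L) * ?d n" for n x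
        unfolding D_def by (rule duhamel_term_diff_le[OF G_meas L(1) GB])
      have D2: "D t x \<le> D (X n) x + ennreal (B L) * ?d n" for n x
        unfolding D_def abs_minus_commute[of "duhamel_kernel (X n) _"] by (rule duhamel_term_diff_le[OF G_meas L(2) GB])
      have S: "\<bar>?S (X n) x - ?S t x\<bar> \<le> ?a n" for n x
        using X(1)[of n] t \<sigma> by (intro p_kernel_diff_le integrable_symbol) auto
      have a0: "0 \<le> ?a n" for n by (intro divide_nonneg_nonneg integral_nonneg_AE AE_I2) auto
      have bound: "Linf_norm (\<lambda>x. u (X n) x - u t x) \<le> ennreal (e * ?a n) + ennreal (B L) * ?d n" for n
        unfolding Linf_norm_def
      proof (rule esssup_I)
        show "(\<lambda>x. ennreal \<bar>u (X n) x - u t x\<bar>) \<in> borel_measurable lborel"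
          using ut_meas[of "X n"] ut_meas[of t] by simp
        show "AE x in lborel. ennreal \<bar>u (X n) x - u t x\<bar> \<le> ennreal (e * ?a n) + ennreal (B L) * ?d n"
        proof (rule AE_I2, rule ennreal_abs_diff_le)
          fix x
          show "0 \<le> u (X n) x" "0 \<le> u t x" using u(1) X(1) t by auto
          have *: "ennreal (e * v) \<le> ennreal (e * v') + ennreal (e * ?a n)" if "\<bar>v - v'\<bar> \<le> ?a n" "0 \<le> v'" for v v'
          proof -
            have "e * v \<le> e * (v' + ?a n)" using that e(1) by (intro mult_left_mono) auto
            then have "ennreal (e * v) \<le> ennreal (e * v' + e * ?a n)" by (intro ennreal_leI) (simp add: distrib_left)
            also have "\<dots> = ennreal (e * v') + ennreal (e * ?a n)" using that e(1) a0[of n] by (intro ennreal_plus) auto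
            finally show ?thesis .
          qed
          have "ennreal (u (X n) x) \<le> (ennreal (e * ?S t x) + ennreal (e * ?a n)) + (D t x + ennreal (B L) * ?d n)"
            unfolding D_eq[OF X(1)] by (intro add_mono * D1 S S0 t)
          also have "\<dots> = ennreal (u t x) + (ennreal (e * ?a n) + ennreal (B L) * ?d n)"
            unfolding D_eq[OF t] by (simp add: ac_simps)
          finally show "ennreal (u (X n) x) \<le> ennreal (u t x) + (ennreal (e * ?a n) + ennreal (B L) * ?d n)" .
          have S': "\<bar>?S t x - ?S (X n) x\<bar> \<le> ?a n" using S[of n x] by (simp add: abs_minus_commute)
          have "ennreal (u t x) \<le> (ennreal (e * ?S (X n) x) + ennreal (e * ?a n)) + (D (X n) x + ennreal (B L) * ?d n)"
            unfolding D_eq[OF t] by (intro add_mono * D2 S' S0 X)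
          also have "\<dots> = ennreal (u (X n) x) + (ennreal (e * ?a n) + ennreal (B L) * ?d n)"
            unfolding D_eq[OF X(1)] by (simp add: ac_simps)
          finally show "ennreal (u t x) \<le> ennreal (u (X n) x) + (ennreal (e * ?a n) + ennreal (B L) * ?d n)" .
        qed
      qed
      have "(\<lambda>n. LINT \<xi>::'a|lborel. \<bar>symbol (1 + X n) (X n) \<xi> - symbol (1 + t) t \<xi>\<bar>) \<longlonglongrightarrow> 0"
        by (rule symbol_L1_tendsto[where \<alpha> = 1]) (use X in \<open>auto intro!: tendsto_intros\<close>)
      from tendsto_mult_right_zero[OF tendsto_divide_zero[OF this], of e "(2 * pi) ^ DIM('a)"]
      have "(\<lambda>n. ennreal (e * ?a n)) \<longlonglongrightarrow> ennreal 0" by (rule tendsto_ennrealI)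
      moreover have "(\<lambda>n. ennreal (B L) * ?d n) \<longlonglongrightarrow> ennreal (B L) * 0"
        by (intro ennreal_tendsto_cmult duhamel_kernel_L1_tendsto[OF t X]) simp
      ultimately have lim: "(\<lambda>n. ennreal (e * ?a n) + ennreal (B L) * ?d n) \<longlonglongrightarrow> 0"
        using tendsto_add by fastforce
      show ?thesis
        by (rule tendsto_sandwich[OF _ _ tendsto_const lim]) (use bound in auto)
    qed
    have I: "{t. 0 \<le> t \<and> ereal t < \<infinity>} = {0..}" by auto
    show "global_mild_solution \<sigma> (\<lambda>t. t powr r) (log_source p) u0 u"
      unfolding global_mild_solution_def mild_solution_def Let_def I
    proof (intro conjI ballI)
      fix t :: real assume "t \<in> {0..}"
      then have t: "0 \<le> t" by simp
      have "Linf_norm (u t) \<le> ennreal 1"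
        using u[OF t] by (intro Linf_normI ut_meas AE_I2) auto
      then have "Linf_norm (u t) < \<infinity>" by (rule le_less_trans) simp
      then show "u t \<in> Linf" using ut_meas by (simp add: Linf_def)
      show "AE x in lborel. 0 \<le> u t x" using u(1)[OF t] by simp
      show "((\<lambda>s. Linf_norm (\<lambda>x. u s x - u t x)) \<longlongrightarrow> 0) (at t within {0..})"
        unfolding tendsto_at_iff_sequentially using cont[OF t] by (auto simp: o_def)
      show "AE x in lborel. u t x = heat_semigroup \<sigma> t u0 x +
          (LINT s:{0..t}|lborel. heat_semigroup \<sigma> (t - s) (\<lambda>y. s powr r * log_source p (u s y)) x)"
        using mild[OF t] by simp
    qed simp
  qed
qed

end

theorem corollary1p5:
  fixes \<sigma> r p :: real
  assumes "0 < \<sigma>" "\<sigma> < 1" and "0 \<le> r" and "1 < p"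
  shows "(\<forall>u0 :: 'a::euclidean_space \<Rightarrow> real.
            u0 \<in> C0 \<and> integrable lborel u0 \<and> (\<forall>x. 0 < u0 x) \<longrightarrow>
            \<not> (\<exists>u. global_mild_solution \<sigma> (\<lambda>t. t powr r)
                     (\<lambda>v. (1 + v) * ln (1 + v) powr p) u0 u))
         \<longleftrightarrow> 1 < p \<and> p \<le> 1 + 2 * \<sigma> * (1 + r) / real DIM('a)"
proof -
  interpret fractional_order \<sigma> using assms by unfold_locales
  have src: "(\<lambda>v. (1 + v) * ln (1 + v) powr p) = log_source p"
    by (simp add: log_source_def fun_eq_iff)
  show ?thesis
    unfolding src
  proof (intro iffI conjI assms allI impI notI)
    assume none: "\<forall>u0 :: 'a \<Rightarrow> real. u0 \<in> C0 \<and> integrable lborel u0 \<and> (\<forall>x. 0 < u0 x) \<longrightarrow>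
      \<not> (\<exists>u. global_mild_solution \<sigma> (\<lambda>t. t powr r) (log_source p) u0 u)"
    show "p \<le> 1 + 2 * \<sigma> * (1 + r) / real DIM('a)"
    proof (rule ccontr)
      assume "\<not> p \<le> 1 + 2 * \<sigma> * (1 + r) / real DIM('a)"
      then have "1 + 2 * \<sigma> * (1 + r) / real DIM('a) < p" by simp
      from global_solution_exists[where 'a='a, OF assms(3,4) this] none show False by blast
    qed
  next
    fix u0 :: "'a \<Rightarrow> real"
    assume p: "1 < p \<and> p \<le> 1 + 2 * \<sigma> * (1 + r) / real DIM('a)"
      and u0: "u0 \<in> C0 \<and> integrable lborel u0 \<and> (\<forall>x. 0 < u0 x)"
      and "\<exists>u. global_mild_solution \<sigma> (\<lambda>t. t powr r) (log_source p) u0 u"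
    then obtain u where u: "global_mild_solution \<sigma> (\<lambda>t. t powr r) (log_source p) u0 u" by blast
    obtain U where "nn_global_solution \<sigma> r p u0 U"
      using global_mild_solution_imp_nn[OF assms(3,4) _ _ u] u0 by blast
    from nn_global_solution.no_global_solution[OF this] p show False by blast
  qed
qed

end
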